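(* For each $n\ge 1$ let $G^{(n)}\sim \mathrm{CM}_n(d^{(n)})$ be a configuration model multigraph with degree sequence $d^{(n)}=(d^{(n)}_1,\dots,d^{(n)}_n)\in\mathbb{N}_0^n$, and let $\bar\mu^{(n)}_0(k)=\frac1n|\{i: d^{(n)}_i=k\}|$, $k\in\mathbb{N}_0$, be its empirical degree distribution. Assume that $(d^{(n)})_{n\ge1}$ has asymptotic degree distribution $(\bar\mu_0(k))_{k\in\mathbb{N}_0}$, i.e. $\bar\mu_0$ is a probability distribution on $\mathbb{N}_0$ with $\bar\mu^{(n)}_0(k)\to\bar\mu_0(k)$ as $n\to\infty$ for every $k$, with mean $m:=\sum_{k=0}^\infty k\,\bar\mu_0(k)>0$, and that the second moments converge: $$\sum_{k=0}^\infty k^2\bar\mu^{(n)}_0(k)\xrightarrow[n\to\infty]{}\sum_{k=0}^\infty k^2\bar\mu_0(k)<\infty .$$ Let $(\lambda(k))_{k\in\mathbb{N}_0}$ be a sequence in $(0,\infty)$ (the clock rates) such that $\sum_{k=0}^\infty k\,\lambda(k)\,\bar\mu^{(n)}_0(k)$ is uniformly summable, i.e. there is a sequence $(\epsilon_N)_{N\ge1}$ with $\epsilon_N\to0$ as $N\to\infty$ and $\sum_{k\ge N}k\,\lambda(k)\,\bar\mu_0^{(n)}(k)\le\epsilon_N$ for all $n\ge 1$ and all $N\ge1$. Let $\sigma_{SDA}(G^{(n)})$ be the proportion of vertices in the independent set found by the static degree-aware exploration of $G^{(n)}$ with clock rates $(\lambda(k))_{k\in\mathbb{N}_0}$. Then,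 as $n\to\infty$, in probability, $$\sigma_{SDA}(G^{(n)})\longrightarrow\int_0^\infty\sum_{k=0}^\infty\lambda(k)\,\bar\mu_0(k)\,e^{-\lambda(k)t}\,e^{-k\tau(t)}\,dt,$$ where $\tau(t)$ is the solution of the ODE $$\frac{d\tau}{dt}=\frac1m\sum_{k=1}^\infty k\,\lambda(k)\,\bar\mu_0(k)\,e^{-\lambda(k)t}\,e^{-(k-2)\tau}$$ with initial condition $\tau(0)=0$.
   Context: Configuration model: given a degree sequence $d^{(n)}=(d_1,\dots,d_n)\in\mathbb{N}_0^n$ (with even sum), assign $d_i$ half-edges to vertex $i$, and sequentially pair each half-edge with an unpaired half-edge chosen uniformly at random until none are left (equivalently, take a uniformly random perfect matching of the half-edges). Each pair of matched half-edges forms an edge between the corresponding vertices. The result is a random multigraph (self-loops and multiple edges are allowed), whose law is denoted $\mathrm{CM}_n(d^{(n)})$. Static degree-aware exploration of a (multi)graph $G$ on $n$ vertices with clock rates $(\lambda(k))_{k\in\mathbb{N}_0}$: at each time $t\ge0$ every vertex is in one of three states: active, blocked or unexplored. At time $0$ all vertices are unexplored. Each vertex $v$ carries an independent exponential clock of rate $\lambda(d_v)$, where $d_v$ is its initial degree (its degree in the full graph $G$); the rate is constant in time. The clocks are independent of $G$ given the degrees. When the clock of a vertex that is still unexplored rings, that vertex becomes active and all of its neighbours that are still unexplored become blocked. Clocks of blocked vertices have no effect. The process ends when no unexplored vertices remain. The set of active vertices at the end is the (maximal) independent set found by the exploration, and $\sigma_{SDA}(G)$ denotes its cardinality divided by $n$.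 (For the configuration model, the graph may equivalently be constructed simultaneously with the exploration, by matching the half-edges of a vertex uniformly at random when it is activated.) *)

theory Defs
  imports "HOL-Probability.Probability" "HOL-Library.Disjoint_Sets" "HOL-Library.Multiset"
begin

text \<open>A multigraph on the vertices \<open>{..<n}\<close> is the multiset of its edges, an edge being its set of
  end points. A self-loop at \<open>v\<close> is the singleton \<open>{v}\<close> and contributes two to the degree of \<open>v\<close>.\<close>

definition multigraph_degree :: "nat set multiset \<Rightarrow> nat \<Rightarrow> nat" where
  "multigraph_degree E v = size {#e \<in># E. v \<in> e#} + count E {v}"


subsection \<open>Configuration model\<close>

definition half_edges :: "nat \<Rightarrow> (nat \<Rightarrow> nat) \<Rightarrow> (nat \<times> nat) set" where
  "half_edges n d = (SIGMA v:{..<n}. {..<d v})"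

definition perfect_matchings :: "'a set \<Rightarrow> 'a set set set" where
  "perfect_matchings H = {M. partition_on H M \<and> (\<forall>e\<in>M. card e = 2)}"

definition matching_multigraph :: "(nat \<times> nat) set set \<Rightarrow> nat set multiset" where
  "matching_multigraph M = image_mset (\<lambda>e. fst ` e) (mset_set M)"

text \<open>Only meaningful if the sum of the degrees is even: otherwise there is no perfect matching and
  \<^const>\<open>pmf_of_set\<close> is unspecified.\<close>

definition configuration_model :: "nat \<Rightarrow> (nat \<Rightarrow> nat) \<Rightarrow> nat set multiset pmf" where
  "configuration_model n d =
     map_pmf matching_multigraph (pmf_of_set (perfect_matchings (half_edges n d)))"

definition empirical_degree_distribution :: "nat \<Rightarrow> (nat \<Rightarrow> nat) \<Rightarrow> nat \<Rightarrow> real" where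
  "empirical_degree_distribution n d k = real (card {i \<in> {..<n}. d i = k}) / real n"

lemma finite_half_edges: "finite (half_edges n d)"
  by (simp add: half_edges_def)

text \<open>The prescribed degrees are the degrees in the multigraph, so a clock rate may be given in terms
  of either.\<close>

lemma multigraph_degree_configuration_model:
  assumes M: "M \<in> perfect_matchings (half_edges n d)" and v: "v < n"
  shows "multigraph_degree (matching_multigraph M) v = d v"
proof -
  let ?H = "half_edges n d"
  have part: "partition_on ?H M" and c2: "\<And>e. e \<in> M \<Longrightarrow> card e = 2"
    using M by (auto simp: perfect_matchings_def)
  have finM: "finite M"
    using part finite_half_edges finite_elements by blast
  have fine: "finite e" if "e \<in> M" for e
    using c2[OF that] by (metis card.infinite zero_neq_numeral)
  have key: "card {h \<in> e. fst h = v} = (if v \<in> fst ` e then 1 else 0) + (if fst ` e = {v} then 1 else 0)"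
    if e: "e \<in> M" for e
  proof -
    obtain a b where ab: "e = {a, b}" "a \<noteq> b"
      using c2[OF e] by (meson card_2_iff)
    have "{h \<in> e. fst h = v} = (if fst a = v then {a} else {}) \<union> (if fst b = v then {b} else {})"
      using ab by auto
    then show ?thesis
      using ab by auto
  qed
  have "d v = card {h \<in> ?H. fst h = v}"
  proof -
    have "{h \<in> ?H. fst h = v} = Pair v ` {..<d v}"
      using v by (auto simp: half_edges_def)
    then show ?thesis
      by (simp add: card_image inj_on_def)
  qed
  also have "{h \<in> ?H. fst h = v} = (\<Union>e\<in>M. {h \<in> e. fst h = v})"
    using part by (auto simp: partition_on_def)
  also have "card \<dots> = (\<Sum>e\<in>M. card {h \<in> e. fst h = v})"
  proof (rule card_UN_disjoint)
    show "\<forall>e\<in>M. \<forall>e'\<in>M. e \<noteq> e' \<longrightarrow> {h \<in> e. fst h = v} \<inter> {h \<in> e'. fst h = v} = {}"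
      using part unfolding partition_on_def disjoint_def by blast
  qed (use finM fine in auto)
  also have "\<dots> = (\<Sum>e\<in>M. (if v \<in> fst ` e then 1 else 0) + (if fst ` e = {v} then 1 else 0))"
    by (intro sum.cong refl key)
  also have "\<dots> = card {e \<in> M. v \<in> fst ` e} + card {e \<in> M. fst ` e = {v}}"
    using finM by (simp add: sum.distrib sum.If_cases Int_def)
  also have "\<dots> = multigraph_degree (matching_multigraph M) v"
    using finM
    by (simp add: multigraph_degree_def matching_multigraph_def filter_mset_image_mset
        count_image_mset_eq_card_vimage)
  finally show ?thesis ..
qed


subsection \<open>Static degree-aware exploration\<close>

datatype vertex_state = Unexplored | Active | Blocked

definition ring_clock :: "nat set multiset \<Rightarrow> nat \<Rightarrow> (nat \<Rightarrow> vertex_state) \<Rightarrow> nat \<Rightarrow> vertex_state" where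
  "ring_clock E v s =
     (if s v = Unexplored
      then (\<lambda>u. if u = v then Active
                else if {v, u} \<in># E \<and> s u = Unexplored then Blocked
                else s u)
      else s)"

text \<open>The state at time \<open>t\<close> if the clock of vertex \<open>v\<close> rings at time \<open>T v\<close>: the clocks that have rung
  are processed in the order of their ringing times. The sort is stable, so simultaneous rings, which
  have probability zero, are processed in the order of the labels.\<close>

definition exploration_state ::
    "nat \<Rightarrow> nat set multiset \<Rightarrow> (nat \<Rightarrow> real) \<Rightarrow> real \<Rightarrow> nat \<Rightarrow> vertex_state" where
  "exploration_state n E T t =
     fold (ring_clock E) (filter (\<lambda>v. T v \<le> t) (sort_key T [0..<n])) (\<lambda>_. Unexplored)"

text \<open>No state changes once there is no unexplored vertex left, so the state at the end of the
  exploration is the one at all large times.\<close>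

definition final_active_set :: "nat \<Rightarrow> nat set multiset \<Rightarrow> (nat \<Rightarrow> real) \<Rightarrow> nat set" where
  "final_active_set n E T =
     {v \<in> {..<n}. \<forall>\<^sub>F t in at_top. exploration_state n E T t v = Active}"

definition sda_proportion :: "nat \<Rightarrow> nat set multiset \<times> (nat \<Rightarrow> real) \<Rightarrow> real" where
  "sda_proportion n = (\<lambda>(E, T). real (card (final_active_set n E T)) / real n)"

text \<open>The joint law of the multigraph and the clocks. The clock rates depend on the multigraph only
  through the degrees, which are deterministic, so this is a product measure.\<close>

definition sda_measure ::
    "nat \<Rightarrow> (nat \<Rightarrow> nat) \<Rightarrow> (nat \<Rightarrow> real) \<Rightarrow> (nat set multiset \<times> (nat \<Rightarrow> real)) measure" where
  "sda_measure n d rate =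
     measure_pmf (configuration_model n d) \<Otimes>\<^sub>M
     (\<Pi>\<^sub>M v\<in>{..<n}. density lborel (exponential_density (rate (d v))))"


subsection \<open>Convergence in probability to a constant\<close>

text \<open>The random variables may live on different probability spaces. Measurability is part of the
  notion, as \<^const>\<open>measure\<close> is zero on non-measurable sets.\<close>

definition converges_in_probability ::
    "(nat \<Rightarrow> 'a measure) \<Rightarrow> (nat \<Rightarrow> 'a \<Rightarrow> real) \<Rightarrow> real \<Rightarrow> bool" where
  "converges_in_probability P X c \<longleftrightarrow>
     (\<forall>n\<ge>1. prob_space (P n) \<and> X n \<in> borel_measurable (P n)) \<and>
     (\<forall>\<epsilon>>0. (\<lambda>n. measure (P n) {\<omega> \<in> space (P n). \<bar>X n \<omega> - c\<bar> > \<epsilon>}) \<longlonglongrightarrow> 0)"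

end

theory Submission
  imports Defs "HOL-Combinatorics.Permutations"
begin

text \<open>Decide whether a vertex becomes active by asking its neighbours with earlier clocks whether they
  became active, and so on. Stopping this recursion after \<open>j\<close> rounds bounds the active set from above
  or below according to the parity of \<open>j\<close>; vertices of degree above a cutoff \<open>K\<close> are replaced by the
  trivial bound of the same parity, so that every answer depends on a bounded number of half-edges.
  The proportion of half-edges with a given answer is then concentrated, because a switch of two edges
  or the change of one clock affects boundedly many answers. Its mean satisfies an asymptotic
  recursion, because re-matching the half-edges of a vertex with uniform independent ones preserves the
  uniform matching and rarely affects the answers. The recursion is the Picard iteration for
  \<open>q(t) = 1 - (1/m) \<Sum>k. k \<mu>(k) \<integral>s<t. \<lambda>(k) exp(-\<lambda>(k) s) q(s)^(k-1) ds\<close>, which is the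
  differential equation for \<open>\<tau>\<close> in the variable \<open>q = exp(-\<tau>)\<close>. It converges by the bound
  \<open>L^j / j!\<close> with \<open>L\<close> at most the second moment divided by \<open>m\<close>, up to an error from the cutoff
  that vanishes as \<open>K \<rightarrow> \<infinity>\<close>.\<close>

section \<open>Averages over perfect matchings\<close>

text \<open>Degrees are unbounded, so without a cutoff one switch or one clock could alter a number
  of answers that grows with \<open>n\<close>, too many for bounded differences. The cutoff costs a
  multiple of the tails of \<mu> and of the size-biased law \<open>k * \<mu> k / m\<close>, the
  degree law at a random half-edge. The second moments act twice. Their boundedness along the
  sequence keeps half-edges from escaping to large degrees, so the number of half-edges per vertex
  tends to \<open>m\<close>. Their finiteness in the limit controls the Lipschitz constant
  \<open>k - 1\<close> of \<open>x ^ (k - 1)\<close> under the size-biased law: integrated against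
  the exponential densities it gives a bounded total over the whole half-line, whatever the rates,
  so the iteration converges uniformly in time. Uniform summability of the rates makes
  \<open>k * rate k * \<mu> k\<close> summable, which dominates the series in the differential
  equation and lets it be integrated term by term.\<close>

definition avg :: "'a set \<Rightarrow> ('a \<Rightarrow> real) \<Rightarrow> real" where
  "avg A f = (\<Sum>x\<in>A. f x) / real (card A)"

lemma avg_add: "avg A (\<lambda>x. f x + g x) = avg A f + avg A g"
  by (simp add: avg_def sum.distrib add_divide_distrib)

lemma avg_diff: "avg A (\<lambda>x. f x - g x) = avg A f - avg A g"
  by (simp add: avg_def sum_subtractf diff_divide_distrib)

lemma avg_cmult: "avg A (\<lambda>x. c * f x) = c * avg A f"
  by (simp add: avg_def sum_distrib_left)

lemma avg_divide: "avg A (\<lambda>x. f x / c) = avg A f / c"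
  by (simp add: avg_def sum_divide_distrib mult.commute)

lemma avg_sum: "avg A (\<lambda>x. \<Sum>i\<in>B. f i x) = (\<Sum>i\<in>B. avg A (f i))"
  unfolding avg_def by (subst sum.swap) (simp add: sum_divide_distrib)

lemma avg_const: "finite A \<Longrightarrow> A \<noteq> {} \<Longrightarrow> avg A (\<lambda>x. c) = c"
  by (simp add: avg_def)

lemma avg_mono: "(\<And>x. x \<in> A \<Longrightarrow> f x \<le> g x) \<Longrightarrow> avg A f \<le> avg A g"
  by (simp add: avg_def divide_right_mono sum_mono)

lemma avg_cong: "(\<And>x. x \<in> A \<Longrightarrow> f x = g x) \<Longrightarrow> avg A f = avg A g"
  by (simp add: avg_def)

lemma avg_nonneg: "(\<And>x. x \<in> A \<Longrightarrow> 0 \<le> f x) \<Longrightarrow> 0 \<le> avg A f"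
  by (simp add: avg_def sum_nonneg)

lemma abs_avg_le: "\<bar>avg A f\<bar> \<le> avg A (\<lambda>x. \<bar>f x\<bar>)"
  by (simp add: avg_def abs_divide divide_right_mono)

lemma abs_avg_diff_le: "\<bar>avg A f - avg A g\<bar> \<le> avg A (\<lambda>x. \<bar>f x - g x\<bar>)"
  using abs_avg_le[of A "\<lambda>x. f x - g x"] by (simp add: avg_diff)

lemma avg_le_const:
  assumes "\<And>x. x \<in> A \<Longrightarrow> f x \<le> c" "0 \<le> c"
  shows "avg A f \<le> c"
proof (cases "finite A \<and> A \<noteq> {}")
  case True
  then show ?thesis
    using avg_mono[of A f "\<lambda>_. c"] assms by (simp add: avg_const)
qed (use assms in \<open>auto simp: avg_def\<close>)

lemma avg_Times:
  "avg (A \<times> B) f = avg A (\<lambda>x. avg B (\<lambda>y. f (x, y)))"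
  by (simp add: avg_def card_cartesian_product sum.cartesian_product sum_divide_distrib
      case_prod_beta mult.commute)

lemma avg_reindex_bij:
  assumes "bij_betw h A B"
  shows "avg A (\<lambda>x. f (h x)) = avg B f"
  unfolding avg_def using sum.reindex_bij_betw[OF assms, of f] bij_betw_same_card[OF assms] by simp

text \<open>The parallel axis identity: deviations from the mean sum to zero, so the cross term
  disappears. It allows any convenient centre \<open>y\<close> in place of the mean.\<close>

lemma sum_square_deviation:
  assumes "finite A"
  shows "(\<Sum>x\<in>A. (f x - y)\<^sup>2) = (\<Sum>x\<in>A. (f x - avg A f)\<^sup>2) + real (card A) * (avg A f - y)\<^sup>2"
proof -
  have s: "(\<Sum>x\<in>A. f x) = real (card A) * avg A f"
    using assms by (cases "A = {}") (simp_all add: avg_def)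
  have "(f x - y)\<^sup>2 = (f x - avg A f)\<^sup>2 + (avg A f - y)\<^sup>2 + 2 * (avg A f - y) * (f x - avg A f)" for x
    by (simp add: power2_eq_square algebra_simps)
  then have "(\<Sum>x\<in>A. (f x - y)\<^sup>2) = (\<Sum>x\<in>A. (f x - avg A f)\<^sup>2) + real (card A) * (avg A f - y)\<^sup>2
      + 2 * (avg A f - y) * (\<Sum>x\<in>A. f x - avg A f)"
    by (simp add: sum.distrib sum_distrib_left)
  then show ?thesis
    by (simp add: sum_subtractf s)
qed

text \<open>A perfect matching is encoded as the involution that sends each half-edge to its partner.\<close>

definition involutions :: "'a set \<Rightarrow> ('a \<Rightarrow> 'a) set" where
  "involutions U = {\<phi>. \<phi> permutes U \<and> (\<forall>x. \<phi> (\<phi> x) = x) \<and> (\<forall>x\<in>U. \<phi> x \<noteq> x)}"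

text \<open>Conjugation by a transposition merely relabels \<open>a\<close> and \<open>b\<close>,
  hence keeps involutions without fixed points. On a matching it exchanges the partners of
  \<open>a\<close> and \<open>b\<close>, and changes nothing if they are partners of each
  other.\<close>

definition switch :: "'a \<Rightarrow> 'a \<Rightarrow> ('a \<Rightarrow> 'a) \<Rightarrow> ('a \<Rightarrow> 'a)" where
  "switch a b \<phi> = Transposition.transpose a b \<circ> \<phi> \<circ> Transposition.transpose a b"

lemma finite_involutions: "finite U \<Longrightarrow> finite (involutions U)"
  unfolding involutions_def by (rule finite_subset[OF _ finite_permutations]) auto

lemma involutionsD:
  assumes "\<phi> \<in> involutions U"
  shows "\<phi> permutes U" "\<phi> (\<phi> x) = x" "x \<in> U \<Longrightarrow> \<phi> x \<noteq> x" "x \<in> U \<Longrightarrow> \<phi> x \<in> U" "x \<notin> U \<Longrightarrow> \<phi> x = x"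
  using assms by (auto simp: involutions_def permutes_in_image permutes_not_in)

lemma involution_eq_iff: "\<phi> \<in> involutions U \<Longrightarrow> \<phi> x = y \<longleftrightarrow> x = \<phi> y"
  using involutionsD(2) by metis

lemma switch_involutions:
  assumes "\<phi> \<in> involutions U" "a \<in> U" "b \<in> U"
  shows "switch a b \<phi> \<in> involutions U"
proof -
  have t: "Transposition.transpose a b permutes U"
    using assms by (simp add: permutes_swap_id)
  have "switch a b \<phi> permutes U"
    unfolding switch_def using t involutionsD(1)[OF assms(1)] by (intro permutes_compose)
  moreover have "switch a b \<phi> (switch a b \<phi> x) = x" for x
    using involutionsD(2)[OF assms(1)] by (simp add: switch_def)
  moreover have "switch a b \<phi> x \<noteq> x" if "x \<in> U" for x
  proof
    assume "switch a b \<phi> x = x"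
    then have "\<phi> (Transposition.transpose a b x) = Transposition.transpose a b x"
      by (metis comp_apply switch_def transpose_involutory)
    moreover have "Transposition.transpose a b x \<in> U"
      using t that by (simp add: permutes_in_image)
    ultimately show False
      using involutionsD(3)[OF assms(1)] by blast
  qed
  ultimately show ?thesis
    by (simp add: involutions_def)
qed

lemma switch_switch: "switch a b (switch a b \<phi>) = \<phi>"
  by (simp add: switch_def fun_eq_iff)

lemma switch_commute: "switch a b \<phi> = switch b a \<phi>"
  by (simp add: switch_def transpose_commute)

lemma switch_differs:
  assumes "\<phi> \<in> involutions U" "switch a b \<phi> x \<noteq> \<phi> x"
  shows "x \<in> {a, b, \<phi> a, \<phi> b}"
proof (rule ccontr)
  assume "x \<notin> {a, b, \<phi> a, \<phi> b}"
  then have "Transposition.transpose a b x = x" "Transposition.transpose a b (\<phi> x) = \<phi> x"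
    using involution_eq_iff[OF assms(1)] by (auto simp: transpose_eq_iff Transposition.transpose_def)
  then show False
    using assms(2) by (simp add: switch_def)
qed

section \<open>Matchings with a prescribed partner of one half-edge\<close>

definition fiber :: "'a set \<Rightarrow> 'a \<Rightarrow> 'a \<Rightarrow> ('a \<Rightarrow> 'a) set" where
  "fiber U h a = {\<phi> \<in> involutions U. \<phi> h = a}"

text \<open>The transposition leaves \<open>h\<close> alone, so its partner is renamed from
  \<open>a\<close> to \<open>b\<close>. All fibers over \<open>h\<close> thus have the same
  size.\<close>

lemma bij_betw_switch_fiber:
  assumes "h \<in> U" "a \<in> U - {h}" "b \<in> U - {h}"
  shows "bij_betw (switch a b) (fiber U h a) (fiber U h b)"
proof (rule bij_betw_byWitness[where f' = "switch a b"])
  show "switch a b ` fiber U h a \<subseteq> fiber U h b" "switch a b ` fiber U h b \<subseteq> fiber U h a"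
    using assms switch_involutions[of _ U a b] by (auto simp: fiber_def switch_def Transposition.transpose_def)
qed (auto simp: switch_switch)

text \<open>Members of \<open>involutions\<close> are the identity off their set, so \<psi> fixes
  \<open>h\<close> and \<open>a\<close>, and composing with the transposition inserts or removes
  exactly this pair.\<close>

lemma bij_betw_fiber:
  assumes "h \<in> U" "a \<in> U - {h}"
  shows "bij_betw (\<lambda>\<psi>. \<psi> \<circ> Transposition.transpose h a) (involutions (U - {h, a})) (fiber U h a)"
proof (rule bij_betw_byWitness[where f' = "\<lambda>\<phi>. \<phi> \<circ> Transposition.transpose h a"])
  show "\<forall>\<psi>\<in>involutions (U - {h, a}). \<psi> \<circ> Transposition.transpose h a \<circ> Transposition.transpose h a = \<psi>"
    by (simp add: comp_assoc)
  show "\<forall>\<psi>\<in>fiber U h a. \<psi> \<circ> Transposition.transpose h a \<circ> Transposition.transpose h a = \<psi>"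
    by (simp add: comp_assoc)
  have t: "Transposition.transpose h a permutes U"
    using assms by (simp add: permutes_swap_id)
  show "(\<lambda>\<psi>. \<psi> \<circ> Transposition.transpose h a) ` involutions (U - {h, a}) \<subseteq> fiber U h a"
  proof clarify
    fix \<psi> assume \<psi>: "\<psi> \<in> involutions (U - {h, a})"
    note D = involutionsD[OF \<psi>]
    have fixp: "\<psi> h = h" "\<psi> a = a"
      using D(5) by auto
    have "\<psi> permutes U"
      using D(1) by (rule permutes_subset) auto
    then have 1: "(\<psi> \<circ> Transposition.transpose h a) permutes U"
      using t by (rule permutes_compose[rotated])
    have 2: "(\<psi> \<circ> Transposition.transpose h a) ((\<psi> \<circ> Transposition.transpose h a) x) = x" for x
    proof (cases "x = h \<or> x = a")
      case False
      then have "\<psi> x \<noteq> h" "\<psi> x \<noteq> a"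
        using D(2) fixp by metis+
      with False show ?thesis
        by (simp add: D(2))
    qed (auto simp: fixp)
    have 3: "(\<psi> \<circ> Transposition.transpose h a) x \<noteq> x" if "x \<in> U" for x
      using that D(3)[of x] fixp assms by (cases "x = h \<or> x = a") auto
    show "\<psi> \<circ> Transposition.transpose h a \<in> fiber U h a"
      using 1 2 3 fixp by (simp add: fiber_def involutions_def)
  qed
  show "(\<lambda>\<phi>. \<phi> \<circ> Transposition.transpose h a) ` fiber U h a \<subseteq> involutions (U - {h, a})"
  proof clarify
    fix \<phi> assume "\<phi> \<in> fiber U h a"
    then have \<phi>: "\<phi> \<in> involutions U" and ha: "\<phi> h = a"
      by (auto simp: fiber_def)
    note D = involutionsD[OF \<phi>]
    have ah: "\<phi> a = h"
      using D(2) ha by auto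
    have "(\<phi> \<circ> Transposition.transpose h a) permutes U"
      using D(1) t by (rule permutes_compose[rotated])
    then have 1: "(\<phi> \<circ> Transposition.transpose h a) permutes (U - {h, a})"
      by (rule permutes_superset) (auto simp: ha ah)
    have 2: "(\<phi> \<circ> Transposition.transpose h a) ((\<phi> \<circ> Transposition.transpose h a) x) = x" for x
    proof (cases "x = h \<or> x = a")
      case False
      then have "\<phi> x \<noteq> h" "\<phi> x \<noteq> a"
        using D(2) ha ah by metis+
      with False show ?thesis
        by (simp add: D(2))
    qed (auto simp: ha ah)
    have 3: "(\<phi> \<circ> Transposition.transpose h a) x \<noteq> x" if "x \<in> U - {h, a}" for x
      using that D(3)[of x] by auto
    show "\<phi> \<circ> Transposition.transpose h a \<in> involutions (U - {h, a})"
      using 1 2 3 by (simp add: involutions_def)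
  qed
qed

lemma involutions_eq_fibers:
  assumes "h \<in> U"
  shows "involutions U = (\<Union>a\<in>U - {h}. fiber U h a)"
  using involutionsD(3,4)[OF _ assms] by (auto simp: fiber_def)

lemma involutions_nonempty:
  assumes "finite U" "even (card U)"
  shows "involutions U \<noteq> {}"
  using assms
proof (induction "card U" arbitrary: U rule: less_induct)
  case less
  show ?case
  proof (cases "U = {}")
    case True
    then have "id \<in> involutions U"
      by (simp add: involutions_def)
    then show ?thesis by blast
  next
    case False
    then obtain h where h: "h \<in> U" by blast
    have "U \<noteq> {h}"
      using less.prems by auto
    then obtain a where a: "a \<in> U - {h}"
      using h by blast
    have c: "card (U - {h, a}) = card U - 2"
      using h a less.prems by (subst card_Diff_subset) auto
    have "card U > 0"
      using h less.prems card_gt_0_iff by blast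
    then have "involutions (U - {h, a}) \<noteq> {}"
      using less.prems by (intro less.hyps) (auto simp: c)
    then have "fiber U h a \<noteq> {}"
      using bij_betw_fiber[OF h a] by (auto simp: bij_betw_def)
    then show ?thesis
      by (auto simp: fiber_def)
  qed
qed

text \<open>Transpositions of disjoint pairs commute. Switches among the remaining half-edges are
  thus switches of the extended matching, which hands the bounded differences down the
  induction.\<close>

lemma switch_extend:
  assumes "b \<notin> {h, a}" "c \<notin> {h, a}"
  shows "switch b c (\<psi> \<circ> Transposition.transpose h a) = switch b c \<psi> \<circ> Transposition.transpose h a"
proof
  fix x
  have "Transposition.transpose h a (Transposition.transpose b c x) = Transposition.transpose b c (Transposition.transpose h a x)"
    using assms by (auto simp: Transposition.transpose_def)
  then show "switch b c (\<psi> \<circ> Transposition.transpose h a) x = (switch b c \<psi> \<circ> Transposition.transpose h a) x"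
    by (simp add: switch_def)
qed

text \<open>Reveal the partner of one half-edge \<open>h\<close>: a switch turns the matchings with partner \<open>a\<close> into those
  with partner \<open>b\<close>, so the conditional means differ by at most \<open>c\<close>, and what remains is a uniform
  matching of the other half-edges.\<close>

lemma variance_involutions_le:
  fixes F :: "('a \<Rightarrow> 'a) \<Rightarrow> real"
  assumes "finite U"
    and "\<And>\<phi> a b. \<phi> \<in> involutions U \<Longrightarrow> a \<in> U \<Longrightarrow> b \<in> U \<Longrightarrow> \<bar>F (switch a b \<phi>) - F \<phi>\<bar> \<le> c"
  shows "(\<Sum>\<phi>\<in>involutions U. (F \<phi> - avg (involutions U) F)\<^sup>2)
      \<le> c\<^sup>2 * real (card U) * real (card (involutions U))"
  using assms
proof (induction "card U" arbitrary: U F rule: less_induct)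
  case less
  note fin = less.prems(1) and lip = less.prems(2)
  show ?case
  proof (cases "U = {} \<or> involutions U = {}")
    case True
    then show ?thesis
    proof
      assume "U = {}"
      then have "involutions U = {id}"
        by (auto simp: involutions_def)
      then show ?thesis
        by (simp add: avg_def)
    qed simp
  next
    case False
    then obtain h where h: "h \<in> U" by blast
    obtain a0 where a0: "a0 \<in> U - {h}"
      using False involutions_eq_fibers[OF h] by auto
    \<comment> \<open>One fiber serves as reference: its mean \<open>?y\<close> replaces the overall
      mean as centre, which can only increase the sum of squares.\<close>
    let ?N = "card (fiber U h a0)" and ?y = "avg (fiber U h a0) F"
    have finf: "finite (fiber U h a)" for a
      using finite_involutions[OF fin] by (simp add: fiber_def)
    have N: "card (fiber U h a) = ?N" if "a \<in> U - {h}" for a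
      using bij_betw_same_card[OF bij_betw_switch_fiber[OF h a0 that]] by simp
    have cU: "card U = card (U - {h}) + 1"
      using h fin by (metis Suc_eq_plus1 card_Suc_Diff1)
    have disj: "disjoint_family_on (fiber U h) (U - {h})"
      by (auto simp: disjoint_family_on_def fiber_def)
    have part: "(\<Sum>\<phi>\<in>involutions U. f \<phi>) = (\<Sum>a\<in>U - {h}. \<Sum>\<phi>\<in>fiber U h a. f \<phi>)" for f :: "_ \<Rightarrow> real"
      unfolding involutions_eq_fibers[OF h]
      using fin finf disj by (intro sum.UNION_disjoint) (auto simp: disjoint_family_on_def)
    have cI: "real (card (involutions U)) = real (card (U - {h})) * real ?N"
      using part[of "\<lambda>_. 1"] N by simp
    have bound: "(\<Sum>\<phi>\<in>fiber U h a. (F \<phi> - ?y)\<^sup>2) \<le> c\<^sup>2 * real (card U) * real ?N"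
      if a: "a \<in> U - {h}" for a
    proof -
      have c2: "card (U - {h, a}) = card U - 2" "card U \<ge> 2"
      proof -
        show "card (U - {h, a}) = card U - 2"
          using h a fin by (subst card_Diff_subset) auto
        have "card {h, a} \<le> card U"
          using h a fin by (intro card_mono) auto
        then show "card U \<ge> 2"
          using a by auto
      qed
      let ?E = "\<lambda>\<psi>. \<psi> \<circ> Transposition.transpose h a"
      let ?J = "involutions (U - {h, a})"
      note bij = bij_betw_fiber[OF h a]
      have av: "avg ?J (\<lambda>\<psi>. F (?E \<psi>)) = avg (fiber U h a) F"
        by (rule avg_reindex_bij[OF bij])
      have "(\<Sum>\<phi>\<in>fiber U h a. (F \<phi> - avg (fiber U h a) F)\<^sup>2)
          = (\<Sum>\<psi>\<in>?J. (F (?E \<psi>) - avg ?J (\<lambda>\<psi>. F (?E \<psi>)))\<^sup>2)"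
        unfolding av by (rule sum.reindex_bij_betw[OF bij, symmetric])
      also have "\<dots> \<le> c\<^sup>2 * real (card (U - {h, a})) * real (card ?J)"
      proof (rule less.hyps)
        show "card (U - {h, a}) < card U"
          using c2 by simp
        fix \<psi> b e assume *: "\<psi> \<in> ?J" "b \<in> U - {h, a}" "e \<in> U - {h, a}"
        have "?E \<psi> \<in> involutions U"
          using bij * by (auto simp: bij_betw_def fiber_def)
        then show "\<bar>F (?E (switch b e \<psi>)) - F (?E \<psi>)\<bar> \<le> c"
          using lip[of "?E \<psi>" b e] * switch_extend[of b h a e \<psi>] by auto
      qed (use fin in auto)
      also have "card ?J = ?N"
        using bij_betw_same_card[OF bij] N[OF a] by simp
      finally have 1: "(\<Sum>\<phi>\<in>fiber U h a. (F \<phi> - avg (fiber U h a) F)\<^sup>2)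
          \<le> c\<^sup>2 * real (card U - 2) * real ?N"
        using c2 by simp
      have "\<bar>avg (fiber U h a) F - ?y\<bar> \<le> c"
      proof -
        have "?y = avg (fiber U h a) (\<lambda>\<phi>. F (switch a a0 \<phi>))"
          using avg_reindex_bij[OF bij_betw_switch_fiber[OF h a a0]] by metis
        then have "\<bar>avg (fiber U h a) F - ?y\<bar> \<le> avg (fiber U h a) (\<lambda>\<phi>. \<bar>F \<phi> - F (switch a a0 \<phi>)\<bar>)"
          using abs_avg_diff_le by metis
        also have "\<dots> \<le> c"
        proof (rule avg_le_const)
          fix \<phi> assume "\<phi> \<in> fiber U h a"
          then show "\<bar>F \<phi> - F (switch a a0 \<phi>)\<bar> \<le> c"
            using lip[of \<phi> a a0] a a0 by (auto simp: fiber_def abs_minus_commute)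
        next
          obtain \<phi> where "\<phi> \<in> involutions U"
            using False by blast
          then show "0 \<le> c"
            using lip[of \<phi> h h] h by linarith
        qed
        finally show ?thesis .
      qed
      then have 2: "(avg (fiber U h a) F - ?y)\<^sup>2 \<le> c\<^sup>2"
        by (metis power_mono abs_ge_zero power2_abs)
      \<comment> \<open>Inside a fiber \<open>card U - 2\<close> half-edges are still to be matched;
        moving the centre from the mean of this fiber to \<open>?y\<close> adds one more
        \<open>c\<^sup>2\<close>.\<close>
      have "(\<Sum>\<phi>\<in>fiber U h a. (F \<phi> - ?y)\<^sup>2) \<le> c\<^sup>2 * real (card U - 2) * real ?N + real ?N * c\<^sup>2"
        using sum_square_deviation[OF finf, of F ?y a, unfolded N[OF a]] 1
          mult_left_mono[OF 2 of_nat_0_le_iff, of ?N] by linarith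
      also have "\<dots> = c\<^sup>2 * real ?N * (real (card U - 2) + 1)"
        by (simp add: algebra_simps)
      also have "\<dots> \<le> c\<^sup>2 * real ?N * real (card U)"
        using c2 by (intro mult_left_mono) auto
      finally show ?thesis
        by (simp add: mult_ac)
    qed
    have "(\<Sum>\<phi>\<in>involutions U. (F \<phi> - avg (involutions U) F)\<^sup>2) \<le> (\<Sum>\<phi>\<in>involutions U. (F \<phi> - ?y)\<^sup>2)"
      using sum_square_deviation[OF finite_involutions[OF fin], of F ?y] by simp
    also have "\<dots> \<le> (\<Sum>a\<in>U - {h}. c\<^sup>2 * real (card U) * real ?N)"
      unfolding part by (intro sum_mono bound)
    also have "\<dots> = c\<^sup>2 * real (card U) * real (card (involutions U))"
      by (simp add: cI)
    finally show ?thesis .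
  qed
qed

corollary avg_involutions_variance_le:
  assumes "finite U"
    and "\<And>\<phi> a b. \<phi> \<in> involutions U \<Longrightarrow> a \<in> U \<Longrightarrow> b \<in> U \<Longrightarrow> \<bar>F (switch a b \<phi>) - F \<phi>\<bar> \<le> c"
  shows "avg (involutions U) (\<lambda>\<phi>. (F \<phi> - avg (involutions U) F)\<^sup>2) \<le> c\<^sup>2 * real (card U)"
proof (cases "involutions U = {}")
  case False
  then have "real (card (involutions U)) > 0"
    using finite_involutions[OF assms(1)] by (simp add: card_gt_0_iff)
  then show ?thesis
    using variance_involutions_le[OF assms] by (simp add: avg_def divide_le_eq)
qed (simp add: avg_def)

text \<open>Re-matching \<open>h\<close> with an independent uniform \<open>g\<close> preserves the uniform law; the second component,
  the former partner of \<open>h\<close>, is again uniform and independent of the new matching.\<close>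

definition rematch :: "'a \<Rightarrow> ('a \<Rightarrow> 'a) \<times> 'a \<Rightarrow> ('a \<Rightarrow> 'a) \<times> 'a" where
  "rematch h = (\<lambda>(\<phi>, g). if g = h then (\<phi>, h) else (switch (\<phi> h) g \<phi>, \<phi> h))"

lemma switch_rematch_apply:
  assumes "\<phi> \<in> involutions U" "h \<in> U" "g \<noteq> h"
  shows "switch (\<phi> h) g \<phi> h = g"
  using assms involutionsD(3)[OF assms(1,2)] by (simp add: switch_def Transposition.transpose_def)

text \<open>\<open>rematch h\<close> is its own inverse: after the switch \<open>h\<close> is
  matched with \<open>g\<close> and its old partner is recorded, so the same operation switches
  back. The pairs with \<open>g = h\<close> are fixed, and they are not hit a second time because
  the recorded partner never equals \<open>h\<close>.\<close>

lemma bij_betw_rematch: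
  assumes h: "h \<in> U"
  shows "bij_betw (rematch h) (involutions U \<times> U) (involutions U \<times> U)"
proof (rule bij_betw_byWitness[where f' = "rematch h"])
  have inv: "rematch h (rematch h p) = p" if pU: "p \<in> involutions U \<times> U" for p
  proof -
    obtain \<phi> g where p: "p = (\<phi>, g)" and *: "\<phi> \<in> involutions U" "g \<in> U"
      using pU by (cases p) auto
    show ?thesis
      unfolding p rematch_def
      using switch_rematch_apply[OF *(1) h, of g] involutionsD(3)[OF *(1) h]
      by (auto simp: switch_commute[of g] switch_switch)
  qed
  then show "\<forall>p\<in>involutions U \<times> U. rematch h (rematch h p) = p"
    by blast
  then show "\<forall>p\<in>involutions U \<times> U. rematch h (rematch h p) = p" .
  show "rematch h ` (involutions U \<times> U) \<subseteq> involutions U \<times> U"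
  proof (rule image_subsetI)
    fix p assume "p \<in> involutions U \<times> U"
    then obtain \<phi> g where p: "p = (\<phi>, g)" and *: "\<phi> \<in> involutions U" "g \<in> U"
      by (cases p) auto
    show "rematch h p \<in> involutions U \<times> U"
      using h * switch_involutions[OF *(1) involutionsD(4)[OF *(1) h] *(2)] involutionsD(4)[OF *(1) h]
      by (simp add: p rematch_def)
  qed
  then show "rematch h ` (involutions U \<times> U) \<subseteq> involutions U \<times> U" .
qed

section \<open>Averages over independent clocks\<close>

lemma (in prob_space) integrable_of_bounded:
  fixes f :: "'a \<Rightarrow> real"
  assumes "f \<in> borel_measurable M" "\<And>x. x \<in> space M \<Longrightarrow> \<bar>f x\<bar> \<le> B"
  shows "integrable M f"
  using assms by (intro integrable_const_bound[of _ B]) auto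

lemma (in prob_space) abs_integral_le_const:
  fixes f :: "'a \<Rightarrow> real"
  assumes "f \<in> borel_measurable M" "\<And>x. x \<in> space M \<Longrightarrow> \<bar>f x\<bar> \<le> B"
  shows "\<bar>\<integral>x. f x \<partial>M\<bar> \<le> B"
proof -
  have "\<bar>\<integral>x. f x \<partial>M\<bar> \<le> (\<integral>x. \<bar>f x\<bar> \<partial>M)"
    by (rule integral_abs_bound)
  also have "\<dots> \<le> (\<integral>x. B \<partial>M)"
    using assms integrable_of_bounded[OF assms] by (intro integral_mono) auto
  finally show ?thesis
    by (simp add: prob_space)
qed

lemma (in prob_space) integral_square_deviation:
  fixes f :: "'a \<Rightarrow> real"
  assumes "f \<in> borel_measurable M" "\<And>x. x \<in> space M \<Longrightarrow> \<bar>f x\<bar> \<le> B"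
  shows "(\<integral>x. (f x - y)\<^sup>2 \<partial>M) = (\<integral>x. (f x - (\<integral>x. f x \<partial>M))\<^sup>2 \<partial>M) + ((\<integral>x. f x \<partial>M) - y)\<^sup>2"
proof -
  let ?m = "\<integral>x. f x \<partial>M"
  note [measurable] = assms(1)
  have i1: "integrable M f"
    by (rule integrable_of_bounded[OF assms])
  have "integrable M (\<lambda>x. (f x)\<^sup>2)"
  proof (rule integrable_of_bounded)
    fix x assume "x \<in> space M"
    then show "\<bar>(f x)\<^sup>2\<bar> \<le> B\<^sup>2"
      using power_mono[OF assms(2), of x 2] by simp
  qed measurable
  then have "(\<integral>x. (f x - z)\<^sup>2 \<partial>M) = (\<integral>x. (f x)\<^sup>2 \<partial>M) - 2 * z * ?m + z\<^sup>2" for z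
    using i1 by (simp add: power2_diff prob_space)
  from this[of y] this[of ?m] show ?thesis
    by (simp add: power2_eq_square algebra_simps)
qed

lemma (in prob_space) integral_abs_le_sqrt:
  fixes f :: "'a \<Rightarrow> real"
  assumes "f \<in> borel_measurable M" "\<And>x. x \<in> space M \<Longrightarrow> \<bar>f x\<bar> \<le> B"
  shows "(\<integral>x. \<bar>f x\<bar> \<partial>M)\<^sup>2 \<le> (\<integral>x. (f x)\<^sup>2 \<partial>M)"
proof -
  have "0 \<le> (\<integral>x. (\<bar>f x\<bar> - (\<integral>x. \<bar>f x\<bar> \<partial>M))\<^sup>2 \<partial>M)"
    by (rule integral_nonneg_AE) simp
  then show ?thesis
    using integral_square_deviation[of "\<lambda>x. \<bar>f x\<bar>" B 0] assms by simp
qed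

text \<open>An Efron-Stein type bound. Integrating out coordinate \<open>i\<close> splits the
  variance into that of \<open>F\<close> in this coordinate, at most \<open>c\<^sup>2\<close>, and
  that of the partial integral, which inherits the bound \<open>c\<close> on differences in the
  other coordinates.\<close>

lemma variance_PiM_le:
  fixes F :: "('i \<Rightarrow> 'a) \<Rightarrow> real"
  assumes M: "\<And>i. prob_space (M i)" and "finite I"
    and "F \<in> borel_measurable (PiM I M)"
    and "\<And>x. x \<in> space (PiM I M) \<Longrightarrow> \<bar>F x\<bar> \<le> B"
    and "\<And>x i y. x \<in> space (PiM I M) \<Longrightarrow> i \<in> I \<Longrightarrow> y \<in> space (M i) \<Longrightarrow> \<bar>F (x(i := y)) - F x\<bar> \<le> c"
  shows "(\<integral>x. (F x - (\<integral>x. F x \<partial>PiM I M))\<^sup>2 \<partial>PiM I M) \<le> c\<^sup>2 * real (card I)"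
  using assms(2-)
proof (induction I arbitrary: F rule: finite_induct)
  case empty
  interpret product_sigma_finite M
    by (simp add: product_sigma_finite_def M prob_space_imp_sigma_finite)
  show ?case
    by (simp add: PiM_empty lebesgue_integral_count_space_finite)
next
  case (insert i I)
  interpret Mi: prob_space "M i"
    by (rule M)
  interpret product_sigma_finite M
    by (simp add: product_sigma_finite_def M prob_space_imp_sigma_finite)
  interpret P: prob_space "PiM I M"
    by (simp add: M prob_space_PiM)
  interpret PI: prob_space "PiM (insert i I) M"
    by (simp add: M prob_space_PiM)
  note F[measurable] = insert.prems(1)
  note bnd = insert.prems(2) and lip = insert.prems(3)
  define G where "G x = (\<integral>y. F (x(i := y)) \<partial>M i)" for x
  let ?m = "\<integral>x. F x \<partial>PiM (insert i I) M"
  have sp: "x(i := y) \<in> space (PiM (insert i I) M)" if "x \<in> space (PiM I M)" "y \<in> space (M i)" for x y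
    using that by (auto simp: space_PiM PiE_def extensional_def)
  have mF: "(\<lambda>y. F (x(i := y))) \<in> borel_measurable (M i)" if [measurable]: "x \<in> space (PiM I M)" for x
    using that insert.hyps by measurable
  have mFp[measurable]: "(\<lambda>(x, y). F (x(i := y))) \<in> borel_measurable (PiM I M \<Otimes>\<^sub>M M i)"
    using measurable_compose[OF measurable_add_dim[of i I M] F] by (simp add: case_prod_beta')
  have mG[measurable]: "G \<in> borel_measurable (PiM I M)"
    unfolding G_def by (intro Mi.borel_measurable_lebesgue_integral) simp
  have bF: "\<bar>F (x(i := y))\<bar> \<le> B" if "x \<in> space (PiM I M)" "y \<in> space (M i)" for x y
    using bnd sp that by blast
  have bG: "\<bar>G x\<bar> \<le> B" if "x \<in> space (PiM I M)" for x
    unfolding G_def using mF bF that by (intro Mi.abs_integral_le_const) auto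
  have iF: "integrable (PiM (insert i I) M) F"
    by (rule PI.integrable_of_bounded[OF F bnd])
  have m: "?m = (\<integral>x. G x \<partial>PiM I M)"
    unfolding G_def using insert.hyps iF by (intro product_integral_insert)
  have bm: "\<bar>?m\<bar> \<le> B"
    by (rule PI.abs_integral_le_const[OF F bnd])
  have B2: "(a - ?m)\<^sup>2 \<le> (2 * B)\<^sup>2" if "\<bar>a\<bar> \<le> B" for a
    using power_mono[of "\<bar>a - ?m\<bar>" "2 * B" 2] that bm by simp
  have iG: "integrable (PiM I M) (\<lambda>x. (G x - ?m)\<^sup>2)"
    by (rule P.integrable_of_bounded[where B = "(2 * B)\<^sup>2"]) (use B2 bG in auto)
  have "(\<integral>x. (F x - ?m)\<^sup>2 \<partial>PiM (insert i I) M) = (\<integral>x. (\<integral>y. (F (x(i := y)) - ?m)\<^sup>2 \<partial>M i) \<partial>PiM I M)"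
  proof (rule product_integral_insert)
    show "integrable (PiM (insert i I) M) (\<lambda>x. (F x - ?m)\<^sup>2)"
      by (rule PI.integrable_of_bounded[where B = "(2 * B)\<^sup>2"]) (use B2 bnd in auto)
  qed (use insert.hyps in auto)
  also have "\<dots> \<le> (\<integral>x. c\<^sup>2 + (G x - ?m)\<^sup>2 \<partial>PiM I M)"
  proof (rule integral_mono)
    have "(\<lambda>x. \<integral>y. (F (x(i := y)) - ?m)\<^sup>2 \<partial>M i) \<in> borel_measurable (PiM I M)"
      by (intro Mi.borel_measurable_lebesgue_integral) (use mFp in measurable)
    then show "integrable (PiM I M) (\<lambda>x. \<integral>y. (F (x(i := y)) - ?m)\<^sup>2 \<partial>M i)"
    proof (rule P.integrable_of_bounded[where B = "(2 * B)\<^sup>2"])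
      fix x assume x: "x \<in> space (PiM I M)"
      then show "\<bar>\<integral>y. (F (x(i := y)) - ?m)\<^sup>2 \<partial>M i\<bar> \<le> (2 * B)\<^sup>2"
        using mF[OF x] B2 bF[OF x] by (intro Mi.abs_integral_le_const) auto
    qed
    show "integrable (PiM I M) (\<lambda>x. c\<^sup>2 + (G x - ?m)\<^sup>2)"
      using iG by simp
    fix x assume x: "x \<in> space (PiM I M)"
    have "(\<integral>y. (F (x(i := y)) - ?m)\<^sup>2 \<partial>M i)
        = (\<integral>y. (F (x(i := y)) - G x)\<^sup>2 \<partial>M i) + (G x - ?m)\<^sup>2"
      unfolding G_def using mF[OF x] bF[OF x] by (rule Mi.integral_square_deviation)
    also have "(\<integral>y. (F (x(i := y)) - G x)\<^sup>2 \<partial>M i) \<le> c\<^sup>2"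
    proof (rule order_trans[OF abs_ge_self Mi.abs_integral_le_const])
      show "(\<lambda>y. (F (x(i := y)) - G x)\<^sup>2) \<in> borel_measurable (M i)"
        using mF[OF x] by measurable
      fix y assume y: "y \<in> space (M i)"
      \<comment> \<open>The deviation from the partial mean is an average of differences of
        \<open>F\<close> at two values of the same coordinate, each at most
        \<open>c\<close>.\<close>
      have "F (x(i := y)) - G x = (\<integral>y'. F (x(i := y)) - F (x(i := y')) \<partial>M i)"
        unfolding G_def using Mi.integrable_of_bounded[OF mF[OF x] bF[OF x]]
        by (simp add: Mi.prob_space)
      also have "\<bar>\<dots>\<bar> \<le> c"
      proof (rule Mi.abs_integral_le_const)
        show "(\<lambda>y'. F (x(i := y)) - F (x(i := y'))) \<in> borel_measurable (M i)"
          using mF[OF x] by measurable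
        fix y' assume "y' \<in> space (M i)"
        then show "\<bar>F (x(i := y)) - F (x(i := y'))\<bar> \<le> c"
          using lip[OF sp[OF x, of y'], of i y] y by (metis fun_upd_upd insertI1)
      qed
      finally show "\<bar>(F (x(i := y)) - G x)\<^sup>2\<bar> \<le> c\<^sup>2"
        using power_mono[of "\<bar>F (x(i := y)) - G x\<bar>" c 2] by simp
    qed
    finally show "(\<integral>y. (F (x(i := y)) - ?m)\<^sup>2 \<partial>M i) \<le> c\<^sup>2 + (G x - ?m)\<^sup>2"
      by simp
  qed
  also have "\<dots> = c\<^sup>2 + (\<integral>x. (G x - (\<integral>x. G x \<partial>PiM I M))\<^sup>2 \<partial>PiM I M)"
    using iG by (simp add: P.prob_space m)
  also have "(\<integral>x. (G x - (\<integral>x. G x \<partial>PiM I M))\<^sup>2 \<partial>PiM I M) \<le> c\<^sup>2 * real (card I)"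
  proof (rule insert.IH[OF mG bG])
    fix x k z assume *: "x \<in> space (PiM I M)" "k \<in> I" "z \<in> space (M k)"
    then have x': "x(k := z) \<in> space (PiM I M)"
      by (auto simp: space_PiM PiE_def extensional_def)
    have "k \<noteq> i"
      using * insert.hyps by auto
    have "G (x(k := z)) - G x = (\<integral>y. F ((x(k := z))(i := y)) - F (x(i := y)) \<partial>M i)"
      unfolding G_def using * x' mF bF
      by (intro Bochner_Integration.integral_diff[symmetric] Mi.integrable_of_bounded[where B = B]) auto
    also have "\<bar>\<dots>\<bar> \<le> c"
    proof (rule Mi.abs_integral_le_const)
      show "(\<lambda>y. F ((x(k := z))(i := y)) - F (x(i := y))) \<in> borel_measurable (M i)"
        using mF[OF x'] mF[OF *(1)] by measurable
      fix y assume "y \<in> space (M i)"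
      then show "\<bar>F ((x(k := z))(i := y)) - F (x(i := y))\<bar> \<le> c"
        unfolding fun_upd_twist[OF \<open>k \<noteq> i\<close>] using lip[OF sp[OF *(1), of y], of k z] * by blast
    qed
    finally show "\<bar>G (x(k := z)) - G x\<bar> \<le> c" .
  qed
  finally show ?case
    using insert.hyps by (simp add: algebra_simps)
qed

text \<open>Redrawing one coordinate does not change the law. The outer integral keeps the old value
  of coordinate \<open>i\<close> as well, so that functionals of the old and of the redrawn point
  can be compared under one integral.\<close>

lemma integral_PiM_resample:
  fixes F :: "('i \<Rightarrow> 'a) \<Rightarrow> real"
  assumes M: "\<And>i. prob_space (M i)" and "finite I" "i \<in> I"
    and F[measurable]: "F \<in> borel_measurable (PiM I M)"
    and bnd: "\<And>x. x \<in> space (PiM I M) \<Longrightarrow> \<bar>F x\<bar> \<le> B"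
  shows "(\<integral>x. F x \<partial>PiM I M) = (\<integral>x. (\<integral>y. F (x(i := y)) \<partial>M i) \<partial>PiM I M)"
proof -
  interpret Mi: prob_space "M i"
    by (rule M)
  interpret product_sigma_finite M
    by (simp add: product_sigma_finite_def M prob_space_imp_sigma_finite)
  interpret P: prob_space "PiM I M"
    by (simp add: M prob_space_PiM)
  define J where "J = I - {i}"
  have I: "I = insert i J" "finite J" "i \<notin> J"
    using assms by (auto simp: J_def)
  have sp: "x(i := y) \<in> space (PiM I M)" if "x \<in> space (PiM I M)" "y \<in> space (M i)" for x y
    using that assms(3) by (auto simp: space_PiM PiE_def extensional_def)
  have m: "(\<lambda>x. \<integral>y. F (x(i := y)) \<partial>M i) \<in> borel_measurable (PiM I M)"
  proof (intro Mi.borel_measurable_lebesgue_integral)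
    have "(\<lambda>(x, y). x(i := y)) \<in> PiM I M \<Otimes>\<^sub>M M i \<rightarrow>\<^sub>M PiM I M"
      using measurable_add_dim[of i I M] assms(3) by (simp add: insert_absorb case_prod_beta')
    from measurable_compose[OF this F]
    show "(\<lambda>(x, y). F (x(i := y))) \<in> borel_measurable (PiM I M \<Otimes>\<^sub>M M i)"
      by (simp add: case_prod_beta')
  qed
  have i2: "integrable (PiM I M) (\<lambda>x. \<integral>y. F (x(i := y)) \<partial>M i)"
  proof (rule P.integrable_of_bounded[OF m, of B], rule Mi.abs_integral_le_const)
    fix x assume x[measurable]: "x \<in> space (PiM I M)"
    have "(\<lambda>y. x(i := y)) \<in> M i \<rightarrow>\<^sub>M PiM I M"
      using measurable_compose[OF measurable_Pair1'[OF x] measurable_add_dim[of i I M]] assms(3)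
      by (simp add: insert_absorb)
    from measurable_compose[OF this F]
    show "(\<lambda>y. F (x(i := y))) \<in> borel_measurable (M i)" .
  qed (use bnd sp in auto)
  have "(\<integral>x. (\<integral>y. F (x(i := y)) \<partial>M i) \<partial>PiM I M)
      = (\<integral>x. (\<integral>z. (\<integral>y. F ((x(i := z))(i := y)) \<partial>M i) \<partial>M i) \<partial>PiM J M)"
    using i2 I unfolding I(1) by (intro product_integral_insert) auto
  also have "\<dots> = (\<integral>x. (\<integral>y. F (x(i := y)) \<partial>M i) \<partial>PiM J M)"
    by (simp add: Mi.prob_space)
  also have "\<dots> = (\<integral>x. F x \<partial>PiM I M)"
    using I P.integrable_of_bounded[OF F bnd] unfolding I(1)
    by (intro product_integral_insert[symmetric]) auto
  finally show ?thesis ..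
qed

section \<open>Messages along half-edges\<close>

locale degree_cutoff =
  fixes n :: nat and d :: "nat \<Rightarrow> nat" and K :: nat
begin

abbreviation H :: "(nat \<times> nat) set" where
  "H \<equiv> half_edges n d"

abbreviation matchings :: "(nat \<times> nat \<Rightarrow> nat \<times> nat) set" where
  "matchings \<equiv> involutions H"

definition siblings :: "nat \<times> nat \<Rightarrow> (nat \<times> nat) set" where
  "siblings z = {fst z} \<times> ({..<d (fst z)} - {snd z})"

text \<open>\<open>msg \<phi> T j z t\<close> approximates the event that the owner of \<open>z\<close> is activated before time \<open>t\<close> in the
  graph without the edge of \<open>z\<close>: from above for even \<open>j\<close>, from below for odd \<open>j\<close>. Vertices of degree
  above \<open>K\<close> send the trivial bound of the same parity.\<close>

fun msg :: "(nat \<times> nat \<Rightarrow> nat \<times> nat) \<Rightarrow> (nat \<Rightarrow> real) \<Rightarrow> nat \<Rightarrow> nat \<times> nat \<Rightarrow> real \<Rightarrow> bool" where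
  "msg \<phi> T 0 z t \<longleftrightarrow> K < d (fst z) \<or> T (fst z) < t"
| "msg \<phi> T (Suc j) z t \<longleftrightarrow>
     (if K < d (fst z) then odd j
      else T (fst z) < t \<and> (\<forall>s\<in>siblings z. \<not> msg \<phi> T j (\<phi> s) (T (fst z))))"

text \<open>The half-edges whose partner has to be looked up in order to evaluate \<^const>\<open>msg\<close>.\<close>

fun query :: "(nat \<times> nat \<Rightarrow> nat \<times> nat) \<Rightarrow> (nat \<Rightarrow> real) \<Rightarrow> nat \<Rightarrow> nat \<times> nat \<Rightarrow> real \<Rightarrow> (nat \<times> nat) set" where
  "query \<phi> T 0 z t = {}"
| "query \<phi> T (Suc j) z t =
     (if K < d (fst z) \<or> \<not> T (fst z) < t then {}
      else siblings z \<union> (\<Union>s\<in>siblings z. query \<phi> T j (\<phi> s) (T (fst z))))"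

text \<open>The number of nodes below the root of a tree with \<open>j\<close> levels and
  \<open>K\<close> children per node. It bounds the queries made from one root and also, by tracing
  queries backwards, the roots that query one half-edge.\<close>

primrec reach :: "nat \<Rightarrow> nat" where
  "reach 0 = 0"
| "reach (Suc j) = K * (1 + reach j)"

lemma fst_siblings: "s \<in> siblings z \<Longrightarrow> fst s = fst z"
  by (auto simp: siblings_def)

lemma finite_siblings: "finite (siblings z)"
  by (simp add: siblings_def)

lemma card_siblings_le: "d (fst z) \<le> K \<Longrightarrow> card (siblings z) \<le> K"
  using card_mono[of "{..<d (fst z)}" "{..<d (fst z)} - {snd z}"]
  by (simp add: siblings_def card_cartesian_product)

lemma sibling_in_half_edges: "s \<in> siblings z \<Longrightarrow> z \<in> H \<Longrightarrow> s \<in> H"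
  by (auto simp: siblings_def half_edges_def)

text \<open>Each round passes on the clock of the vertex just visited as the new deadline, so clocks
  strictly decrease along the recursion. This is what excludes a return to the vertex that
  asks.\<close>

lemma query_time: "y \<in> query \<phi> T j z t \<Longrightarrow> T (fst y) < t"
proof (induction j arbitrary: z t)
  case (Suc j)
  then have lt: "T (fst z) < t"
    by (auto split: if_splits)
  consider "y \<in> siblings z" | s where "y \<in> query \<phi> T j (\<phi> s) (T (fst z))"
    using Suc.prems by (auto split: if_splits)
  then show ?case
  proof cases
    case 1
    then show ?thesis
      using fst_siblings lt by simp
  next
    case 2
    show ?thesis
      using Suc.IH[OF 2] lt by simp
  qed
qed simp

text \<open>Siblings of \<open>z\<close> differ from \<open>z\<close>, and everything queried
  further down belongs to a vertex with an earlier clock than the owner of \<open>z\<close>.\<close>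

lemma root_notin_query: "z \<notin> query \<phi> T j z t"
proof (cases j)
  case (Suc i)
  have "z \<notin> siblings z"
    by (cases z) (auto simp: siblings_def)
  moreover have "z \<notin> query \<phi> T i (\<phi> s) (T (fst z))" for s
    using query_time[of z \<phi> T i "\<phi> s" "T (fst z)"] by auto
  ultimately show ?thesis
    by (simp add: Suc)
qed simp

lemma finite_query: "finite (query \<phi> T j z t)"
  by (induction j arbitrary: z t) (auto simp: finite_siblings)

lemma card_query_le: "card (query \<phi> T j z t) \<le> reach j"
proof (induction j arbitrary: z t)
  case (Suc j)
  show ?case
  proof (cases "K < d (fst z) \<or> \<not> T (fst z) < t")
    case False
    then have c: "card (siblings z) \<le> K"
      by (intro card_siblings_le) simp
    have "card (query \<phi> T (Suc j) z t)
        \<le> card (siblings z) + card (\<Union>s\<in>siblings z. query \<phi> T j (\<phi> s) (T (fst z)))"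
      using False by (simp add: card_Un_le)
    also have "card (\<Union>s\<in>siblings z. query \<phi> T j (\<phi> s) (T (fst z)))
        \<le> (\<Sum>s\<in>siblings z. card (query \<phi> T j (\<phi> s) (T (fst z))))"
      by (rule card_UN_le[OF finite_siblings])
    also have "\<dots> \<le> (\<Sum>s\<in>siblings z. reach j)"
      by (intro sum_mono Suc.IH)
    finally have "card (query \<phi> T (Suc j) z t) \<le> card (siblings z) * (1 + reach j)"
      by simp
    also have "\<dots> \<le> K * (1 + reach j)"
      using c by (rule mult_le_mono1)
    finally show ?thesis
      by simp
  qed simp
qed simp

section \<open>Bounded influence of one partner and of one clock\<close>

definition queriers :: "(nat \<times> nat \<Rightarrow> nat \<times> nat) \<Rightarrow> (nat \<Rightarrow> real) \<Rightarrow> nat \<Rightarrow> nat \<times> nat \<Rightarrow> (nat \<times> nat) set" where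
  "queriers \<phi> T j y = {z \<in> H. \<exists>t. y \<in> query \<phi> T j z t}"

text \<open>Empty above the cutoff, where vertices query nothing; a root that queries anything is
  therefore counted here.\<close>

definition low_half_edges :: "nat \<Rightarrow> (nat \<times> nat) set" where
  "low_half_edges v = (if d v \<le> K then {v} \<times> {..<d v} else {})"

lemma card_low_half_edges_le: "card (low_half_edges v) \<le> K"
  and finite_low_half_edges: "finite (low_half_edges v)"
  by (simp_all add: low_half_edges_def card_cartesian_product)

lemma mem_low_half_edges:
  "z \<in> H \<Longrightarrow> d (fst z) \<le> K \<Longrightarrow> fst z = v \<Longrightarrow> z \<in> low_half_edges v"
  by (cases z) (auto simp: low_half_edges_def half_edges_def)

text \<open>The counting step shared by queries and clocks: going back by one round, from a
  half-edge to the roots that use its answer, costs a factor \<open>K\<close>.\<close>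

lemma card_Un_low_le:
  assumes "finite A" "card A \<le> c" "B \<subseteq> low_half_edges v \<union> (\<Union>y\<in>A. low_half_edges (f y))"
  shows "card B \<le> K * (1 + c)"
proof -
  have "card B \<le> card (low_half_edges v \<union> (\<Union>y\<in>A. low_half_edges (f y)))"
    using assms by (intro card_mono) (auto simp: finite_low_half_edges)
  also have "\<dots> \<le> card (low_half_edges v) + card (\<Union>y\<in>A. low_half_edges (f y))"
    by (rule card_Un_le)
  also have "card (\<Union>y\<in>A. low_half_edges (f y)) \<le> (\<Sum>y\<in>A. card (low_half_edges (f y)))"
    by (rule card_UN_le[OF assms(1)])
  also have "\<dots> \<le> (\<Sum>y\<in>A. K)"
    by (intro sum_mono card_low_half_edges_le)
  also have "\<dots> = card A * K"
    by simp
  also have "\<dots> \<le> c * K"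
    using assms(2) by (rule mult_le_mono1)
  finally show ?thesis
    using card_low_half_edges_le[of v] by (simp add: algebra_simps)
qed

lemma finite_queriers: "finite (queriers \<phi> T j y)"
  by (simp add: queriers_def finite_half_edges)

text \<open>Queries are traced backwards. A root \<open>z\<close> queries \<open>y\<close> as a
  sibling, and then shares the owner of \<open>y\<close>, or through a sibling \<open>s\<close>
  whose partner \<open>x\<close> queries \<open>y\<close>; as \<open>s\<close> is then the partner
  of \<open>x\<close>, the owner of \<open>z\<close> is determined by \<open>x\<close>. The bound is
  uniform in the deadline, over which \<open>queriers\<close> takes the union.\<close>

lemma card_queriers_le:
  assumes \<phi>: "\<phi> \<in> matchings"
  shows "card (queriers \<phi> T j y) \<le> reach j"
proof (induction j)
  case (Suc j)
  have "queriers \<phi> T (Suc j) y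
      \<subseteq> low_half_edges (fst y) \<union> (\<Union>x\<in>queriers \<phi> T j y. low_half_edges (fst (\<phi> x)))"
  proof
    fix z assume "z \<in> queriers \<phi> T (Suc j) y"
    then obtain t where z: "z \<in> H" and y: "y \<in> query \<phi> T (Suc j) z t"
      by (auto simp: queriers_def)
    have low: "d (fst z) \<le> K"
      using y by (auto split: if_splits)
    consider "y \<in> siblings z" | s where "s \<in> siblings z" "y \<in> query \<phi> T j (\<phi> s) (T (fst z))"
      using y by (auto split: if_splits)
    then show "z \<in> low_half_edges (fst y) \<union> (\<Union>x\<in>queriers \<phi> T j y. low_half_edges (fst (\<phi> x)))"
    proof cases
      case 1
      then show ?thesis
        using mem_low_half_edges[OF z low] fst_siblings[OF 1] by simp
    next
      case 2
      have "\<phi> s \<in> H"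
        using sibling_in_half_edges[OF 2(1) z] by (rule involutionsD(4)[OF \<phi>])
      then have "\<phi> s \<in> queriers \<phi> T j y"
        using 2(2) unfolding queriers_def by blast
      moreover have "z \<in> low_half_edges (fst (\<phi> (\<phi> s)))"
        using mem_low_half_edges[OF z low] fst_siblings[OF 2(1)] involutionsD(2)[OF \<phi>] by simp
      ultimately show ?thesis
        by blast
    qed
  qed
  from card_Un_low_le[OF finite_queriers Suc.IH this] show ?case
    by simp
qed (simp add: queriers_def)

text \<open>The two evaluations run in parallel up to a looked-up half-edge whose partner differs,
  and this one is queried by both. Later, one of the two memberships excludes a case through the old
  matching and the other through the new one.\<close>

lemma msg_differs:
  assumes "msg \<phi> T j z t \<noteq> msg \<phi>' T j z t"
  shows "\<exists>y. \<phi> y \<noteq> \<phi>' y \<and> y \<in> query \<phi> T j z t \<and> y \<in> query \<phi>' T j z t"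
  using assms
proof (induction j arbitrary: z t)
  case (Suc j)
  have low: "\<not> (K < d (fst z) \<or> \<not> T (fst z) < t)"
    using Suc.prems by (auto split: if_splits)
  obtain s where s: "s \<in> siblings z"
      and ne: "msg \<phi> T j (\<phi> s) (T (fst z)) \<noteq> msg \<phi>' T j (\<phi>' s) (T (fst z))"
    using Suc.prems by (auto split: if_splits)
  show ?case
  proof (cases "\<phi> s = \<phi>' s")
    case True
    with ne have "msg \<phi> T j (\<phi> s) (T (fst z)) \<noteq> msg \<phi>' T j (\<phi> s) (T (fst z))"
      by simp
    from Suc.IH[OF this] obtain y where "\<phi> y \<noteq> \<phi>' y" "y \<in> query \<phi> T j (\<phi> s) (T (fst z))"
        "y \<in> query \<phi>' T j (\<phi>' s) (T (fst z))"
      using True by auto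
    then show ?thesis
      using low s by (intro exI[of _ y]) auto
  next
    case False
    then show ?thesis
      using low s by (intro exI[of _ s]) auto
  qed
qed simp

definition clock_sensitive :: "(nat \<times> nat \<Rightarrow> nat \<times> nat) \<Rightarrow> (nat \<Rightarrow> real) \<Rightarrow> nat \<Rightarrow> real \<Rightarrow> nat \<Rightarrow> (nat \<times> nat) set" where
  "clock_sensitive \<phi> T v x j = {z \<in> H. \<exists>t. msg \<phi> T j z t \<noteq> msg \<phi> (T(v := x)) j z t}"

lemma finite_clock_sensitive: "finite (clock_sensitive \<phi> T v x j)"
  by (simp add: clock_sensitive_def finite_half_edges)

text \<open>The clock of \<open>v\<close> enters at the half-edges of \<open>v\<close> themselves,
  even before any look-up, which costs one more level than \<open>card_queriers_le\<close>.\<close>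

lemma card_clock_sensitive_le:
  assumes \<phi>: "\<phi> \<in> matchings"
  shows "card (clock_sensitive \<phi> T v x j) \<le> reach (Suc j)"
proof (induction j)
  case 0
  have "clock_sensitive \<phi> T v x 0 \<subseteq> low_half_edges v"
  proof
    fix z assume "z \<in> clock_sensitive \<phi> T v x 0"
    then have "z \<in> H" "d (fst z) \<le> K" "fst z = v"
      by (auto simp: clock_sensitive_def split: if_splits)
    then show "z \<in> low_half_edges v"
      by (rule mem_low_half_edges)
  qed
  from card_mono[OF finite_low_half_edges this] show ?case
    using card_low_half_edges_le[of v] by simp
next
  case (Suc j)
  have "clock_sensitive \<phi> T v x (Suc j)
      \<subseteq> low_half_edges v \<union> (\<Union>y\<in>clock_sensitive \<phi> T v x j. low_half_edges (fst (\<phi> y)))"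
  proof
    fix z assume "z \<in> clock_sensitive \<phi> T v x (Suc j)"
    then obtain t where z: "z \<in> H" and ne: "msg \<phi> T (Suc j) z t \<noteq> msg \<phi> (T(v := x)) (Suc j) z t"
      by (auto simp: clock_sensitive_def)
    have low: "d (fst z) \<le> K"
      using ne by (auto split: if_splits)
    show "z \<in> low_half_edges v \<union> (\<Union>y\<in>clock_sensitive \<phi> T v x j. low_half_edges (fst (\<phi> y)))"
    proof (cases "fst z = v")
      case True
      then show ?thesis
        using mem_low_half_edges[OF z low] by blast
    next
      case False
      then obtain s where s: "s \<in> siblings z"
          "msg \<phi> T j (\<phi> s) (T (fst z)) \<noteq> msg \<phi> (T(v := x)) j (\<phi> s) (T (fst z))"
        using ne by (auto split: if_splits)
      have "\<phi> s \<in> H"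
        using sibling_in_half_edges[OF s(1) z] by (rule involutionsD(4)[OF \<phi>])
      then have "\<phi> s \<in> clock_sensitive \<phi> T v x j"
        using s(2) unfolding clock_sensitive_def by blast
      moreover have "z \<in> low_half_edges (fst (\<phi> (\<phi> s)))"
        using mem_low_half_edges[OF z low] fst_siblings[OF s(1)] involutionsD(2)[OF \<phi>] by simp
      ultimately show ?thesis
        by blast
    qed
  qed
  from card_Un_low_le[OF finite_clock_sensitive Suc.IH this] show ?case
    by simp
qed

definition switch_sensitive :: "(nat \<times> nat \<Rightarrow> nat \<times> nat) \<Rightarrow> (nat \<Rightarrow> real) \<Rightarrow> nat \<times> nat \<Rightarrow> nat \<times> nat \<Rightarrow> nat \<Rightarrow> (nat \<times> nat) set" where
  "switch_sensitive \<phi> T a b j = {z \<in> H. \<exists>t. msg \<phi> T j z t \<noteq> msg (switch a b \<phi>) T j z t}"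

lemma finite_switch_sensitive: "finite (switch_sensitive \<phi> T a b j)"
  by (simp add: switch_sensitive_def finite_half_edges)

text \<open>A switch alters the partners of at most four half-edges, and an answer can change only
  for roots that query one of them.\<close>

lemma card_switch_sensitive_le:
  assumes \<phi>: "\<phi> \<in> matchings"
  shows "card (switch_sensitive \<phi> T a b j) \<le> 4 * reach j"
proof -
  have "switch_sensitive \<phi> T a b j \<subseteq> (\<Union>y\<in>{a, b, \<phi> a, \<phi> b}. queriers \<phi> T j y)"
  proof
    fix z assume "z \<in> switch_sensitive \<phi> T a b j"
    then obtain t where z: "z \<in> H" and "msg \<phi> T j z t \<noteq> msg (switch a b \<phi>) T j z t"
      by (auto simp: switch_sensitive_def)
    from msg_differs[OF this(2)] obtain y where "\<phi> y \<noteq> switch a b \<phi> y" "y \<in> query \<phi> T j z t"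
      by blast
    then show "z \<in> (\<Union>y\<in>{a, b, \<phi> a, \<phi> b}. queriers \<phi> T j y)"
      using switch_differs[OF \<phi>, of a b y] z unfolding queriers_def by auto
  qed
  then have "card (switch_sensitive \<phi> T a b j) \<le> card (\<Union>y\<in>{a, b, \<phi> a, \<phi> b}. queriers \<phi> T j y)"
    by (intro card_mono) (auto simp: finite_queriers)
  also have "\<dots> \<le> (\<Sum>y\<in>{a, b, \<phi> a, \<phi> b}. card (queriers \<phi> T j y))"
    by (rule card_UN_le) simp
  also have "\<dots> \<le> card {a, b, \<phi> a, \<phi> b} * reach j"
    using sum_bounded_above[of _ "\<lambda>y. card (queriers \<phi> T j y)"] card_queriers_le[OF \<phi>] by simp
  also have "\<dots> \<le> 4 * reach j"
    by (intro mult_le_mono1) (simp add: card_insert_if)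
  finally show ?thesis .
qed

end

section \<open>Replacing partners by independent half-edges\<close>

lemma abs_mult3_diff_le:
  fixes a b c a' b' c' :: real
  assumes "a \<in> {0..1}" "b \<in> {0..1}" "c \<in> {0..1}" "a' \<in> {0..1}" "b' \<in> {0..1}" "c' \<in> {0..1}"
  shows "\<bar>a' * b' * c' - a * b * c\<bar> \<le> \<bar>a' - a\<bar> + \<bar>b' - b\<bar> + \<bar>c' - c\<bar>"
proof -
  have "a' * b' * c' - a * b * c = (a' - a) * (b' * c') + (b' - b) * (a * c') + (c' - c) * (a * b)"
    by (simp add: algebra_simps)
  then have "\<bar>a' * b' * c' - a * b * c\<bar>
      \<le> \<bar>(a' - a) * (b' * c')\<bar> + \<bar>(b' - b) * (a * c')\<bar> + \<bar>(c' - c) * (a * b)\<bar>"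
    by linarith
  also have "\<dots> = \<bar>a' - a\<bar> * (b' * c') + \<bar>b' - b\<bar> * (a * c') + \<bar>c' - c\<bar> * (a * b)"
    using assms by (simp add: abs_mult)
  also have "\<dots> \<le> \<bar>a' - a\<bar> * 1 + \<bar>b' - b\<bar> * 1 + \<bar>c' - c\<bar> * 1"
    using assms by (intro add_mono mult_left_mono mult_le_one) auto
  finally show ?thesis
    by simp
qed

lemma abs_of_bool_diff_le3:
  assumes "\<not> (P1 \<or> P2 \<or> P3) \<Longrightarrow> A = B"
  shows "\<bar>of_bool A - of_bool B :: real\<bar> \<le> of_bool P1 + of_bool P2 + of_bool P3"
  using assms by (cases P1; cases P2; cases P3; cases A; cases B; simp)

lemma abs_of_bool_diff_le6:
  assumes "\<not> (P1 \<or> P2 \<or> P3 \<or> P4 \<or> P5 \<or> P6) \<Longrightarrow> A = B"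
  shows "\<bar>of_bool A - of_bool B :: real\<bar>
      \<le> of_bool P1 + of_bool P2 + of_bool P3 + of_bool P4 + of_bool P5 + of_bool P6"
proof (cases "A = B")
  case False
  then have "P1 \<or> P2 \<or> P3 \<or> P4 \<or> P5 \<or> P6"
    using assms by blast
  then have "1 \<le> of_bool P1 + of_bool P2 + of_bool P3 + of_bool P4 + of_bool P5 + (of_bool P6 :: real)"
    by (elim disjE) simp_all
  then show ?thesis
    by (cases A; cases B; simp)
qed simp

context degree_cutoff
begin

text \<open>Real valued, so that the absence of messages at several half-edges is a product whose
  factors can be replaced one at a time.\<close>

definition silent :: "(nat \<times> nat \<Rightarrow> nat \<times> nat) \<Rightarrow> (nat \<Rightarrow> real) \<Rightarrow> nat \<Rightarrow> real \<Rightarrow> nat \<times> nat \<Rightarrow> real" where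
  "silent \<phi> T j t z = of_bool (\<not> msg \<phi> T j z t)"

definition msg_fraction :: "(nat \<times> nat \<Rightarrow> nat \<times> nat) \<Rightarrow> (nat \<Rightarrow> real) \<Rightarrow> nat \<Rightarrow> real \<Rightarrow> real" where
  "msg_fraction \<phi> T j t = avg H (\<lambda>z. of_bool (msg \<phi> T j z t))"

lemma silent_bounds: "silent \<phi> T j t z \<in> {0..1}"
  by (simp add: silent_def)

lemma finite_matchings: "finite matchings"
  by (intro finite_involutions finite_half_edges)

lemma avg_in_unit: "(\<And>x. x \<in> A \<Longrightarrow> f x \<in> {0..1}) \<Longrightarrow> avg A f \<in> {0..1}"
  by (auto intro!: avg_nonneg avg_le_const)

lemma msg_fraction_bounds: "msg_fraction \<phi> T j t \<in> {0..1}"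
  unfolding msg_fraction_def by (rule avg_in_unit) simp

lemma avg_silent: "H \<noteq> {} \<Longrightarrow> avg H (silent \<phi> T j t) = 1 - msg_fraction \<phi> T j t"
proof -
  assume "H \<noteq> {}"
  moreover have "silent \<phi> T j t = (\<lambda>z. 1 - of_bool (msg \<phi> T j z t))"
    by (simp add: fun_eq_iff silent_def)
  ultimately show ?thesis
    by (simp add: msg_fraction_def avg_diff avg_const finite_half_edges)
qed

lemma abs_avg_of_bool_diff_le:
  assumes "finite A" "card {x \<in> A. P x \<noteq> Q x} \<le> c"
  shows "\<bar>avg A (\<lambda>x. of_bool (P x)) - avg A (\<lambda>x. of_bool (Q x))\<bar> \<le> real c / real (card A)"
proof -
  have "\<bar>avg A (\<lambda>x. of_bool (P x)) - avg A (\<lambda>x. of_bool (Q x))\<bar> \<le> avg A (\<lambda>x. \<bar>of_bool (P x) - of_bool (Q x)\<bar>)"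
    by (rule abs_avg_diff_le)
  also have "\<dots> = avg A (\<lambda>x. of_bool (P x \<noteq> Q x))"
    by (intro avg_cong) auto
  also have "\<dots> = real (card {x \<in> A. P x \<noteq> Q x}) / real (card A)"
    using assms(1) by (simp add: avg_def Int_def)
  finally show ?thesis
    using assms(2) by (meson divide_right_mono of_nat_0_le_iff of_nat_le_iff order_trans)
qed

lemma msg_fraction_switch:
  assumes "\<phi> \<in> matchings"
  shows "\<bar>msg_fraction (switch a b \<phi>) T j t - msg_fraction \<phi> T j t\<bar> \<le> real (4 * reach j) / real (card H)"
  unfolding msg_fraction_def
proof (rule abs_avg_of_bool_diff_le[OF finite_half_edges])
  have "card {z \<in> H. msg (switch a b \<phi>) T j z t \<noteq> msg \<phi> T j z t} \<le> card (switch_sensitive \<phi> T a b j)"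
    by (intro card_mono finite_switch_sensitive) (auto simp: switch_sensitive_def)
  then show "card {z \<in> H. msg (switch a b \<phi>) T j z t \<noteq> msg \<phi> T j z t} \<le> 4 * reach j"
    using card_switch_sensitive_le[OF assms] le_trans by blast
qed

lemma msg_fraction_clock:
  assumes "\<phi> \<in> matchings"
  shows "\<bar>msg_fraction \<phi> (T(v := x)) j t - msg_fraction \<phi> T j t\<bar> \<le> real (reach (Suc j)) / real (card H)"
  unfolding msg_fraction_def
proof (rule abs_avg_of_bool_diff_le[OF finite_half_edges])
  have "card {z \<in> H. msg \<phi> (T(v := x)) j z t \<noteq> msg \<phi> T j z t} \<le> card (clock_sensitive \<phi> T v x j)"
    by (intro card_mono finite_clock_sensitive) (auto simp: clock_sensitive_def)
  then show "card {z \<in> H. msg \<phi> (T(v := x)) j z t \<noteq> msg \<phi> T j z t} \<le> reach (Suc j)"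
    using card_clock_sensitive_le[OF assms] le_trans by blast
qed

lemma avg_matchings_count_le:
  assumes "\<And>\<phi>. \<phi> \<in> matchings \<Longrightarrow> card {g \<in> H. Q \<phi> g} \<le> c"
  shows "avg (matchings \<times> H) (\<lambda>(\<phi>, g). of_bool (Q \<phi> g)) \<le> real c / real (card H)"
proof -
  have "avg (matchings \<times> H) (\<lambda>(\<phi>, g). of_bool (Q \<phi> g)) = avg matchings (\<lambda>\<phi>. real (card {g \<in> H. Q \<phi> g}) / real (card H))"
    using finite_half_edges by (simp add: avg_Times) (simp add: avg_def Int_def)
  also have "\<dots> \<le> real c / real (card H)"
    using assms by (intro avg_le_const divide_right_mono) auto
  finally show ?thesis .
qed

lemma card_vimage_le:
  assumes "\<phi> \<in> matchings" "finite A"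
  shows "card {g \<in> H. \<phi> g \<in> A} \<le> card A"
proof (rule card_inj_on_le[OF _ _ assms(2)])
  show "inj_on \<phi> {g \<in> H. \<phi> g \<in> A}"
    using involutionsD(2)[OF assms(1)] by (metis inj_onI)
  show "\<phi> ` {g \<in> H. \<phi> g \<in> A} \<subseteq> A"
    by blast
qed

lemma switch_partner_differs:
  assumes \<phi>: "\<phi> \<in> matchings" and "switch (\<phi> h) g \<phi> x \<noteq> \<phi> x"
  shows "x = h \<or> x = g \<or> x = \<phi> h \<or> x = \<phi> g"
  using switch_differs[OF assms] unfolding involutionsD(2)[OF \<phi>] by blast

text \<open>Two evaluations with different answers both query a half-edge whose partner has changed. This is
  never \<open>h\<close>, since clocks decrease along the queries. Queries that are not rare for every fixed \<open>\<phi>\<close>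
  because they close a cycle are expressed through the new matching and the former partner \<open>a\<close>, which
  are again independent and uniform.\<close>

lemma rematched_silent_diff:
  assumes \<phi>: "\<phi> \<in> matchings" and h: "h \<in> H" and \<phi>': "rematch h (\<phi>, g) = (\<phi>', a)"
  shows "\<bar>silent \<phi>' T j (T (fst h)) (\<phi>' h) - silent \<phi> T j (T (fst h)) g\<bar>
      \<le> of_bool (g = h) + of_bool (g \<in> queriers \<phi> T j (\<phi> h) \<or> g \<notin> H)
        + of_bool (\<phi>' a \<in> query \<phi>' T j (\<phi>' h) (T (fst h)))"
  unfolding silent_def
proof (rule abs_of_bool_diff_le3, rule ccontr)
  let ?t = "T (fst h)"
  assume "\<not> (g = h \<or> (g \<in> queriers \<phi> T j (\<phi> h) \<or> g \<notin> H) \<or> \<phi>' a \<in> query \<phi>' T j (\<phi>' h) ?t)"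
    and ne: "(\<not> msg \<phi>' T j (\<phi>' h) ?t) \<noteq> (\<not> msg \<phi> T j g ?t)"
  then have "g \<noteq> h" "g \<notin> queriers \<phi> T j (\<phi> h)" "g \<in> H" "\<phi>' a \<notin> query \<phi>' T j (\<phi>' h) ?t"
    by blast+
  have eq: "\<phi>' = switch (\<phi> h) g \<phi>" "a = \<phi> h"
    using \<phi>' \<open>g \<noteq> h\<close> by (auto simp: rematch_def)
  have g: "\<phi>' h = g"
    unfolding eq using switch_rematch_apply[OF \<phi> h \<open>g \<noteq> h\<close>] .
  \<comment> \<open>The switch joins the two former partners \<open>\<phi> h\<close> and
    \<open>\<phi> g\<close> to each other. So the event on \<open>\<phi> g\<close> is an event for
    the new matching and the former partner \<open>a\<close>.\<close>
  have "\<phi>' (\<phi> h) = \<phi> g"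
  proof -
    have "\<phi> g \<noteq> g" "\<phi> g \<noteq> \<phi> h"
      using involutionsD(3)[OF \<phi> \<open>g \<in> H\<close>] involutionsD(2)[OF \<phi>] \<open>g \<noteq> h\<close> by metis+
    then show ?thesis
      by (simp add: eq switch_def)
  qed
  have "msg \<phi> T j g ?t \<noteq> msg \<phi>' T j g ?t"
    using ne by (auto simp: g)
  from msg_differs[OF this] obtain y where y: "\<phi> y \<noteq> \<phi>' y" "y \<in> query \<phi> T j g ?t" "y \<in> query \<phi>' T j g ?t"
    by blast
  then have "y = h \<or> y = g \<or> y = \<phi> h \<or> y = \<phi> g"
    using switch_partner_differs[OF \<phi>] unfolding eq by metis
  moreover have "y \<noteq> h"
    using query_time[OF y(2)] by auto
  moreover have "y \<noteq> g"
    using root_notin_query y(2) by blast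
  moreover have "y \<noteq> \<phi> h"
    using y(2) \<open>g \<notin> queriers \<phi> T j (\<phi> h)\<close> \<open>g \<in> H\<close> by (auto simp: queriers_def)
  moreover have "y \<noteq> \<phi> g"
    using y(3) \<open>\<phi>' a \<notin> query \<phi>' T j (\<phi>' h) ?t\<close> by (auto simp: g eq(2) \<open>\<phi>' (\<phi> h) = \<phi> g\<close>)
  ultimately show False
    by blast
qed

text \<open>The partner of \<open>s\<close> changes only if \<open>s\<close> is one of
  \<open>g\<close>, \<open>\<phi> g\<close> and \<open>a\<close>. Otherwise both evaluations start
  at the same half-edge, and the differing partner that both query is that of \<open>g\<close>,
  \<open>\<phi> g\<close> or \<open>a\<close>; \<open>h\<close> is out of reach, as its owner has
  the deadline as clock. The events on \<open>a\<close> involve the new pair alone, which is again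
  uniform.\<close>

lemma other_silent_diff:
  assumes \<phi>: "\<phi> \<in> matchings" and h: "h \<in> H" and \<phi>': "rematch h (\<phi>, g) = (\<phi>', a)"
    and s: "s \<noteq> h" "fst s = fst h"
  shows "\<bar>silent \<phi>' T j (T (fst h)) (\<phi>' s) - silent \<phi> T j (T (fst h)) (\<phi> s)\<bar>
      \<le> of_bool (g = s) + of_bool (\<phi> g = s) + of_bool (a = s)
        + of_bool (g \<in> query \<phi> T j (\<phi> s) (T (fst h)))
        + of_bool (\<phi> g \<in> query \<phi> T j (\<phi> s) (T (fst h)))
        + of_bool (a \<in> query \<phi>' T j (\<phi>' s) (T (fst h)))"
  unfolding silent_def
proof (rule abs_of_bool_diff_le6, rule ccontr)
  let ?t = "T (fst h)"
  assume "\<not> (g = s \<or> \<phi> g = s \<or> a = s \<or> g \<in> query \<phi> T j (\<phi> s) ?t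
      \<or> \<phi> g \<in> query \<phi> T j (\<phi> s) ?t \<or> a \<in> query \<phi>' T j (\<phi>' s) ?t)"
    and ne: "(\<not> msg \<phi>' T j (\<phi>' s) ?t) \<noteq> (\<not> msg \<phi> T j (\<phi> s) ?t)"
  then have no: "g \<noteq> s" "\<phi> g \<noteq> s" "a \<noteq> s" "g \<notin> query \<phi> T j (\<phi> s) ?t"
      "\<phi> g \<notin> query \<phi> T j (\<phi> s) ?t" "a \<notin> query \<phi>' T j (\<phi>' s) ?t"
    by blast+
  have "g \<noteq> h"
    using ne \<phi>' by (auto simp: rematch_def)
  then have eq: "\<phi>' = switch (\<phi> h) g \<phi>" "a = \<phi> h"
    using \<phi>' by (auto simp: rematch_def)
  have s': "\<phi>' s = \<phi> s"
    using switch_partner_differs[OF \<phi>, of h g s] no s(1) unfolding eq by auto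
  have "msg \<phi> T j (\<phi> s) ?t \<noteq> msg \<phi>' T j (\<phi> s) ?t"
    using ne by (auto simp: s')
  from msg_differs[OF this] obtain y where y: "\<phi> y \<noteq> \<phi>' y" "y \<in> query \<phi> T j (\<phi> s) ?t"
      "y \<in> query \<phi>' T j (\<phi> s) ?t"
    by blast
  then have "y = h \<or> y = g \<or> y = \<phi> h \<or> y = \<phi> g"
    using switch_partner_differs[OF \<phi>] unfolding eq by metis
  moreover have "y \<noteq> h"
    using query_time[OF y(2)] by auto
  ultimately show False
    using no y eq(2) s' by auto
qed

lemma avg_rematch:
  assumes "h \<in> H"
  shows "avg (matchings \<times> H) (\<lambda>p. f (rematch h p)) = avg (matchings \<times> H) f"
  by (rule avg_reindex_bij[OF bij_betw_rematch[OF assms]])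

lemma avg_rematched_silent_diff:
  assumes h: "h \<in> H"
  shows "avg (matchings \<times> H)
      (\<lambda>p. \<bar>silent (fst (rematch h p)) T j (T (fst h)) (fst (rematch h p) h)
          - silent (fst p) T j (T (fst h)) (snd p)\<bar>)
      \<le> real (1 + 2 * reach j) / real (card H)"
proof -
  let ?A = "avg (matchings \<times> H)" and ?t = "T (fst h)"
  \<comment> \<open>\<open>?f2\<close> allows for \<open>g\<close> outside \<open>H\<close>, since
    \<open>queriers\<close> lies inside \<open>H\<close>; for \<open>g\<close> drawn from
    \<open>H\<close> this adds nothing. \<open>?f3\<close> is applied to the rematched pair, which
    has the same law.\<close>
  let ?f1 = "\<lambda>(\<phi>, g). of_bool (g = h)"
    and ?f2 = "\<lambda>(\<phi>, g). of_bool (g \<in> queriers \<phi> T j (\<phi> h) \<or> g \<notin> H)"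
    and ?f3 = "\<lambda>(\<phi>, a). of_bool (\<phi> a \<in> query \<phi> T j (\<phi> h) ?t)"
  have "?A (\<lambda>p. \<bar>silent (fst (rematch h p)) T j ?t (fst (rematch h p) h) - silent (fst p) T j ?t (snd p)\<bar>)
      \<le> ?A (\<lambda>p. ?f1 p + ?f2 p + ?f3 (rematch h p))"
  proof (rule avg_mono)
    fix p assume "p \<in> matchings \<times> H"
    then have "fst p \<in> matchings"
      by auto
    from rematched_silent_diff[OF this h, of "snd p" "fst (rematch h p)" "snd (rematch h p)" T j]
    show "\<bar>silent (fst (rematch h p)) T j ?t (fst (rematch h p) h) - silent (fst p) T j ?t (snd p)\<bar>
        \<le> ?f1 p + ?f2 p + ?f3 (rematch h p)"
      by (simp add: case_prod_beta)
  qed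
  also have "\<dots> = ?A ?f1 + ?A ?f2 + ?A ?f3"
    by (simp add: avg_add avg_rematch[OF h, of ?f3])
  also have "\<dots> \<le> real 1 / real (card H) + real (reach j) / real (card H) + real (reach j) / real (card H)"
  proof (intro add_mono avg_matchings_count_le)
    fix \<phi> assume \<phi>: "\<phi> \<in> matchings"
    show "card {g \<in> H. g = h} \<le> 1"
      using card_mono[of "{h}" "{g \<in> H. g = h}"] by auto
    have "{g \<in> H. g \<in> queriers \<phi> T j (\<phi> h) \<or> g \<notin> H} \<subseteq> queriers \<phi> T j (\<phi> h)"
      by auto
    from card_mono[OF finite_queriers this] show "card {g \<in> H. g \<in> queriers \<phi> T j (\<phi> h) \<or> g \<notin> H} \<le> reach j"
      using card_queriers_le[OF \<phi>] le_trans by blast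
    show "card {g \<in> H. \<phi> g \<in> query \<phi> T j (\<phi> h) ?t} \<le> reach j"
      using card_vimage_le[OF \<phi> finite_query] card_query_le le_trans by blast
  qed
  finally show ?thesis
    by (simp add: add_divide_distrib)
qed

lemma avg_other_silent_diff:
  assumes h: "h \<in> H" and s: "s \<noteq> h" "fst s = fst h"
  shows "avg (matchings \<times> H)
      (\<lambda>p. \<bar>silent (fst (rematch h p)) T j (T (fst h)) (fst (rematch h p) s)
          - silent (fst p) T j (T (fst h)) (fst p s)\<bar>)
      \<le> real (3 + 3 * reach j) / real (card H)"
proof -
  let ?A = "avg (matchings \<times> H)" and ?t = "T (fst h)"
  let ?f1 = "\<lambda>(\<phi>, g). of_bool (g = s)"
    and ?f2 = "\<lambda>(\<phi>, g). of_bool (\<phi> g = s)"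
    and ?f3 = "\<lambda>(\<phi>, g). of_bool (g \<in> query \<phi> T j (\<phi> s) ?t)"
    and ?f4 = "\<lambda>(\<phi>, g). of_bool (\<phi> g \<in> query \<phi> T j (\<phi> s) ?t)"
  have "?A (\<lambda>p. \<bar>silent (fst (rematch h p)) T j ?t (fst (rematch h p) s) - silent (fst p) T j ?t (fst p s)\<bar>)
      \<le> ?A (\<lambda>p. ?f1 p + ?f2 p + ?f1 (rematch h p) + ?f3 p + ?f4 p + ?f3 (rematch h p))"
  proof (rule avg_mono)
    fix p assume "p \<in> matchings \<times> H"
    then have "fst p \<in> matchings"
      by auto
    from other_silent_diff[OF this h _ s, of "snd p" "fst (rematch h p)" "snd (rematch h p)" T j]
    show "\<bar>silent (fst (rematch h p)) T j ?t (fst (rematch h p) s) - silent (fst p) T j ?t (fst p s)\<bar>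
        \<le> ?f1 p + ?f2 p + ?f1 (rematch h p) + ?f3 p + ?f4 p + ?f3 (rematch h p)"
      by (simp add: case_prod_beta)
  qed
  also have "\<dots> = ?A ?f1 + ?A ?f2 + ?A ?f1 + ?A ?f3 + ?A ?f4 + ?A ?f3"
    by (simp add: avg_add avg_rematch[OF h, of ?f3] avg_rematch[OF h, of ?f1])
  also have "\<dots> \<le> real 1 / real (card H) + real 1 / real (card H) + real 1 / real (card H)
      + real (reach j) / real (card H) + real (reach j) / real (card H) + real (reach j) / real (card H)"
  proof (intro add_mono avg_matchings_count_le)
    fix \<phi> assume \<phi>: "\<phi> \<in> matchings"
    show "card {g \<in> H. g = s} \<le> 1" "card {g \<in> H. g = s} \<le> 1"
      using card_mono[of "{s}" "{g \<in> H. g = s}"] by auto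
    show "card {g \<in> H. \<phi> g = s} \<le> 1"
      using card_vimage_le[OF \<phi>, of "{s}"] by simp
    have "card {g \<in> H. g \<in> query \<phi> T j (\<phi> s) ?t} \<le> card (query \<phi> T j (\<phi> s) ?t)"
      by (intro card_mono finite_query) auto
    then show "card {g \<in> H. g \<in> query \<phi> T j (\<phi> s) ?t} \<le> reach j"
        "card {g \<in> H. g \<in> query \<phi> T j (\<phi> s) ?t} \<le> reach j"
      using card_query_le le_trans by blast+
    show "card {g \<in> H. \<phi> g \<in> query \<phi> T j (\<phi> s) ?t} \<le> reach j"
      using card_vimage_le[OF \<phi> finite_query] card_query_le le_trans by blast
  qed
  finally show ?thesis
    by (simp add: add_divide_distrib)
qed

text \<open>The replaced factor costs \<open>1 + 2 * reach j\<close>. Each of the \<open>m\<close>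
  other factors is either a sibling, with cost \<open>3 + 3 * reach j\<close>, or a factor
  \<open>1 - msg_fraction\<close>, with cost \<open>4 * reach j\<close> by the switch; the
  coefficient \<open>3 + 4 * reach j\<close> dominates both, so that only their total number
  matters.\<close>

definition step_error :: "nat \<Rightarrow> nat \<Rightarrow> nat" where
  "step_error j m = m * (3 + 4 * reach j) + (1 + 2 * reach j)"

text \<open>After \<open>rematch h\<close> the partner of \<open>h\<close> is the independent
  half-edge \<open>g\<close>, unless \<open>g = h\<close>, and averaging over \<open>g\<close> turns
  its factor into \<open>1 - msg_fraction\<close>. The other factors are compared before and after
  the rematching. The clocks are fixed, with the clock of the owner of \<open>h\<close> as deadline,
  so no query returns to \<open>h\<close>.\<close>

lemma replace_one_partner:
  fixes T :: "nat \<Rightarrow> real"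
  assumes h: "h \<in> H" and "finite S" "h \<notin> S" "\<And>s. s \<in> S \<Longrightarrow> fst s = fst h"
  defines "t \<equiv> T (fst h)"
  shows "\<bar>avg matchings (\<lambda>\<phi>. (\<Prod>s\<in>S. silent \<phi> T j t (\<phi> s)) * silent \<phi> T j t (\<phi> h) * (1 - msg_fraction \<phi> T j t) ^ r)
      - avg matchings (\<lambda>\<phi>. (\<Prod>s\<in>S. silent \<phi> T j t (\<phi> s)) * (1 - msg_fraction \<phi> T j t) ^ Suc r)\<bar>
      \<le> real (step_error j (card S + r)) / real (card H)"
proof -
  let ?P = "matchings \<times> H"
  define A where "A \<phi> = (\<Prod>s\<in>S. silent \<phi> T j t (\<phi> s))" for \<phi>
  define C where "C \<phi> = (1 - msg_fraction \<phi> T j t) ^ r" for \<phi>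
  have Hne: "H \<noteq> {}"
    using h by auto
  have A01: "A \<phi> \<in> {0..1}" for \<phi>
    unfolding A_def by (auto intro!: prod_nonneg prod_le_1 simp: silent_def)
  have C01: "C \<phi> \<in> {0..1}" for \<phi>
    unfolding C_def using msg_fraction_bounds[of \<phi> T j t] by (auto intro!: power_le_one)
  \<comment> \<open>Over pairs, the first average uses that the rematched matching is again uniform,
    the second that \<open>snd p\<close> is independent of \<open>fst p\<close>.\<close>
  have 1: "avg matchings (\<lambda>\<phi>. A \<phi> * silent \<phi> T j t (\<phi> h) * C \<phi>)
      = avg ?P (\<lambda>p. let \<phi>' = fst (rematch h p) in A \<phi>' * silent \<phi>' T j t (\<phi>' h) * C \<phi>')"
    using avg_rematch[OF h, of "\<lambda>p. A (fst p) * silent (fst p) T j t (fst p h) * C (fst p)"]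
    by (simp add: avg_Times avg_const finite_half_edges Hne Let_def)
  have 2: "avg matchings (\<lambda>\<phi>. A \<phi> * (1 - msg_fraction \<phi> T j t) ^ Suc r)
      = avg ?P (\<lambda>p. A (fst p) * silent (fst p) T j t (snd p) * C (fst p))"
  proof -
    have "avg H (\<lambda>g. A \<phi> * silent \<phi> T j t g * C \<phi>) = A \<phi> * (1 - msg_fraction \<phi> T j t) ^ Suc r" for \<phi>
      using avg_cmult[of H "A \<phi> * C \<phi>" "silent \<phi> T j t"] avg_silent[OF Hne, of \<phi> T j t]
      by (simp add: mult_ac C_def)
    then show ?thesis
      by (simp add: avg_Times)
  qed
  have "\<bar>avg matchings (\<lambda>\<phi>. A \<phi> * silent \<phi> T j t (\<phi> h) * C \<phi>)
      - avg matchings (\<lambda>\<phi>. A \<phi> * (1 - msg_fraction \<phi> T j t) ^ Suc r)\<bar>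
      \<le> avg ?P (\<lambda>p. \<bar>(let \<phi>' = fst (rematch h p) in A \<phi>' * silent \<phi>' T j t (\<phi>' h) * C \<phi>')
          - A (fst p) * silent (fst p) T j t (snd p) * C (fst p)\<bar>)"
    unfolding 1 2 by (rule abs_avg_diff_le)
  also have "\<dots> \<le> avg ?P (\<lambda>p.
      (\<Sum>s\<in>S. \<bar>silent (fst (rematch h p)) T j t (fst (rematch h p) s) - silent (fst p) T j t (fst p s)\<bar>)
      + \<bar>silent (fst (rematch h p)) T j t (fst (rematch h p) h) - silent (fst p) T j t (snd p)\<bar>
      + real r * (real (4 * reach j) / real (card H)))"
  proof (rule avg_mono)
    fix p assume p: "p \<in> ?P"
    define \<phi>' where "\<phi>' = fst (rematch h p)"
    have \<phi>: "fst p \<in> matchings" and "snd p \<in> H"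
      using p by auto
    have "\<bar>A \<phi>' - A (fst p)\<bar> \<le> (\<Sum>s\<in>S. \<bar>silent \<phi>' T j t (\<phi>' s) - silent (fst p) T j t (fst p s)\<bar>)"
      unfolding A_def real_norm_def[symmetric]
      by (rule norm_prod_diff) (simp_all add: silent_def)
    moreover have "\<bar>msg_fraction \<phi>' T j t - msg_fraction (fst p) T j t\<bar> \<le> real (4 * reach j) / real (card H)"
      using msg_fraction_switch[OF \<phi>, of "fst p h" "snd p" T j t]
      by (auto simp: \<phi>'_def rematch_def case_prod_beta)
    then have "\<bar>C \<phi>' - C (fst p)\<bar> \<le> real r * (real (4 * reach j) / real (card H))"
      unfolding C_def real_norm_def[symmetric]
      using norm_power_diff[of "1 - msg_fraction \<phi>' T j t" "1 - msg_fraction (fst p) T j t" r]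
        msg_fraction_bounds[of \<phi>' T j t] msg_fraction_bounds[of "fst p" T j t]
      by (smt (verit) atLeastAtMost_iff mult_left_mono of_nat_0_le_iff real_norm_def)
    ultimately show "\<bar>(let \<phi>' = fst (rematch h p) in A \<phi>' * silent \<phi>' T j t (\<phi>' h) * C \<phi>')
          - A (fst p) * silent (fst p) T j t (snd p) * C (fst p)\<bar>
        \<le> (\<Sum>s\<in>S. \<bar>silent (fst (rematch h p)) T j t (fst (rematch h p) s) - silent (fst p) T j t (fst p s)\<bar>)
          + \<bar>silent (fst (rematch h p)) T j t (fst (rematch h p) h) - silent (fst p) T j t (snd p)\<bar>
          + real r * (real (4 * reach j) / real (card H))"
      unfolding Let_def \<phi>'_def[symmetric]
      using abs_mult3_diff_le[OF A01 silent_bounds C01 A01 silent_bounds C01,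
          of \<phi>' \<phi>' T j t "\<phi>' h" \<phi>' "fst p" "fst p" T j t "snd p" "fst p"]
      by linarith
  qed
  also have "\<dots> \<le> real (card S) * (real (3 + 3 * reach j) / real (card H))
      + real (1 + 2 * reach j) / real (card H) + real r * (real (4 * reach j) / real (card H))"
    unfolding avg_add avg_sum
  proof (intro add_mono)
    show "(\<Sum>s\<in>S. avg ?P (\<lambda>p. \<bar>silent (fst (rematch h p)) T j t (fst (rematch h p) s) - silent (fst p) T j t (fst p s)\<bar>))
        \<le> real (card S) * (real (3 + 3 * reach j) / real (card H))"
      unfolding t_def using assms by (intro sum_bounded_above avg_other_silent_diff) auto
    show "avg ?P (\<lambda>p. \<bar>silent (fst (rematch h p)) T j t (fst (rematch h p) h) - silent (fst p) T j t (snd p)\<bar>)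
        \<le> real (1 + 2 * reach j) / real (card H)"
      unfolding t_def by (rule avg_rematched_silent_diff[OF h])
    show "avg ?P (\<lambda>p. real r * (real (4 * reach j) / real (card H))) \<le> real r * (real (4 * reach j) / real (card H))"
      by (intro avg_le_const) auto
  qed
  also have "\<dots> = (real (card S) * real (3 + 3 * reach j) + real (1 + 2 * reach j) + real r * real (4 * reach j)) / real (card H)"
    by (simp only: add_divide_distrib times_divide_eq_right)
  also have "\<dots> = real (card S * (3 + 3 * reach j) + (1 + 2 * reach j) + r * (4 * reach j)) / real (card H)"
    by (simp only: of_nat_add of_nat_mult)
  also have "\<dots> \<le> real (step_error j (card S + r)) / real (card H)"
  proof (intro divide_right_mono of_nat_mono)
    have "card S * (3 + 3 * reach j) \<le> card S * (3 + 4 * reach j)" "r * (4 * reach j) \<le> r * (3 + 4 * reach j)"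
      by (intro mult_le_mono; simp)+
    then show "card S * (3 + 3 * reach j) + (1 + 2 * reach j) + r * (4 * reach j) \<le> step_error j (card S + r)"
      unfolding step_error_def add_mult_distrib by linarith
  qed simp
  finally show ?thesis
    unfolding A_def C_def .
qed

text \<open>Factors move one at a time from the product to the power. The total
  \<open>card S + r\<close> is preserved, so one error bound serves all steps; \<open>r\<close> is
  generalised because the induction hypothesis is used at \<open>Suc r\<close>.\<close>

lemma replace_partners:
  assumes S: "S \<subseteq> {v} \<times> {..<d v}" and v: "v < n"
  shows "\<bar>avg matchings (\<lambda>\<phi>. (\<Prod>s\<in>S. silent \<phi> T j (T v) (\<phi> s)) * (1 - msg_fraction \<phi> T j (T v)) ^ r)
      - avg matchings (\<lambda>\<phi>. (1 - msg_fraction \<phi> T j (T v)) ^ (card S + r))\<bar>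
      \<le> real (card S) * (real (step_error j (card S + r)) / real (card H))"
proof -
  have "finite S"
    using S by (rule finite_subset) simp
  then show ?thesis
    using S
  proof (induction S arbitrary: r rule: finite_induct)
    case (insert h S)
    let ?z = "\<lambda>\<phi>. 1 - msg_fraction \<phi> T j (T v)" and ?e = "real (step_error j (card (insert h S) + r)) / real (card H)"
    have fh: "fst h = v" and hH: "h \<in> H"
      using insert.prems v by (auto simp: half_edges_def)
    have fS: "fst s = fst h" if "s \<in> S" for s
      using that insert.prems fh by auto
    have c: "card (insert h S) = Suc (card S)"
      using insert.hyps by simp
    have "\<bar>avg matchings (\<lambda>\<phi>. (\<Prod>s\<in>S. silent \<phi> T j (T v) (\<phi> s)) * silent \<phi> T j (T v) (\<phi> h) * ?z \<phi> ^ r)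
        - avg matchings (\<lambda>\<phi>. (\<Prod>s\<in>S. silent \<phi> T j (T v) (\<phi> s)) * ?z \<phi> ^ Suc r)\<bar>
        \<le> real (step_error j (card S + r)) / real (card H)"
      using replace_one_partner[OF hH insert.hyps(1,2) fS, of T j r] unfolding fh .
    also have "\<dots> \<le> ?e"
      by (intro divide_right_mono) (simp_all add: step_error_def c)
    finally have 1: "\<bar>avg matchings (\<lambda>\<phi>. (\<Prod>s\<in>insert h S. silent \<phi> T j (T v) (\<phi> s)) * ?z \<phi> ^ r)
        - avg matchings (\<lambda>\<phi>. (\<Prod>s\<in>S. silent \<phi> T j (T v) (\<phi> s)) * ?z \<phi> ^ Suc r)\<bar> \<le> ?e"
      using insert.hyps by (simp add: mult_ac)
    have 2: "\<bar>avg matchings (\<lambda>\<phi>. (\<Prod>s\<in>S. silent \<phi> T j (T v) (\<phi> s)) * ?z \<phi> ^ Suc r)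
        - avg matchings (\<lambda>\<phi>. ?z \<phi> ^ (card (insert h S) + r))\<bar> \<le> real (card S) * ?e"
      using insert.IH[of "Suc r"] insert.prems by (simp add: c)
    have 3: "real (card (insert h S)) * ?e = ?e + real (card S) * ?e"
      by (simp only: c of_nat_Suc distrib_right mult_1)
    show ?case
      unfolding 3 using 1 2 by linarith
  qed simp
qed

end

section \<open>Expectation and concentration of message fractions\<close>

lemma avg_square_le: "(avg A f)\<^sup>2 \<le> avg A (\<lambda>x. (f x)\<^sup>2)"
proof (cases "finite A \<and> A \<noteq> {}")
  case True
  then have "real (card A) * (avg A f)\<^sup>2 \<le> (\<Sum>x\<in>A. (f x)\<^sup>2)"
    using sum_square_deviation[of A f 0] sum_nonneg[of A "\<lambda>x. (f x - avg A f)\<^sup>2"] by simp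
  moreover have "real (card A) > 0"
    using True by (simp add: card_gt_0_iff)
  ultimately show ?thesis
    by (simp add: avg_def[of A "\<lambda>x. (f x)\<^sup>2"] le_divide_eq mult.commute)
qed (auto simp: avg_def)

locale clock_model = degree_cutoff +
  fixes D :: "nat \<Rightarrow> real measure"
  assumes prob_D: "\<And>k. prob_space (D k)"
    and sets_D[measurable_cong]: "\<And>k. sets (D k) = sets borel"
begin

lemma space_D: "space (D k) = UNIV"
  using sets_eq_imp_space_eq[OF sets_D] by simp

abbreviation clocks :: "(nat \<Rightarrow> real) measure" where
  "clocks \<equiv> \<Pi>\<^sub>M v\<in>{..<n}. D (d v)"

sublocale clocks: prob_space clocks
  by (intro prob_space_PiM prob_D)

lemma measurable_clock[measurable]: "v < n \<Longrightarrow> (\<lambda>T. T v) \<in> borel_measurable clocks"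
  using measurable_component_singleton[of v "{..<n}" "\<lambda>v. D (d v)"]
  by (simp add: measurable_cong_sets[OF refl sets_D])

lemma clock_upd_space: "T \<in> space clocks \<Longrightarrow> v < n \<Longrightarrow> T(v := x) \<in> space clocks"
  by (auto simp: space_PiM PiE_def extensional_def space_D)

end

locale clocked_degrees = clock_model +
  assumes even_half_edges: "even (card (half_edges n d))"
    and half_edges_nonempty: "half_edges n d \<noteq> {}"
begin

lemma matchings_nonempty: "matchings \<noteq> {}"
  by (rule involutions_nonempty[OF finite_half_edges even_half_edges])

text \<open>Expectation over matchings and clocks as a finite average of integrals, so that
  measurability is an issue for the clocks alone.\<close>

definition mean :: "((nat \<times> nat \<Rightarrow> nat \<times> nat) \<Rightarrow> (nat \<Rightarrow> real) \<Rightarrow> real) \<Rightarrow> real" where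
  "mean F = avg matchings (\<lambda>\<phi>. \<integral>T. F \<phi> T \<partial>clocks)"

text \<open>The deadline \<open>f\<close> is random as well, because the recursion replaces it by
  the clock of the vertex just visited.\<close>

lemma measurable_msg:
  assumes \<phi>: "\<phi> \<in> matchings"
    and "\<And>v. v < n \<Longrightarrow> (\<lambda>\<omega>. T \<omega> v) \<in> borel_measurable N"
    and "f \<in> borel_measurable N" "z \<in> H"
  shows "Measurable.pred N (\<lambda>\<omega>. msg \<phi> (T \<omega>) j z (f \<omega>))"
  using assms(3,4)
proof (induction j arbitrary: z f)
  case 0
  have [measurable]: "(\<lambda>\<omega>. T \<omega> (fst z)) \<in> borel_measurable N" "f \<in> borel_measurable N"
    using assms(2)[of "fst z"] 0 by (auto simp: half_edges_def)
  show ?case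
    by simp
next
  case (Suc j)
  have [measurable]: "(\<lambda>\<omega>. T \<omega> (fst z)) \<in> borel_measurable N" "f \<in> borel_measurable N"
    using assms(2)[of "fst z"] Suc.prems by (auto simp: half_edges_def)
  have [measurable]: "Measurable.pred N (\<lambda>\<omega>. msg \<phi> (T \<omega>) j (\<phi> s) (T \<omega> (fst z)))" if "s \<in> siblings z" for s
    using sibling_in_half_edges[OF that Suc.prems(2)]
    by (intro Suc.IH) (simp_all add: involutionsD(4)[OF \<phi>])
  have [measurable]: "Measurable.pred N (\<lambda>\<omega>. \<forall>s\<in>siblings z. \<not> msg \<phi> (T \<omega>) j (\<phi> s) (T \<omega> (fst z)))"
    by (intro pred_intros_finite finite_siblings) measurable
  show ?case
    by simp
qed

lemma measurable_silent:
  assumes "\<phi> \<in> matchings"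
    and "\<And>v. v < n \<Longrightarrow> (\<lambda>\<omega>. T \<omega> v) \<in> borel_measurable N"
    and "f \<in> borel_measurable N" "z \<in> H"
  shows "(\<lambda>\<omega>. silent \<phi> (T \<omega>) j (f \<omega>) z) \<in> borel_measurable N"
  unfolding silent_def using measurable_msg[OF assms] by measurable

lemma measurable_msg_fraction:
  assumes "\<phi> \<in> matchings"
    and "\<And>v. v < n \<Longrightarrow> (\<lambda>\<omega>. T \<omega> v) \<in> borel_measurable N"
    and "f \<in> borel_measurable N"
  shows "(\<lambda>\<omega>. msg_fraction \<phi> (T \<omega>) j (f \<omega>)) \<in> borel_measurable N"
proof -
  have [measurable]: "Measurable.pred N (\<lambda>\<omega>. msg \<phi> (T \<omega>) j z (f \<omega>))" if "z \<in> H" for z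
    by (rule measurable_msg[OF assms that])
  show ?thesis
    unfolding msg_fraction_def avg_def by measurable
qed

lemma mean_nonneg: "(\<And>\<phi> T. 0 \<le> F \<phi> T) \<Longrightarrow> 0 \<le> mean F"
  unfolding mean_def by (intro avg_nonneg Bochner_Integration.integral_nonneg) auto

lemma mean_const: "mean (\<lambda>_ _. c) = c"
  by (simp add: mean_def avg_const finite_matchings matchings_nonempty clocks.prob_space)

text \<open>The variance splits into the conditional variance given the matching, at most
  \<open>c\<^sup>2 * n\<close> from the \<open>n\<close> clocks, and the variance of the conditional
  mean, at most \<open>c\<^sup>2 * card H\<close> from the switches. Cauchy-Schwarz passes to the
  first absolute moment.\<close>

lemma mean_abs_deviation_le:
  assumes meas: "\<And>\<phi>. \<phi> \<in> matchings \<Longrightarrow> F \<phi> \<in> borel_measurable clocks"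
    and bnd: "\<And>\<phi> T. F \<phi> T \<in> {0..1}"
    and sw: "\<And>\<phi> a b T. \<phi> \<in> matchings \<Longrightarrow> a \<in> H \<Longrightarrow> b \<in> H \<Longrightarrow> \<bar>F (switch a b \<phi>) T - F \<phi> T\<bar> \<le> c"
    and cl: "\<And>\<phi> T v x. \<phi> \<in> matchings \<Longrightarrow> v < n \<Longrightarrow> \<bar>F \<phi> (T(v := x)) - F \<phi> T\<bar> \<le> c"
    and "0 \<le> c"
  shows "mean (\<lambda>\<phi> T. \<bar>F \<phi> T - mean F\<bar>) \<le> c * sqrt (real (card H + n))"
proof -
  define m where "m \<phi> = (\<integral>T. F \<phi> T \<partial>clocks)" for \<phi>
  have mF: "mean F = avg matchings m"
    by (simp add: mean_def m_def[abs_def])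
  have b: "\<bar>F \<phi> T\<bar> \<le> 1" for \<phi> T
    using bnd[of \<phi> T] by auto
  have int: "integrable clocks (F \<phi>)" if "\<phi> \<in> matchings" for \<phi>
    using clocks.integrable_of_bounded[OF meas[OF that] b] .
  have m_sw: "\<bar>m (switch a b \<phi>) - m \<phi>\<bar> \<le> c" if *: "\<phi> \<in> matchings" "a \<in> H" "b \<in> H" for \<phi> a b
  proof -
    have **: "switch a b \<phi> \<in> matchings"
      using * by (rule switch_involutions)
    have "m (switch a b \<phi>) - m \<phi> = (\<integral>T. F (switch a b \<phi>) T - F \<phi> T \<partial>clocks)"
      unfolding m_def using int[OF *(1)] int[OF **] by simp
    then show ?thesis
      using clocks.abs_integral_le_const[of "\<lambda>T. F (switch a b \<phi>) T - F \<phi> T" c] sw[OF *]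
        meas[OF *(1)] meas[OF **] by simp
  qed
  have "mean (\<lambda>\<phi> T. (F \<phi> T - mean F)\<^sup>2) = avg matchings (\<lambda>\<phi>. (\<integral>T. (F \<phi> T - m \<phi>)\<^sup>2 \<partial>clocks) + (m \<phi> - mean F)\<^sup>2)"
    unfolding mean_def m_def
    by (intro avg_cong clocks.integral_square_deviation[OF meas b])
  also have "\<dots> \<le> c\<^sup>2 * real n + c\<^sup>2 * real (card H)"
    unfolding avg_add
  proof (intro add_mono)
    show "avg matchings (\<lambda>\<phi>. \<integral>T. (F \<phi> T - m \<phi>)\<^sup>2 \<partial>clocks) \<le> c\<^sup>2 * real n"
    proof (rule avg_le_const)
      fix \<phi> assume "\<phi> \<in> matchings"
      then show "(\<integral>T. (F \<phi> T - m \<phi>)\<^sup>2 \<partial>clocks) \<le> c\<^sup>2 * real n"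
        unfolding m_def
        using variance_PiM_le[of "\<lambda>v. D (d v)" "{..<n}" "F \<phi>" 1 c] prob_D meas b cl by simp
    qed simp
    show "avg matchings (\<lambda>\<phi>. (m \<phi> - mean F)\<^sup>2) \<le> c\<^sup>2 * real (card H)"
      unfolding mF using m_sw by (intro avg_involutions_variance_le finite_half_edges)
  qed
  finally have var: "mean (\<lambda>\<phi> T. (F \<phi> T - mean F)\<^sup>2) \<le> c\<^sup>2 * real (card H + n)"
    by (simp add: algebra_simps)
  have m01: "\<bar>mean F\<bar> \<le> 1"
    unfolding mean_def
    by (intro order_trans[OF abs_avg_le] avg_le_const clocks.abs_integral_le_const meas b) auto
  have "(mean (\<lambda>\<phi> T. \<bar>F \<phi> T - mean F\<bar>))\<^sup>2 \<le> avg matchings (\<lambda>\<phi>. (\<integral>T. \<bar>F \<phi> T - mean F\<bar> \<partial>clocks)\<^sup>2)"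
    unfolding mean_def[of "\<lambda>\<phi> T. \<bar>F \<phi> T - mean F\<bar>"] by (rule avg_square_le)
  also have "\<dots> \<le> mean (\<lambda>\<phi> T. (F \<phi> T - mean F)\<^sup>2)"
    unfolding mean_def[of "\<lambda>\<phi> T. (F \<phi> T - mean F)\<^sup>2"]
  proof (rule avg_mono, rule clocks.integral_abs_le_sqrt)
    fix \<phi> T show "\<bar>F \<phi> T - mean F\<bar> \<le> 2"
      using b[of \<phi> T] m01 by linarith
  qed (use meas in measurable)
  also note var
  also have "c\<^sup>2 * real (card H + n) = (c * sqrt (real (card H + n)))\<^sup>2"
    by (simp add: power_mult_distrib)
  finally show ?thesis
    by (rule power2_le_imp_le) (use \<open>0 \<le> c\<close> in simp)
qed

lemma integral_clock:
  assumes "v < n" and f: "f \<in> borel_measurable borel" and bnd: "\<And>s. \<bar>f s\<bar> \<le> (B::real)"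
  shows "(\<integral>T. f (T v) \<partial>clocks) = (\<integral>s. f s \<partial>D (d v))"
proof -
  have "(\<integral>T. f (T v) \<partial>clocks) = (\<integral>T. (\<integral>s. f ((T(v := s)) v) \<partial>D (d v)) \<partial>clocks)"
    using assms measurable_compose[OF measurable_clock[OF assms(1)] f]
    by (intro integral_PiM_resample[of "\<lambda>v. D (d v)" _ _ _ B] prob_D) auto
  then show ?thesis
    by (simp add: clocks.prob_space)
qed

text \<open>The first summand collects up to \<open>K\<close> replaced partners and the redrawn
  clock of the vertex; the second is the Lipschitz constant \<open>K\<close> of powers up to
  \<open>K\<close> times the mean distance of \<open>msg_fraction\<close> from \<open>b\<close>. The
  sum over degrees up to \<open>K\<close> yields one bound for all vertices below the
  cutoff.\<close>

definition low_error :: "nat \<Rightarrow> (real \<Rightarrow> real) \<Rightarrow> real" where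
  "low_error j b = real (K * step_error j K + K * reach (Suc j)) / real (card H)
     + real K * (\<Sum>k\<le>K. \<integral>s. mean (\<lambda>\<phi> T. \<bar>msg_fraction \<phi> T j s - b s\<bar>) \<partial>D k)"

lemma measurable_msg_fraction_pair:
  assumes "\<phi> \<in> matchings"
  shows "(\<lambda>(T, s). msg_fraction \<phi> T j s) \<in> borel_measurable (clocks \<Otimes>\<^sub>M D k)"
    and "(\<lambda>(T, s). msg_fraction \<phi> (T(v := s)) j s) \<in> borel_measurable (clocks \<Otimes>\<^sub>M D k)"
proof -
  have c: "(\<lambda>p. fst p v) \<in> borel_measurable (clocks \<Otimes>\<^sub>M D k)" if "v < n" for v
    using measurable_compose[OF measurable_fst measurable_clock[OF that]] .
  have s[measurable]: "snd \<in> borel_measurable (clocks \<Otimes>\<^sub>M D k)"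
    by measurable
  show "(\<lambda>(T, s). msg_fraction \<phi> T j s) \<in> borel_measurable (clocks \<Otimes>\<^sub>M D k)"
    unfolding case_prod_beta by (intro measurable_msg_fraction assms c s)
  show "(\<lambda>(T, s). msg_fraction \<phi> (T(v := s)) j s) \<in> borel_measurable (clocks \<Otimes>\<^sub>M D k)"
    unfolding case_prod_beta
    by (intro measurable_msg_fraction assms s) (use c in \<open>simp add: fun_upd_def\<close>)
qed

text \<open>Three replacements: the partners of \<open>S\<close> by independent half-edges, the
  clock of \<open>v\<close> by a fresh one that no longer influences the fraction, and the fraction
  by the deterministic \<open>b\<close>. The siblings with \<open>A = {..<t}\<close> give the
  messages, all half-edges of \<open>v\<close> with \<open>A = UNIV\<close> the active
  vertices.\<close>

lemma mean_cavity:
  assumes v: "v < n" "d v \<le> K" and S: "S \<subseteq> {v} \<times> {..<d v}" and A[measurable]: "A \<in> sets borel"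
    and b[measurable]: "b \<in> borel_measurable borel" and b01: "\<And>s. b s \<in> {0..1}"
  shows "\<bar>mean (\<lambda>\<phi> T. indicator A (T v) * (\<Prod>s\<in>S. silent \<phi> T j (T v) (\<phi> s)))
      - (\<integral>s. indicator A s * (1 - b s) ^ card S \<partial>D (d v))\<bar> \<le> low_error j b"
proof -
  interpret Dv: prob_space "D (d v)"
    by (rule prob_D)
  interpret PD: pair_prob_space clocks "D (d v)" ..
  let ?k = "card S" and ?z = "msg_fraction"
  have kK: "?k \<le> K"
    using card_mono[OF _ S] v(2) by (simp add: card_cartesian_product)
  note T_v = measurable_clock[OF v(1)]
  have z01: "\<bar>1 - ?z \<phi> T j t\<bar> \<le> 1" "\<bar>?z \<phi> T j t - b s\<bar> \<le> 1" for \<phi> T t s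
    using msg_fraction_bounds[of \<phi> T j t] b01[of s] by auto
  have zp: "\<bar>(1 - ?z \<phi> T j t) ^ r\<bar> \<le> 1" "\<bar>(1 - b t) ^ r\<bar> \<le> 1" for \<phi> T t r
    using msg_fraction_bounds[of \<phi> T j t] b01[of t] by (auto simp: power_abs intro!: power_le_one)
  have ind: "\<bar>indicator A x * y :: real\<bar> \<le> 1" if "\<bar>y\<bar> \<le> 1" for x y
    using that by (auto simp: indicator_def)
  have m1: "(\<lambda>T. indicator A (T v) * (\<Prod>s\<in>S. silent \<phi> T j (T v) (\<phi> s))) \<in> borel_measurable clocks"
    if \<phi>: "\<phi> \<in> matchings" for \<phi>
  proof -
    have [measurable]: "(\<lambda>T. silent \<phi> T j (T v) (\<phi> s)) \<in> borel_measurable clocks" if "s \<in> S" for s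
    proof (rule measurable_silent[OF \<phi> measurable_clock T_v])
      have "s \<in> H"
        using S that v by (auto simp: half_edges_def)
      then show "\<phi> s \<in> H"
        by (rule involutionsD(4)[OF \<phi>])
    qed
    have [measurable]: "(\<lambda>T. T v) \<in> borel_measurable clocks"
      by (rule T_v)
    show ?thesis
      by measurable
  qed
  have m2: "(\<lambda>T. indicator A (T v) * (1 - ?z \<phi> T j (T v)) ^ ?k) \<in> borel_measurable clocks"
    if \<phi>: "\<phi> \<in> matchings" for \<phi>
  proof -
    have [measurable]: "(\<lambda>T. ?z \<phi> T j (T v)) \<in> borel_measurable clocks"
      by (rule measurable_msg_fraction[OF \<phi> measurable_clock T_v])
    have [measurable]: "(\<lambda>T. T v) \<in> borel_measurable clocks"
      by (rule T_v)
    show ?thesis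
      by measurable
  qed
  have p01: "\<bar>\<Prod>s\<in>S. silent \<phi> T j t (\<phi> s)\<bar> \<le> 1" for \<phi> T t
    unfolding abs_prod by (intro prod_le_1) (simp add: silent_def)
  have "\<bar>mean (\<lambda>\<phi> T. indicator A (T v) * (\<Prod>s\<in>S. silent \<phi> T j (T v) (\<phi> s)))
      - mean (\<lambda>\<phi> T. indicator A (T v) * (1 - ?z \<phi> T j (T v)) ^ ?k)\<bar>
      = \<bar>\<integral>T. avg matchings (\<lambda>\<phi>. indicator A (T v) * (\<Prod>s\<in>S. silent \<phi> T j (T v) (\<phi> s)))
          - avg matchings (\<lambda>\<phi>. indicator A (T v) * (1 - ?z \<phi> T j (T v)) ^ ?k) \<partial>clocks\<bar>"
  proof -
    \<comment> \<open>Average and integral are interchanged because the replacement of partners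
      holds for each fixed clock vector.\<close>
    have "mean F = (\<integral>T. avg matchings (\<lambda>\<phi>. F \<phi> T) \<partial>clocks)"
        "integrable clocks (\<lambda>T. avg matchings (\<lambda>\<phi>. F \<phi> T))"
      if "\<And>\<phi>. \<phi> \<in> matchings \<Longrightarrow> F \<phi> \<in> borel_measurable clocks" "\<And>\<phi> T. \<bar>F \<phi> T\<bar> \<le> 1" for F
    proof -
      have "integrable clocks (F \<phi>)" if "\<phi> \<in> matchings" for \<phi>
        using that \<open>\<And>\<phi>. \<phi> \<in> matchings \<Longrightarrow> F \<phi> \<in> borel_measurable clocks\<close> \<open>\<And>\<phi> T. \<bar>F \<phi> T\<bar> \<le> 1\<close>
        by (intro clocks.integrable_of_bounded[where B = 1]) auto
      then show "mean F = (\<integral>T. avg matchings (\<lambda>\<phi>. F \<phi> T) \<partial>clocks)"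
          "integrable clocks (\<lambda>T. avg matchings (\<lambda>\<phi>. F \<phi> T))"
        by (simp_all add: mean_def avg_def)
    qed
    note sw = this
    show ?thesis
      using m1 m2 ind[OF p01] ind[OF zp(1)] by (subst (1 2) sw(1)) (auto simp: sw(2))
  qed
  also have "\<dots> \<le> real (K * step_error j K) / real (card H)"
  proof (rule clocks.abs_integral_le_const)
    show "(\<lambda>T. avg matchings (\<lambda>\<phi>. indicator A (T v) * (\<Prod>s\<in>S. silent \<phi> T j (T v) (\<phi> s)))
          - avg matchings (\<lambda>\<phi>. indicator A (T v) * (1 - ?z \<phi> T j (T v)) ^ ?k)) \<in> borel_measurable clocks"
      unfolding avg_def using m1 m2 by measurable
    fix T
    have "\<bar>avg matchings (\<lambda>\<phi>. indicator A (T v) * (\<Prod>s\<in>S. silent \<phi> T j (T v) (\<phi> s)))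
          - avg matchings (\<lambda>\<phi>. indicator A (T v) * (1 - ?z \<phi> T j (T v)) ^ ?k)\<bar>
        \<le> \<bar>avg matchings (\<lambda>\<phi>. \<Prod>s\<in>S. silent \<phi> T j (T v) (\<phi> s))
          - avg matchings (\<lambda>\<phi>. (1 - ?z \<phi> T j (T v)) ^ ?k)\<bar>"
      by (auto simp: indicator_def avg_cmult)
    also have "\<dots> \<le> real ?k * (real (step_error j ?k) / real (card H))"
      using replace_partners[OF S v(1), of T j 0] by simp
    also have "\<dots> \<le> real K * (real (step_error j K) / real (card H))"
      using kK by (intro mult_mono divide_right_mono) (auto simp: step_error_def)
    finally show "\<bar>avg matchings (\<lambda>\<phi>. indicator A (T v) * (\<Prod>s\<in>S. silent \<phi> T j (T v) (\<phi> s)))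
          - avg matchings (\<lambda>\<phi>. indicator A (T v) * (1 - ?z \<phi> T j (T v)) ^ ?k)\<bar>
        \<le> real (K * step_error j K) / real (card H)"
      by simp
  qed
  finally have 1: "\<bar>mean (\<lambda>\<phi> T. indicator A (T v) * (\<Prod>s\<in>S. silent \<phi> T j (T v) (\<phi> s)))
      - mean (\<lambda>\<phi> T. indicator A (T v) * (1 - ?z \<phi> T j (T v)) ^ ?k)\<bar>
      \<le> real (K * step_error j K) / real (card H)" .

  let ?c = "real K * (real (reach (Suc j)) / real (card H))"
  define I where "I = (\<integral>s. indicator A s * (1 - b s) ^ ?k \<partial>D (d v))"
  \<comment> \<open>The fraction with the redrawn clock differs from the original by the influence
    of one clock, and \<open>?k\<close>-th powers are \<open>?k\<close>-Lipschitz on the unit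
    interval.\<close>
  have bz: "\<bar>(1 - ?z \<phi> (T(v := s)) j s) ^ ?k - (1 - b s) ^ ?k\<bar> \<le> ?c + real K * \<bar>?z \<phi> T j s - b s\<bar>"
    if \<phi>: "\<phi> \<in> matchings" for \<phi> T s
  proof -
    have "\<bar>(1 - ?z \<phi> (T(v := s)) j s) ^ ?k - (1 - b s) ^ ?k\<bar> \<le> real ?k * \<bar>?z \<phi> (T(v := s)) j s - b s\<bar>"
      using norm_power_diff[of "1 - ?z \<phi> (T(v := s)) j s" "1 - b s" ?k]
        msg_fraction_bounds[of \<phi> "T(v := s)" j s] b01[of s] by (simp add: abs_minus_commute)
    also have "\<dots> \<le> real K * (real (reach (Suc j)) / real (card H) + \<bar>?z \<phi> T j s - b s\<bar>)"
      using kK msg_fraction_clock[OF \<phi>, of T v s j s] by (intro mult_mono) auto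
    finally show ?thesis
      by (simp add: distrib_left)
  qed
  have "\<bar>mean (\<lambda>\<phi> T. indicator A (T v) * (1 - ?z \<phi> T j (T v)) ^ ?k) - I\<bar>
      \<le> avg matchings (\<lambda>\<phi>. \<bar>(\<integral>T. indicator A (T v) * (1 - ?z \<phi> T j (T v)) ^ ?k \<partial>clocks) - I\<bar>)"
    unfolding mean_def
    using abs_avg_diff_le[of matchings _ "\<lambda>_. I"] by (simp add: avg_const finite_matchings matchings_nonempty)
  also have "\<dots> \<le> avg matchings (\<lambda>\<phi>. ?c + real K * (\<integral>s. (\<integral>T. \<bar>?z \<phi> T j s - b s\<bar> \<partial>clocks) \<partial>D (d v)))"
  proof (rule avg_mono)
    fix \<phi> assume \<phi>: "\<phi> \<in> matchings"
    note mz[measurable] = measurable_msg_fraction_pair[OF \<phi>]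
    define f where "f T s = indicator A s * (1 - ?z \<phi> (T(v := s)) j s) ^ ?k" for T s
    define g where "g T s = \<bar>?z \<phi> T j s - b s\<bar>" for T s
    define i where "i s = indicator A s * (1 - b s) ^ ?k" for s
    have mf[measurable]: "(\<lambda>(T, s). f T s) \<in> borel_measurable (clocks \<Otimes>\<^sub>M D (d v))"
      using mz(2)[of j v "d v"] unfolding f_def case_prod_beta by measurable
    have mg[measurable]: "(\<lambda>(T, s). g T s) \<in> borel_measurable (clocks \<Otimes>\<^sub>M D (d v))"
      using mz(1)[of j "d v"] unfolding g_def case_prod_beta by measurable
    have mi[measurable]: "i \<in> borel_measurable borel"
      unfolding i_def by measurable
    have bf: "\<bar>f T s\<bar> \<le> 1" and bg: "\<bar>g T s\<bar> \<le> 1" and bi: "\<bar>i s\<bar> \<le> 1" for T s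
      unfolding f_def g_def i_def using ind[OF zp(1)] ind[OF zp(2)] z01(2) by auto
    have intf: "integrable (clocks \<Otimes>\<^sub>M D (d v)) (\<lambda>(T, s). f T s)"
      and intg: "integrable (clocks \<Otimes>\<^sub>M D (d v)) (\<lambda>(T, s). g T s)"
      and inti: "integrable (clocks \<Otimes>\<^sub>M D (d v)) (\<lambda>(T, s). i s)"
      using bf bg bi by (intro PD.integrable_of_bounded[where B = 1]; auto)+
    \<comment> \<open>Redrawing the clock of \<open>v\<close> makes the time \<open>s\<close>
      independent of \<open>T\<close>, so that \<open>g\<close> can be integrated over
      \<open>T\<close> first, for fixed \<open>s\<close>.\<close>
    have "(\<integral>T. indicator A (T v) * (1 - ?z \<phi> T j (T v)) ^ ?k \<partial>clocks)
        = (\<integral>T. (\<integral>s. f T s \<partial>D (d v)) \<partial>clocks)"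
      using integral_PiM_resample[of "\<lambda>v. D (d v)" "{..<n}" v, OF prob_D _ _ m2[OF \<phi>] ind[OF zp(1)]] v(1)
      by (simp add: f_def)
    also have "\<dots> = (\<integral>p. (\<lambda>(T, s). f T s) p \<partial>(clocks \<Otimes>\<^sub>M D (d v)))"
      by (rule PD.integral_fst'[OF intf, simplified])
    finally have a: "(\<integral>T. indicator A (T v) * (1 - ?z \<phi> T j (T v)) ^ ?k \<partial>clocks)
        = (\<integral>p. (\<lambda>(T, s). f T s) p \<partial>(clocks \<Otimes>\<^sub>M D (d v)))" .
    have "(\<integral>T. (\<integral>s. i s \<partial>D (d v)) \<partial>clocks) = (\<integral>p. (\<lambda>(T, s). i s) p \<partial>(clocks \<Otimes>\<^sub>M D (d v)))"
      using PD.integral_fst'[OF inti] by simp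
    then have bI: "I = (\<integral>p. (\<lambda>(T, s). i s) p \<partial>(clocks \<Otimes>\<^sub>M D (d v)))"
      by (simp add: clocks.prob_space I_def i_def)
    have "\<bar>(\<integral>T. indicator A (T v) * (1 - ?z \<phi> T j (T v)) ^ ?k \<partial>clocks) - I\<bar>
        = \<bar>\<integral>p. (\<lambda>(T, s). f T s) p - (\<lambda>(T, s). i s) p \<partial>(clocks \<Otimes>\<^sub>M D (d v))\<bar>"
      unfolding a bI by (simp only: Bochner_Integration.integral_diff[OF intf inti])
    also have "\<dots> \<le> (\<integral>p. \<bar>(\<lambda>(T, s). f T s) p - (\<lambda>(T, s). i s) p\<bar> \<partial>(clocks \<Otimes>\<^sub>M D (d v)))"
      by (rule integral_abs_bound)
    also have "\<dots> \<le> (\<integral>p. ?c + real K * (\<lambda>(T, s). g T s) p \<partial>(clocks \<Otimes>\<^sub>M D (d v)))"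
    proof (rule integral_mono)
      show "integrable (clocks \<Otimes>\<^sub>M D (d v)) (\<lambda>p. ?c + real K * (\<lambda>(T, s). g T s) p)"
        using intg by simp
      show "integrable (clocks \<Otimes>\<^sub>M D (d v)) (\<lambda>p. \<bar>(\<lambda>(T, s). f T s) p - (\<lambda>(T, s). i s) p\<bar>)"
        by (intro integrable_abs Bochner_Integration.integrable_diff intf inti)
      fix p :: "(nat \<Rightarrow> real) \<times> real"
      obtain T s where p: "p = (T, s)"
        by (cases p)
      have "\<bar>f T s - i s\<bar> \<le> \<bar>(1 - ?z \<phi> (T(v := s)) j s) ^ ?k - (1 - b s) ^ ?k\<bar>"
        unfolding f_def i_def by (simp add: indicator_def)
      also note bz[OF \<phi>]
      finally show "\<bar>(\<lambda>(T, s). f T s) p - (\<lambda>(T, s). i s) p\<bar> \<le> ?c + real K * (\<lambda>(T, s). g T s) p"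
        by (simp add: p g_def)
    qed
    also have "\<dots> = ?c + real K * (\<integral>p. (\<lambda>(T, s). g T s) p \<partial>(clocks \<Otimes>\<^sub>M D (d v)))"
      using intg by (simp add: PD.prob_space)
    also have "(\<integral>p. (\<lambda>(T, s). g T s) p \<partial>(clocks \<Otimes>\<^sub>M D (d v))) = (\<integral>s. (\<integral>T. g T s \<partial>clocks) \<partial>D (d v))"
      by (rule PD.integral_snd[OF intg, symmetric])
    finally show "\<bar>(\<integral>T. indicator A (T v) * (1 - ?z \<phi> T j (T v)) ^ ?k \<partial>clocks) - I\<bar>
        \<le> ?c + real K * (\<integral>s. (\<integral>T. \<bar>?z \<phi> T j s - b s\<bar> \<partial>clocks) \<partial>D (d v))"
      by (simp add: g_def)
  qed
  also have "\<dots> = ?c + real K * (\<integral>s. mean (\<lambda>\<phi> T. \<bar>?z \<phi> T j s - b s\<bar>) \<partial>D (d v))"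
  proof -
    have "integrable (D (d v)) (\<lambda>s. \<integral>T. \<bar>?z \<phi> T j s - b s\<bar> \<partial>clocks)" if \<phi>: "\<phi> \<in> matchings" for \<phi>
    proof (rule Dv.integrable_of_bounded[where B = 1])
      have [measurable]: "(\<lambda>(T, s). ?z \<phi> T j s) \<in> borel_measurable (clocks \<Otimes>\<^sub>M D (d v))"
        by (rule measurable_msg_fraction_pair(1)[OF \<phi>])
      have "(\<lambda>(s, T). \<bar>?z \<phi> T j s - b s\<bar>) \<in> borel_measurable (D (d v) \<Otimes>\<^sub>M clocks)"
        by measurable
      then show "(\<lambda>s. \<integral>T. \<bar>?z \<phi> T j s - b s\<bar> \<partial>clocks) \<in> borel_measurable (D (d v))"
        by (rule clocks.borel_measurable_lebesgue_integral)
      fix s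
      have "(\<lambda>T. ?z \<phi> T j s) \<in> borel_measurable clocks"
        by (rule measurable_msg_fraction[OF \<phi>, where f = "\<lambda>_. s"]) (auto intro: measurable_clock)
      then show "\<bar>\<integral>T. \<bar>?z \<phi> T j s - b s\<bar> \<partial>clocks\<bar> \<le> 1"
        using z01(2) by (intro clocks.abs_integral_le_const) auto
    qed
    then show ?thesis
      by (simp add: avg_add avg_const avg_cmult finite_matchings matchings_nonempty mean_def avg_def)
  qed
  also have "(\<integral>s. mean (\<lambda>\<phi> T. \<bar>?z \<phi> T j s - b s\<bar>) \<partial>D (d v))
      \<le> (\<Sum>k\<le>K. \<integral>s. mean (\<lambda>\<phi> T. \<bar>?z \<phi> T j s - b s\<bar>) \<partial>D k)"
    using v(2) by (intro member_le_sum Bochner_Integration.integral_nonneg mean_nonneg) auto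
  finally have 2: "\<bar>mean (\<lambda>\<phi> T. indicator A (T v) * (1 - ?z \<phi> T j (T v)) ^ ?k) - I\<bar>
      \<le> ?c + real K * (\<Sum>k\<le>K. \<integral>s. mean (\<lambda>\<phi> T. \<bar>?z \<phi> T j s - b s\<bar>) \<partial>D k)"
    by (simp add: mult_left_mono)
  have "low_error j b = real (K * step_error j K) / real (card H)
      + (?c + real K * (\<Sum>k\<le>K. \<integral>s. mean (\<lambda>\<phi> T. \<bar>?z \<phi> T j s - b s\<bar>) \<partial>D k))"
    by (simp only: low_error_def of_nat_add of_nat_mult add_divide_distrib times_divide_eq_right add.assoc)
  then show ?thesis
    using 1 2 unfolding I_def by linarith
qed

end

section \<open>Fraction of active vertices at finite depth\<close>

context clocked_degrees
begin

text \<open>All half-edges of \<open>v\<close> count here, as no edge leads back to an asking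
  vertex. Activity is the absence of messages, so the parity is opposite to that of
  \<open>msg\<close>: odd \<open>j\<close> bounds from above, and a vertex beyond the cutoff then
  counts as active.\<close>

definition active_bound :: "(nat \<times> nat \<Rightarrow> nat \<times> nat) \<Rightarrow> (nat \<Rightarrow> real) \<Rightarrow> nat \<Rightarrow> nat \<Rightarrow> bool" where
  "active_bound \<phi> T j v \<longleftrightarrow>
     (if K < d v then odd j else \<forall>s\<in>{v} \<times> {..<d v}. \<not> msg \<phi> T j (\<phi> s) (T v))"

definition active_fraction :: "(nat \<times> nat \<Rightarrow> nat \<times> nat) \<Rightarrow> (nat \<Rightarrow> real) \<Rightarrow> nat \<Rightarrow> real" where
  "active_fraction \<phi> T j = avg {..<n} (\<lambda>v. of_bool (active_bound \<phi> T j v))"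

lemma n_pos: "n > 0"
  using half_edges_nonempty by (auto simp: half_edges_def)

lemma active_fraction_bounds: "active_fraction \<phi> T j \<in> {0..1}"
  unfolding active_fraction_def by (rule avg_in_unit) simp

text \<open>An answer changes because a half-edge of the vertex has a new partner, which concerns
  the owners of four half-edges, or because an unchanged partner sends a different message, and each
  such partner accounts for one vertex.\<close>

lemma active_fraction_switch:
  assumes \<phi>: "\<phi> \<in> matchings"
  shows "\<bar>active_fraction (switch a b \<phi>) T j - active_fraction \<phi> T j\<bar> \<le> real (4 + 4 * reach j) / real n"
proof -
  have "\<bar>active_fraction (switch a b \<phi>) T j - active_fraction \<phi> T j\<bar>
      \<le> real (4 + 4 * reach j) / real (card {..<n})"
    unfolding active_fraction_def
  proof (rule abs_avg_of_bool_diff_le)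
    let ?S = "switch_sensitive \<phi> T a b j"
    have "{v \<in> {..<n}. active_bound (switch a b \<phi>) T j v \<noteq> active_bound \<phi> T j v}
        \<subseteq> fst ` {a, b, \<phi> a, \<phi> b} \<union> (\<lambda>z. fst (\<phi> z)) ` ?S"
    proof
      fix v assume *: "v \<in> {v \<in> {..<n}. active_bound (switch a b \<phi>) T j v \<noteq> active_bound \<phi> T j v}"
      have "\<exists>s\<in>{v} \<times> {..<d v}. msg (switch a b \<phi>) T j (switch a b \<phi> s) (T v) \<noteq> msg \<phi> T j (\<phi> s) (T v)"
      proof (rule ccontr)
        assume "\<not> ?thesis"
        then have "active_bound (switch a b \<phi>) T j v = active_bound \<phi> T j v"
          unfolding active_bound_def by (intro if_cong ball_cong refl arg_cong[of _ _ Not]) blast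
        with * show False
          by simp
      qed
      then obtain s where s: "s \<in> {v} \<times> {..<d v}"
          and ne: "msg (switch a b \<phi>) T j (switch a b \<phi> s) (T v) \<noteq> msg \<phi> T j (\<phi> s) (T v)"
        by blast
      have sH: "s \<in> H" and fs: "fst s = v"
        using s * by (auto simp: half_edges_def)
      show "v \<in> fst ` {a, b, \<phi> a, \<phi> b} \<union> (\<lambda>z. fst (\<phi> z)) ` ?S"
      proof (cases "switch a b \<phi> s = \<phi> s")
        case True
        then have "\<phi> s \<in> ?S"
          using ne involutionsD(4)[OF \<phi> sH] by (auto simp: switch_sensitive_def)
        moreover have "v = fst (\<phi> (\<phi> s))"
          using involutionsD(2)[OF \<phi>] fs by simp
        ultimately show ?thesis
          by blast
      next
        case False
        from switch_differs[OF \<phi> this] show ?thesis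
          using fs by blast
      qed
    qed
    then have "card {v \<in> {..<n}. active_bound (switch a b \<phi>) T j v \<noteq> active_bound \<phi> T j v}
        \<le> card (fst ` {a, b, \<phi> a, \<phi> b} \<union> (\<lambda>z. fst (\<phi> z)) ` ?S)"
      by (intro card_mono) (simp_all add: finite_switch_sensitive)
    also have "\<dots> \<le> card (fst ` {a, b, \<phi> a, \<phi> b}) + card ((\<lambda>z. fst (\<phi> z)) ` ?S)"
      by (rule card_Un_le)
    also have "\<dots> \<le> 4 + 4 * reach j"
    proof (intro add_mono)
      have "card (fst ` {a, b, \<phi> a, \<phi> b}) \<le> card {a, b, \<phi> a, \<phi> b}"
        by (rule card_image_le) simp
      also have "\<dots> \<le> 4"
        by (simp add: card_insert_if)
      finally show "card (fst ` {a, b, \<phi> a, \<phi> b}) \<le> 4" .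
      show "card ((\<lambda>z. fst (\<phi> z)) ` ?S) \<le> 4 * reach j"
        by (rule le_trans[OF card_image_le[OF finite_switch_sensitive] card_switch_sensitive_le[OF \<phi>]])
    qed
    finally show "card {v \<in> {..<n}. active_bound (switch a b \<phi>) T j v \<noteq> active_bound \<phi> T j v} \<le> 4 + 4 * reach j" .
  qed simp
  then show ?thesis
    by simp
qed

lemma active_fraction_clock:
  assumes \<phi>: "\<phi> \<in> matchings"
  shows "\<bar>active_fraction \<phi> (T(u := x)) j - active_fraction \<phi> T j\<bar> \<le> real (1 + reach (Suc j)) / real n"
proof -
  have "\<bar>active_fraction \<phi> (T(u := x)) j - active_fraction \<phi> T j\<bar>
      \<le> real (1 + reach (Suc j)) / real (card {..<n})"
    unfolding active_fraction_def
  proof (rule abs_avg_of_bool_diff_le)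
    let ?S = "clock_sensitive \<phi> T u x j"
    have "{v \<in> {..<n}. active_bound \<phi> (T(u := x)) j v \<noteq> active_bound \<phi> T j v}
        \<subseteq> {u} \<union> (\<lambda>z. fst (\<phi> z)) ` ?S"
    proof
      fix v assume *: "v \<in> {v \<in> {..<n}. active_bound \<phi> (T(u := x)) j v \<noteq> active_bound \<phi> T j v}"
      have "\<exists>s\<in>{v} \<times> {..<d v}. msg \<phi> (T(u := x)) j (\<phi> s) ((T(u := x)) v) \<noteq> msg \<phi> T j (\<phi> s) (T v)"
      proof (rule ccontr)
        assume "\<not> ?thesis"
        then have "active_bound \<phi> (T(u := x)) j v = active_bound \<phi> T j v"
          unfolding active_bound_def by (intro if_cong ball_cong refl arg_cong[of _ _ Not]) blast
        with * show False
          by simp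
      qed
      then obtain s where s: "s \<in> {v} \<times> {..<d v}"
          and ne: "msg \<phi> (T(u := x)) j (\<phi> s) ((T(u := x)) v) \<noteq> msg \<phi> T j (\<phi> s) (T v)"
        by blast
      have sH: "s \<in> H" and fs: "fst s = v"
        using s * by (auto simp: half_edges_def)
      show "v \<in> {u} \<union> (\<lambda>z. fst (\<phi> z)) ` ?S"
      proof (cases "v = u")
        case False
        then have "\<phi> s \<in> ?S"
          using ne involutionsD(4)[OF \<phi> sH] by (auto simp: clock_sensitive_def)
        moreover have "v = fst (\<phi> (\<phi> s))"
          using involutionsD(2)[OF \<phi>] fs by simp
        ultimately show ?thesis
          by blast
      qed simp
    qed
    then have "card {v \<in> {..<n}. active_bound \<phi> (T(u := x)) j v \<noteq> active_bound \<phi> T j v}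
        \<le> card ({u} \<union> (\<lambda>z. fst (\<phi> z)) ` ?S)"
      by (intro card_mono) (simp_all add: finite_clock_sensitive)
    also have "\<dots> \<le> card {u} + card ((\<lambda>z. fst (\<phi> z)) ` ?S)"
      by (rule card_Un_le)
    also have "\<dots> \<le> 1 + reach (Suc j)"
      using le_trans[OF card_image_le[OF finite_clock_sensitive] card_clock_sensitive_le[OF \<phi>]]
      by (intro add_mono) simp_all
    finally show "card {v \<in> {..<n}. active_bound \<phi> (T(u := x)) j v \<noteq> active_bound \<phi> T j v} \<le> 1 + reach (Suc j)" .
  qed simp
  then show ?thesis
    by simp
qed

lemma measurable_active_bound:
  assumes \<phi>: "\<phi> \<in> matchings" and v: "v < n"
  shows "Measurable.pred clocks (\<lambda>T. active_bound \<phi> T j v)"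
proof -
  have [measurable]: "Measurable.pred clocks (\<lambda>T. msg \<phi> T j (\<phi> s) (T v))" if "s \<in> {v} \<times> {..<d v}" for s
  proof (rule measurable_msg[OF \<phi> measurable_clock measurable_clock[OF v]])
    have "s \<in> H"
      using that v by (auto simp: half_edges_def)
    then show "\<phi> s \<in> H"
      by (rule involutionsD(4)[OF \<phi>])
  qed
  have "Measurable.pred clocks (\<lambda>T. \<forall>s\<in>{v} \<times> {..<d v}. \<not> msg \<phi> T j (\<phi> s) (T v))"
    by (intro pred_intros_finite) (auto, measurable)
  then show ?thesis
    unfolding active_bound_def by simp
qed

lemma measurable_active_fraction:
  assumes "\<phi> \<in> matchings"
  shows "(\<lambda>T. active_fraction \<phi> T j) \<in> borel_measurable clocks"
  unfolding active_fraction_def avg_def using measurable_active_bound[OF assms] by measurable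

lemma mean_avg:
  assumes "\<And>z \<phi>. z \<in> B \<Longrightarrow> \<phi> \<in> matchings \<Longrightarrow> integrable clocks (f z \<phi>)"
  shows "mean (\<lambda>\<phi> T. avg B (\<lambda>z. f z \<phi> T)) = avg B (\<lambda>z. mean (f z))"
proof -
  have "mean (\<lambda>\<phi> T. avg B (\<lambda>z. f z \<phi> T)) = avg matchings (\<lambda>\<phi>. avg B (\<lambda>z. \<integral>T. f z \<phi> T \<partial>clocks))"
    unfolding mean_def using assms by (intro avg_cong) (simp add: avg_def)
  also have "\<dots> = avg B (\<lambda>z. mean (f z))"
    unfolding mean_def avg_def[of B] by (simp add: avg_divide avg_sum)
  finally show ?thesis .
qed

lemma mean_abs_diff_triangle:
  assumes meas: "\<And>\<phi>. \<phi> \<in> matchings \<Longrightarrow> F \<phi> \<in> borel_measurable clocks"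
    and bnd: "\<And>\<phi> T. F \<phi> T \<in> {0..1}"
  shows "mean (\<lambda>\<phi> T. \<bar>F \<phi> T - y\<bar>) \<le> mean (\<lambda>\<phi> T. \<bar>F \<phi> T - x\<bar>) + \<bar>x - y\<bar>"
proof -
  have int: "integrable clocks (\<lambda>T. \<bar>F \<phi> T - x\<bar>)" if "\<phi> \<in> matchings" for \<phi> x
  proof (rule clocks.integrable_of_bounded[where B = "1 + \<bar>x\<bar>"])
    fix T show "\<bar>\<bar>F \<phi> T - x\<bar>\<bar> \<le> 1 + \<bar>x\<bar>"
      using bnd[of \<phi> T] by auto
  qed (use meas[OF that] in measurable)
  have "mean (\<lambda>\<phi> T. \<bar>F \<phi> T - y\<bar>) \<le> avg matchings (\<lambda>\<phi>. (\<integral>T. \<bar>F \<phi> T - x\<bar> \<partial>clocks) + \<bar>x - y\<bar>)"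
    unfolding mean_def[of "\<lambda>\<phi> T. \<bar>F \<phi> T - y\<bar>"]
  proof (rule avg_mono)
    fix \<phi> assume \<phi>: "\<phi> \<in> matchings"
    have "(\<integral>T. \<bar>F \<phi> T - y\<bar> \<partial>clocks) \<le> (\<integral>T. \<bar>F \<phi> T - x\<bar> + \<bar>x - y\<bar> \<partial>clocks)"
      using int[OF \<phi>] by (intro integral_mono) auto
    then show "(\<integral>T. \<bar>F \<phi> T - y\<bar> \<partial>clocks) \<le> (\<integral>T. \<bar>F \<phi> T - x\<bar> \<partial>clocks) + \<bar>x - y\<bar>"
      using int[OF \<phi>] by (simp add: clocks.prob_space)
  qed
  then show ?thesis
    by (simp add: avg_add avg_const finite_matchings matchings_nonempty mean_def)
qed

definition deviation :: "nat \<Rightarrow> real" where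
  "deviation j = real (4 * reach j + reach (Suc j)) / real (card H) * sqrt (real (card H + n))"

lemma mean_msg_fraction_deviation:
  "mean (\<lambda>\<phi> T. \<bar>msg_fraction \<phi> T j t - mean (\<lambda>\<phi> T. msg_fraction \<phi> T j t)\<bar>) \<le> deviation j"
  unfolding deviation_def
proof (rule mean_abs_deviation_le)
  fix \<phi> assume \<phi>: "\<phi> \<in> matchings"
  show "(\<lambda>T. msg_fraction \<phi> T j t) \<in> borel_measurable clocks"
    by (rule measurable_msg_fraction[OF \<phi>, where f = "\<lambda>_. t"]) (auto intro: measurable_clock)
  show "\<bar>msg_fraction (switch a b \<phi>) T j t - msg_fraction \<phi> T j t\<bar>
      \<le> real (4 * reach j + reach (Suc j)) / real (card H)" for a b T
    using msg_fraction_switch[OF \<phi>, of a b T j t]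
    by (rule order_trans) (intro divide_right_mono of_nat_mono; simp)
  show "\<bar>msg_fraction \<phi> (T(v := x)) j t - msg_fraction \<phi> T j t\<bar>
      \<le> real (4 * reach j + reach (Suc j)) / real (card H)" for v x T
    using msg_fraction_clock[OF \<phi>, of T v x j t]
    by (rule order_trans) (intro divide_right_mono of_nat_mono; simp)
qed (use msg_fraction_bounds in auto)

lemma mean_of_bool_msg:
  assumes "z \<in> H" "\<phi> \<in> matchings"
  shows "integrable clocks (\<lambda>T. of_bool (msg \<phi> T j z t) :: real)"
proof (rule clocks.integrable_of_bounded[where B = 1])
  have [measurable]: "Measurable.pred clocks (\<lambda>T. msg \<phi> T j z t)"
    by (rule measurable_msg[OF assms(2), where f = "\<lambda>_. t"]) (auto intro: measurable_clock assms(1))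
  show "(\<lambda>T. of_bool (msg \<phi> T j z t) :: real) \<in> borel_measurable clocks"
    by measurable
qed simp

lemma mean_msg_fraction:
  "mean (\<lambda>\<phi> T. msg_fraction \<phi> T j t) = avg H (\<lambda>z. mean (\<lambda>\<phi> T. of_bool (msg \<phi> T j z t)))"
  unfolding msg_fraction_def by (rule mean_avg[OF mean_of_bool_msg])

lemma msg_fraction_0:
  "mean (\<lambda>\<phi> T. \<bar>msg_fraction \<phi> T 0 t
      - avg H (\<lambda>z. if K < d (fst z) then 1 else \<integral>s. indicator {..<t} s \<partial>D (d (fst z)))\<bar>) \<le> deviation 0"
proof -
  have "mean (\<lambda>\<phi> T. of_bool (msg \<phi> T 0 z t)) = (if K < d (fst z) then 1 else \<integral>s. indicator {..<t} s \<partial>D (d (fst z)))"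
    if z: "z \<in> H" for z
  proof (cases "K < d (fst z)")
    case False
    have "(\<integral>T. indicator {..<t} (T (fst z)) \<partial>clocks) = (\<integral>s. indicat_real {..<t} s \<partial>D (d (fst z)))"
      by (rule integral_clock[where B = 1]) (use z in \<open>auto simp: half_edges_def\<close>)
    then have "(\<integral>T. of_bool (T (fst z) < t) \<partial>clocks) = (\<integral>s. indicat_real {..<t} s \<partial>D (d (fst z)))"
      by (simp add: indicator_def)
    then show ?thesis
      using False by (simp add: mean_def avg_const finite_matchings matchings_nonempty)
  qed (simp add: mean_const)
  then have "mean (\<lambda>\<phi> T. msg_fraction \<phi> T 0 t)
      = avg H (\<lambda>z. if K < d (fst z) then 1 else \<integral>s. indicator {..<t} s \<partial>D (d (fst z)))"
    unfolding mean_msg_fraction by (rule avg_cong)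
  then show ?thesis
    using mean_msg_fraction_deviation[of 0 t] by simp
qed

lemma low_error_nonneg: "0 \<le> low_error j b"
  unfolding low_error_def
  by (intro add_nonneg_nonneg mult_nonneg_nonneg sum_nonneg Bochner_Integration.integral_nonneg mean_nonneg) auto

text \<open>An answer at a vertex of degree \<open>k\<close> depends on \<open>k - 1\<close>
  siblings, the remaining edge leading to the asking vertex. Concentration turns the estimate of the
  mean into one of the mean absolute deviation, the form that \<open>low_error\<close> needs at the
  next depth.\<close>

lemma msg_fraction_Suc:
  assumes b: "b \<in> borel_measurable borel" "\<And>s. b s \<in> {0..1}"
  shows "mean (\<lambda>\<phi> T. \<bar>msg_fraction \<phi> T (Suc j) t
      - avg H (\<lambda>z. if K < d (fst z) then of_bool (odd j)
          else \<integral>s. indicator {..<t} s * (1 - b s) ^ (d (fst z) - 1) \<partial>D (d (fst z)))\<bar>)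
    \<le> deviation (Suc j) + low_error j b"
proof -
  let ?g = "\<lambda>z. if K < d (fst z) then of_bool (odd j)
          else \<integral>s. indicator {..<t} s * (1 - b s) ^ (d (fst z) - 1) \<partial>D (d (fst z))"
  have "\<bar>mean (\<lambda>\<phi> T. msg_fraction \<phi> T (Suc j) t) - avg H ?g\<bar>
      \<le> avg H (\<lambda>z. \<bar>mean (\<lambda>\<phi> T. of_bool (msg \<phi> T (Suc j) z t)) - ?g z\<bar>)"
    unfolding mean_msg_fraction by (rule abs_avg_diff_le)
  also have "\<dots> \<le> low_error j b"
  proof (rule avg_le_const[OF _ low_error_nonneg])
    fix z assume z: "z \<in> H"
    show "\<bar>mean (\<lambda>\<phi> T. of_bool (msg \<phi> T (Suc j) z t)) - ?g z\<bar> \<le> low_error j b"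
    proof (cases "K < d (fst z)")
      case True
      then show ?thesis
        using low_error_nonneg by (simp add: mean_const)
    next
      case False
      have v: "fst z < n" "snd z < d (fst z)"
        using z by (auto simp: half_edges_def)
      have c: "card (siblings z) = d (fst z) - 1"
        using v by (simp add: siblings_def card_cartesian_product)
      have "of_bool (msg \<phi> T (Suc j) z t)
          = indicator {..<t} (T (fst z)) * (\<Prod>s\<in>siblings z. silent \<phi> T j (T (fst z)) (\<phi> s))" for \<phi> T
      proof -
        have "(\<Prod>s\<in>siblings z. silent \<phi> T j (T (fst z)) (\<phi> s))
            = of_bool (\<forall>s\<in>siblings z. \<not> msg \<phi> T j (\<phi> s) (T (fst z)))"
          unfolding silent_def using finite_siblings[of z]
          by (induction rule: finite_induct) auto
        then show ?thesis
          using False by (simp add: indicator_def)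
      qed
      then have "mean (\<lambda>\<phi> T. of_bool (msg \<phi> T (Suc j) z t))
          = mean (\<lambda>\<phi> T. indicator {..<t} (T (fst z)) * (\<Prod>s\<in>siblings z. silent \<phi> T j (T (fst z)) (\<phi> s)))"
        by simp
      then show ?thesis
        using mean_cavity[OF v(1) _ _ _ b, of "siblings z" "{..<t}" j] False
        by (simp add: c del: msg.simps) (auto simp: siblings_def)
    qed
  qed
  finally have 1: "\<bar>mean (\<lambda>\<phi> T. msg_fraction \<phi> T (Suc j) t) - avg H ?g\<bar> \<le> low_error j b" .
  have "mean (\<lambda>\<phi> T. \<bar>msg_fraction \<phi> T (Suc j) t - avg H ?g\<bar>)
      \<le> mean (\<lambda>\<phi> T. \<bar>msg_fraction \<phi> T (Suc j) t - mean (\<lambda>\<phi> T. msg_fraction \<phi> T (Suc j) t)\<bar>)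
        + \<bar>mean (\<lambda>\<phi> T. msg_fraction \<phi> T (Suc j) t) - avg H ?g\<bar>"
  proof (rule mean_abs_diff_triangle)
    fix \<phi> assume \<phi>: "\<phi> \<in> matchings"
    show "(\<lambda>T. msg_fraction \<phi> T (Suc j) t) \<in> borel_measurable clocks"
      by (rule measurable_msg_fraction[OF \<phi>, where f = "\<lambda>_. t"]) (auto intro: measurable_clock)
  qed (rule msg_fraction_bounds)
  also have "\<dots> \<le> deviation (Suc j) + low_error j b"
    using 1 mean_msg_fraction_deviation[of "Suc j" t] by linarith
  finally show ?thesis .
qed

text \<open>The constant adds the influence \<open>4 + 4 * reach j\<close> of a switch and
  \<open>1 + reach (Suc j)\<close> of a clock.\<close>

lemma active_fraction_mean:
  assumes b: "b \<in> borel_measurable borel" "\<And>s. b s \<in> {0..1}"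
  shows "mean (\<lambda>\<phi> T. \<bar>active_fraction \<phi> T j
      - avg {..<n} (\<lambda>v. if K < d v then of_bool (odd j) else \<integral>s. (1 - b s) ^ d v \<partial>D (d v))\<bar>)
    \<le> real (5 + 4 * reach j + reach (Suc j)) / real n * sqrt (real (card H + n)) + low_error j b"
proof -
  let ?g = "\<lambda>v. if K < d v then of_bool (odd j) else \<integral>s. (1 - b s) ^ d v \<partial>D (d v)"
  have i: "integrable clocks (\<lambda>T. of_bool (active_bound \<phi> T j v) :: real)"
    if "v \<in> {..<n}" "\<phi> \<in> matchings" for v \<phi>
  proof (rule clocks.integrable_of_bounded[where B = 1])
    have [measurable]: "Measurable.pred clocks (\<lambda>T. active_bound \<phi> T j v)"
      using that by (intro measurable_active_bound) auto
    show "(\<lambda>T. of_bool (active_bound \<phi> T j v) :: real) \<in> borel_measurable clocks"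
      by measurable
  qed simp
  have m: "mean (\<lambda>\<phi> T. active_fraction \<phi> T j)
      = avg {..<n} (\<lambda>v. mean (\<lambda>\<phi> T. of_bool (active_bound \<phi> T j v)))"
    unfolding active_fraction_def by (rule mean_avg[OF i])
  have "\<bar>mean (\<lambda>\<phi> T. active_fraction \<phi> T j) - avg {..<n} ?g\<bar>
      \<le> avg {..<n} (\<lambda>v. \<bar>mean (\<lambda>\<phi> T. of_bool (active_bound \<phi> T j v)) - ?g v\<bar>)"
    unfolding m by (rule abs_avg_diff_le)
  also have "\<dots> \<le> low_error j b"
  proof (rule avg_le_const[OF _ low_error_nonneg])
    fix v assume v: "v \<in> {..<n}"
    show "\<bar>mean (\<lambda>\<phi> T. of_bool (active_bound \<phi> T j v)) - ?g v\<bar> \<le> low_error j b"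
    proof (cases "K < d v")
      case True
      then show ?thesis
        using low_error_nonneg by (simp add: mean_const active_bound_def)
    next
      case False
      have "of_bool (active_bound \<phi> T j v)
          = indicator UNIV (T v) * (\<Prod>s\<in>{v} \<times> {..<d v}. silent \<phi> T j (T v) (\<phi> s))" for \<phi> T
      proof -
        have fin: "finite ({v} \<times> {..<d v})"
          by simp
        have "(\<Prod>s\<in>{v} \<times> {..<d v}. silent \<phi> T j (T v) (\<phi> s))
            = of_bool (\<forall>s\<in>{v} \<times> {..<d v}. \<not> msg \<phi> T j (\<phi> s) (T v))"
          unfolding silent_def using fin
          by (induction rule: finite_induct) auto
        then show ?thesis
          using False by (simp add: active_bound_def)
      qed
      then have "mean (\<lambda>\<phi> T. of_bool (active_bound \<phi> T j v))
          = mean (\<lambda>\<phi> T. indicator UNIV (T v) * (\<Prod>s\<in>{v} \<times> {..<d v}. silent \<phi> T j (T v) (\<phi> s)))"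
        by simp
      then show ?thesis
        using mean_cavity[OF _ _ _ _ b, of v "{v} \<times> {..<d v}" UNIV j] False v
        by (simp add: card_cartesian_product)
    qed
  qed
  finally have 1: "\<bar>mean (\<lambda>\<phi> T. active_fraction \<phi> T j) - avg {..<n} ?g\<bar> \<le> low_error j b" .
  have "mean (\<lambda>\<phi> T. \<bar>active_fraction \<phi> T j - avg {..<n} ?g\<bar>)
      \<le> mean (\<lambda>\<phi> T. \<bar>active_fraction \<phi> T j - mean (\<lambda>\<phi> T. active_fraction \<phi> T j)\<bar>)
        + \<bar>mean (\<lambda>\<phi> T. active_fraction \<phi> T j) - avg {..<n} ?g\<bar>"
    by (intro mean_abs_diff_triangle measurable_active_fraction active_fraction_bounds)
  also have "mean (\<lambda>\<phi> T. \<bar>active_fraction \<phi> T j - mean (\<lambda>\<phi> T. active_fraction \<phi> T j)\<bar>)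
      \<le> real (5 + 4 * reach j + reach (Suc j)) / real n * sqrt (real (card H + n))"
  proof (rule mean_abs_deviation_le)
    fix \<phi> assume \<phi>: "\<phi> \<in> matchings"
    show "\<bar>active_fraction (switch a b \<phi>) T j - active_fraction \<phi> T j\<bar>
        \<le> real (5 + 4 * reach j + reach (Suc j)) / real n" for a b T
      using active_fraction_switch[OF \<phi>, of a b T j]
      by (rule order_trans) (intro divide_right_mono of_nat_mono; simp)
    show "\<bar>active_fraction \<phi> (T(v := x)) j - active_fraction \<phi> T j\<bar>
        \<le> real (5 + 4 * reach j + reach (Suc j)) / real n" for v x T
      using active_fraction_clock[OF \<phi>, of T v x j]
      by (rule order_trans) (intro divide_right_mono of_nat_mono; simp)
  qed (use active_fraction_bounds measurable_active_fraction in auto)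
  finally show ?thesis
    using 1 by linarith
qed

end

section \<open>The greedy exploration\<close>

text \<open>The exploration without its times, along any list of vertices, so that it can be
  analysed by appending one ring.\<close>

definition explored :: "nat set multiset \<Rightarrow> nat list \<Rightarrow> nat \<Rightarrow> vertex_state" where
  "explored E xs = fold (ring_clock E) xs (\<lambda>_. Unexplored)"

lemma explored_Nil: "explored E [] = (\<lambda>_. Unexplored)"
  by (simp add: explored_def)

lemma explored_snoc: "explored E (xs @ [x]) = ring_clock E x (explored E xs)"
  by (simp add: explored_def)

lemma explored_append: "explored E xs v \<noteq> Unexplored \<Longrightarrow> explored E (xs @ ys) v = explored E xs v"
proof (induction ys rule: rev_induct)
  case (snoc y ys)
  then show ?case
    unfolding append_assoc[symmetric] explored_snoc by (auto simp: ring_clock_def)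
qed simp

lemma explored_Active: "explored E xs v = Active \<Longrightarrow> v \<in> set xs"
proof (induction xs rule: rev_induct)
  case (snoc x xs)
  then show ?case
    unfolding explored_snoc by (auto simp: ring_clock_def split: if_splits)
qed (simp add: explored_Nil)

lemma explored_rung: "v \<in> set xs \<Longrightarrow> explored E xs v \<noteq> Unexplored"
proof (induction xs rule: rev_induct)
  case (snoc x xs)
  then show ?case
    unfolding explored_snoc by (auto simp: ring_clock_def)
qed simp

lemma explored_Blocked: "explored E xs v = Blocked \<Longrightarrow> \<exists>u. explored E xs u = Active \<and> {u, v} \<in># E"
proof (induction xs arbitrary: v rule: rev_induct)
  case (snoc x xs)
  show ?case
  proof (cases "explored E xs v = Blocked")
    case True
    then obtain u where "explored E xs u = Active" "{u, v} \<in># E"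
      using snoc.IH by blast
    then show ?thesis
      using explored_append[of E xs u "[x]"] by auto
  next
    case False
    then show ?thesis
      using snoc.prems unfolding explored_snoc
      by (intro exI[of _ x]) (auto simp: ring_clock_def split: if_splits)
  qed
qed (simp add: explored_Nil)

lemma explored_neighbour:
  "explored E xs u = Active \<Longrightarrow> {u, v} \<in># E \<Longrightarrow> v \<noteq> u \<Longrightarrow> explored E xs v \<noteq> Unexplored"
proof (induction xs rule: rev_induct)
  case (snoc x xs)
  then show ?case
    unfolding explored_snoc by (auto simp: ring_clock_def split: if_splits)
qed (simp add: explored_Nil)

text \<open>A vertex becomes active if it is still unexplored when its clock rings, and earlier
  rings can only have blocked it through an active neighbour. Later rings change neither
  \<open>v\<close> nor its predecessors, so the complete list may stand on both sides.\<close>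

lemma explored_Active_iff:
  assumes "distinct (ys @ v # zs)"
  shows "explored E (ys @ v # zs) v = Active
    \<longleftrightarrow> (\<forall>u\<in>set ys. {u, v} \<in># E \<longrightarrow> explored E (ys @ v # zs) u \<noteq> Active)"
proof -
  have same: "explored E (ys @ v # zs) u = explored E ys u" if "u \<in> set ys" for u
    using explored_append[OF explored_rung[OF that]] .
  have "explored E (ys @ v # zs) v = explored E (ys @ [v]) v"
    using explored_append[OF explored_rung[of v "ys @ [v]" E], of zs] by simp
  also have "explored E (ys @ [v]) v = Active \<longleftrightarrow> explored E ys v = Unexplored"
    using explored_Active[of E ys v] assms unfolding explored_snoc by (auto simp: ring_clock_def)
  also have "\<dots> \<longleftrightarrow> (\<forall>u\<in>set ys. {u, v} \<in># E \<longrightarrow> explored E ys u \<noteq> Active)"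
  proof
    assume "explored E ys v = Unexplored"
    then show "\<forall>u\<in>set ys. {u, v} \<in># E \<longrightarrow> explored E ys u \<noteq> Active"
      using explored_neighbour[of E ys _ v] assms by auto
  next
    assume *: "\<forall>u\<in>set ys. {u, v} \<in># E \<longrightarrow> explored E ys u \<noteq> Active"
    have "explored E ys v \<noteq> Active"
      using explored_Active[of E ys v] assms by auto
    moreover have "explored E ys v \<noteq> Blocked"
      using explored_Blocked[of E ys v] explored_Active[of E ys] * by blast
    ultimately show "explored E ys v = Unexplored"
      by (cases "explored E ys v") auto
  qed
  finally show ?thesis
    by (simp add: same)
qed

lemma final_active_set_eq:
  "final_active_set n E T = {v \<in> {..<n}. explored E (sort_key T [0..<n]) v = Active}"
proof -
  have "\<forall>\<^sub>F t in at_top. exploration_state n E T t = explored E (sort_key T [0..<n])"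
    unfolding eventually_at_top_linorder
  proof (intro exI allI impI)
    \<comment> \<open>From the latest ring on, the list of rung clocks is complete. For
      \<open>n = 0\<close> the maximum is an unspecified number and both lists are empty.\<close>
    fix t assume t: "(MAX v\<in>{..<n}. T v) \<le> t"
    have "T v \<le> t" if "v < n" for v
    proof -
      have "T v \<le> (MAX v\<in>{..<n}. T v)"
        using that by (intro Max_ge) auto
      with t show ?thesis
        by linarith
    qed
    then have "filter (\<lambda>v. T v \<le> t) (sort_key T [0..<n]) = sort_key T [0..<n]"
      by (intro filter_True) auto
    then show "exploration_state n E T t = explored E (sort_key T [0..<n])"
      by (simp add: exploration_state_def explored_def)
  qed
  then have "(\<forall>\<^sub>F t in at_top. exploration_state n E T t v = Active)
      \<longleftrightarrow> (\<forall>\<^sub>F t::real in at_top. explored E (sort_key T [0..<n]) v = Active)" for v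
    by (intro eventually_subst) (auto elim: eventually_mono)
  then show ?thesis
    by (simp add: final_active_set_def)
qed

text \<open>Without ties the predecessors of \<open>v\<close> in the sorted list are exactly the
  vertices with a smaller clock.\<close>

lemma mem_final_active_set_iff:
  assumes inj: "inj_on T {..<n}" and v: "v < n"
  shows "v \<in> final_active_set n E T
    \<longleftrightarrow> (\<forall>u<n. T u < T v \<and> {u, v} \<in># E \<longrightarrow> u \<notin> final_active_set n E T)"
proof -
  let ?xs = "sort_key T [0..<n]"
  obtain ys zs where xs: "?xs = ys @ v # zs"
    using split_list[of v ?xs] v by auto
  have dist: "distinct (ys @ v # zs)"
    using distinct_sort[of T "[0..<n]"] xs by simp
  have sorted: "sorted (map T (ys @ v # zs))"
    using sorted_sort_key[of T "[0..<n]"] xs by simp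
  have "set (ys @ v # zs) = {..<n}"
    unfolding xs[symmetric] by auto
  then have mem: "set ys \<union> {v} \<union> set zs = {..<n}"
    by simp
  have ys: "set ys = {u. u < n \<and> T u < T v}"
  proof (intro set_eqI iffI)
    fix u assume u: "u \<in> set ys"
    then have "u < n" "u \<noteq> v" "T u \<le> T v"
      using mem dist sorted by (auto simp: sorted_append)
    moreover have "T u \<noteq> T v"
      using inj_onD[OF inj, of u v] \<open>u < n\<close> \<open>u \<noteq> v\<close> v by auto
    ultimately show "u \<in> {u. u < n \<and> T u < T v}"
      by simp
  next
    fix u assume u: "u \<in> {u. u < n \<and> T u < T v}"
    then have "u \<in> set ys \<union> {v} \<union> set zs"
      using mem by auto
    moreover have "u \<notin> set zs"
      using sorted u by (auto simp: sorted_append)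
    ultimately show "u \<in> set ys"
      using u by auto
  qed
  show ?thesis
  proof -
    have "v \<in> final_active_set n E T \<longleftrightarrow> explored E (ys @ v # zs) v = Active"
      using v by (simp add: final_active_set_eq xs)
    also have "\<dots> \<longleftrightarrow> (\<forall>u\<in>set ys. {u, v} \<in># E \<longrightarrow> explored E (ys @ v # zs) u \<noteq> Active)"
      by (rule explored_Active_iff[OF dist])
    also have "\<dots> \<longleftrightarrow> (\<forall>u<n. T u < T v \<and> {u, v} \<in># E \<longrightarrow> u \<notin> final_active_set n E T)"
      unfolding ys final_active_set_eq xs by blast
    finally show ?thesis .
  qed
qed

section \<open>Perfect matchings and involutions\<close>

lemma inj_on_involution_edges:
  "inj_on (\<lambda>\<phi>. (\<lambda>h. {h, \<phi> h}) ` U) (involutions U)"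
proof (rule inj_onI)
  fix \<phi> \<psi> assume *: "\<phi> \<in> involutions U" "\<psi> \<in> involutions U"
    "(\<lambda>h. {h, \<phi> h}) ` U = (\<lambda>h. {h, \<psi> h}) ` U"
  show "\<phi> = \<psi>"
  proof
    fix x show "\<phi> x = \<psi> x"
    proof (cases "x \<in> U")
      case True
      then have "{x, \<phi> x} \<in> (\<lambda>h. {h, \<psi> h}) ` U"
        using *(3) by blast
      then obtain h where "{x, \<phi> x} = {h, \<psi> h}"
        by blast
      then show ?thesis
        using involutionsD(2)[OF *(2), of h] by (auto simp: doubleton_eq_iff)
    next
      case False
      then show ?thesis
        using * by (simp add: involutionsD(5))
    qed
  qed
qed

lemma involution_edges_perfect_matching:
  assumes "\<phi> \<in> involutions U"
  shows "(\<lambda>h. {h, \<phi> h}) ` U \<in> perfect_matchings U"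
proof -
  note D = involutionsD[OF assms]
  have "partition_on U ((\<lambda>h. {h, \<phi> h}) ` U)"
  proof (rule partition_onI)
    show "\<Union> ((\<lambda>h. {h, \<phi> h}) ` U) = U"
      using D(4) by auto
    fix p q assume "p \<in> (\<lambda>h. {h, \<phi> h}) ` U" "q \<in> (\<lambda>h. {h, \<phi> h}) ` U" "p \<noteq> q"
    then obtain g h where pq: "p = {g, \<phi> g}" "q = {h, \<phi> h}" "p \<noteq> q"
      by blast
    show "disjnt p q"
    proof (rule ccontr)
      assume "\<not> disjnt p q"
      then obtain x where "x \<in> p" "x \<in> q"
        by (auto simp: disjnt_iff)
      moreover have "{y, \<phi> y} = {x, \<phi> x}" if "x \<in> {y, \<phi> y}" for y
        using that D(2)[of y] by auto
      ultimately have "p = {x, \<phi> x}" "q = {x, \<phi> x}"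
        using pq(1,2) by metis+
      with pq(3) show False
        by simp
    qed
  qed auto
  moreover have "card e = 2" if e: "e \<in> (\<lambda>h. {h, \<phi> h}) ` U" for e
  proof -
    obtain h where h: "h \<in> U" "e = {h, \<phi> h}"
      using e by blast
    have "h \<noteq> \<phi> h"
      using D(3)[OF h(1)] by metis
    then show ?thesis
      by (simp add: h)
  qed
  ultimately show ?thesis
    by (simp add: perfect_matchings_def)
qed

lemma perfect_matching_from_involution:
  assumes "M \<in> perfect_matchings U"
  shows "\<exists>\<phi>\<in>involutions U. M = (\<lambda>h. {h, \<phi> h}) ` U"
proof -
  have part: "partition_on U M" and c2: "\<And>e. e \<in> M \<Longrightarrow> card e = 2"
    using assms by (auto simp: perfect_matchings_def)
  have U: "U = \<Union> M"
    using partition_onD1[OF part] .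
  have uniq: "e = e'" if "e \<in> M" "e' \<in> M" "x \<in> e" "x \<in> e'" for e e' x
    using partition_onD2[OF part] that by (auto dest: disjointD)
  have "\<forall>x\<in>U. \<exists>y. {x, y} \<in> M \<and> y \<noteq> x"
  proof
    fix x assume "x \<in> U"
    then obtain e where e: "e \<in> M" "x \<in> e"
      using U by auto
    obtain a b where "e = {a, b}" "a \<noteq> b"
      using c2[OF e(1)] by (meson card_2_iff)
    then show "\<exists>y. {x, y} \<in> M \<and> y \<noteq> x"
      using e by (cases "x = a") (auto simp: insert_commute)
  qed
  then obtain f where f: "\<And>x. x \<in> U \<Longrightarrow> {x, f x} \<in> M" "\<And>x. x \<in> U \<Longrightarrow> f x \<noteq> x"
    by metis
  define \<phi> where "\<phi> x = (if x \<in> U then f x else x)" for x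
  have fU: "f x \<in> U" if "x \<in> U" for x
    using f(1)[OF that] U by auto
  have ff: "f (f x) = x" if x: "x \<in> U" for x
  proof -
    have "{x, f x} = {f x, f (f x)}"
      by (rule uniq[OF f(1)[OF x] f(1)[OF fU[OF x]], of "f x"]) auto
    then show ?thesis
      using f(2)[OF x] by (auto simp: doubleton_eq_iff)
  qed
  have inv: "\<phi> (\<phi> x) = x" for x
    by (simp add: \<phi>_def fU ff)
  have "\<phi> permutes U"
    unfolding permutes_def
  proof (intro conjI allI impI)
    fix y show "\<exists>!x. \<phi> x = y"
      by (rule ex1I[of _ "\<phi> y"]) (use inv in auto)
  qed (simp add: \<phi>_def)
  then have \<phi>: "\<phi> \<in> involutions U"
    using inv f(2) by (simp add: involutions_def \<phi>_def)
  have "M = (\<lambda>h. {h, \<phi> h}) ` U"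
  proof (intro set_eqI iffI)
    fix e assume e: "e \<in> M"
    obtain a b where ab: "e = {a, b}"
      using c2[OF e] by (meson card_2_iff)
    then have "a \<in> U"
      using e U by auto
    moreover have "e = {a, f a}"
      by (rule uniq[OF e f(1)[OF \<open>a \<in> U\<close>], of a]) (auto simp: ab)
    ultimately show "e \<in> (\<lambda>h. {h, \<phi> h}) ` U"
      by (auto simp: \<phi>_def)
  qed (auto simp: \<phi>_def f(1))
  with \<phi> show ?thesis
    by blast
qed

lemma perfect_matchings_eq_image:
  "perfect_matchings U = (\<lambda>\<phi>. (\<lambda>h. {h, \<phi> h}) ` U) ` involutions U"
proof (intro set_eqI iffI)
  fix M assume "M \<in> perfect_matchings U"
  then show "M \<in> (\<lambda>\<phi>. (\<lambda>h. {h, \<phi> h}) ` U) ` involutions U"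
    using perfect_matching_from_involution[of M U] by (simp add: image_iff)
next
  fix M assume "M \<in> (\<lambda>\<phi>. (\<lambda>h. {h, \<phi> h}) ` U) ` involutions U"
  then obtain \<phi> where "\<phi> \<in> involutions U" "M = (\<lambda>h. {h, \<phi> h}) ` U"
    by (elim imageE)
  then show "M \<in> perfect_matchings U"
    using involution_edges_perfect_matching[of \<phi> U] by simp
qed

definition involution_graph :: "nat \<Rightarrow> (nat \<Rightarrow> nat) \<Rightarrow> (nat \<times> nat \<Rightarrow> nat \<times> nat) \<Rightarrow> nat set multiset" where
  "involution_graph n d \<phi> = matching_multigraph ((\<lambda>h. {h, \<phi> h}) ` half_edges n d)"

text \<open>The map from involutions to sets of pairs is a bijection onto the perfect matchings and
  so carries one uniform law to the other.\<close>

lemma configuration_model_eq: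
  assumes "involutions (half_edges n d) \<noteq> {}"
  shows "configuration_model n d = map_pmf (involution_graph n d) (pmf_of_set (involutions (half_edges n d)))"
proof -
  let ?H = "half_edges n d"
  have "pmf_of_set (perfect_matchings ?H) = map_pmf (\<lambda>\<phi>. (\<lambda>h. {h, \<phi> h}) ` ?H) (pmf_of_set (involutions ?H))"
    unfolding perfect_matchings_eq_image
    by (intro map_pmf_of_set_inj[symmetric] inj_on_involution_edges assms finite_involutions finite_half_edges)
  then show ?thesis
    unfolding configuration_model_def involution_graph_def[abs_def] by (simp add: pmf.map_comp comp_def)
qed

lemma mem_involution_graph_iff:
  "e \<in># involution_graph n d \<phi> \<longleftrightarrow> (\<exists>h\<in>half_edges n d. e = {fst h, fst (\<phi> h)})"
proof -
  have "e \<in># involution_graph n d \<phi> \<longleftrightarrow> e \<in> (\<lambda>h. fst ` {h, \<phi> h}) ` half_edges n d"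
    by (simp add: involution_graph_def matching_multigraph_def finite_half_edges image_image del: image_insert)
  also have "\<dots> \<longleftrightarrow> (\<exists>h\<in>half_edges n d. e = {fst h, fst (\<phi> h)})"
    by (simp add: image_iff)
  finally show ?thesis .
qed

section \<open>Parity sandwich for the active set\<close>

context degree_cutoff
begin

text \<open>The greedy rule read along half-edges. Multiple edges repeat a condition, and a
  self-loop at \<open>v\<close> gives the false comparison \<open>T v < T v\<close>, so both fit
  into the same formula.\<close>

lemma mem_final_iff_half_edges:
  assumes \<phi>: "\<phi> \<in> matchings" and inj: "inj_on T {..<n}" and v: "v < n"
  defines "F \<equiv> final_active_set n (involution_graph n d \<phi>) T"
  shows "v \<in> F \<longleftrightarrow> (\<forall>s\<in>{v} \<times> {..<d v}. \<not> (T (fst (\<phi> s)) < T v \<and> fst (\<phi> s) \<in> F))"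
proof -
  have "(\<exists>u<n. T u < T v \<and> {u, v} \<in># involution_graph n d \<phi> \<and> u \<in> F)
      \<longleftrightarrow> (\<exists>s\<in>{v} \<times> {..<d v}. T (fst (\<phi> s)) < T v \<and> fst (\<phi> s) \<in> F)"
  proof
    assume "\<exists>u<n. T u < T v \<and> {u, v} \<in># involution_graph n d \<phi> \<and> u \<in> F"
    then obtain u h where u: "T u < T v" "u \<in> F" and h: "h \<in> H" and e: "{u, v} = {fst h, fst (\<phi> h)}"
      by (auto simp: mem_involution_graph_iff)
    have "\<exists>s\<in>H. fst s = v \<and> fst (\<phi> s) = u"
    proof (cases "fst h = v")
      case True
      then show ?thesis
        using e h u by (auto simp: doubleton_eq_iff)
    next
      case False
      then have "fst (\<phi> h) = v" "fst (\<phi> (\<phi> h)) = u"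
        using e involutionsD(2)[OF \<phi>] by (auto simp: doubleton_eq_iff)
      then show ?thesis
        using involutionsD(4)[OF \<phi> h] by blast
    qed
    then show "\<exists>s\<in>{v} \<times> {..<d v}. T (fst (\<phi> s)) < T v \<and> fst (\<phi> s) \<in> F"
      using u by (auto simp: half_edges_def)
  next
    assume "\<exists>s\<in>{v} \<times> {..<d v}. T (fst (\<phi> s)) < T v \<and> fst (\<phi> s) \<in> F"
    then obtain s where s: "s \<in> {v} \<times> {..<d v}" "T (fst (\<phi> s)) < T v" "fst (\<phi> s) \<in> F"
      by blast
    have sH: "s \<in> H"
      using s(1) v by (auto simp: half_edges_def)
    have "{fst (\<phi> s), v} \<in># involution_graph n d \<phi>"
      unfolding mem_involution_graph_iff
      using s(1) sH by (intro bexI[of _ s]) auto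
    moreover have "fst (\<phi> s) < n"
      using involutionsD(4)[OF \<phi> sH] by (auto simp: half_edges_def)
    ultimately show "\<exists>u<n. T u < T v \<and> {u, v} \<in># involution_graph n d \<phi> \<and> u \<in> F"
      using s by blast
  qed
  then show ?thesis
    unfolding F_def mem_final_active_set_iff[OF inj v] by blast
qed

text \<open>The negation in the recursion exchanges upper and lower bounds, so the two parities are
  proved together. The deadline is the clock of the vertex that asks, at the other end of the edge
  of \<open>z\<close>.\<close>

lemma msg_sandwich:
  assumes \<phi>: "\<phi> \<in> matchings" and inj: "inj_on T {..<n}" and z: "z \<in> H"
  defines "F \<equiv> final_active_set n (involution_graph n d \<phi>) T"
  shows "(even j \<longrightarrow> T (fst z) < T (fst (\<phi> z)) \<and> fst z \<in> F \<longrightarrow> msg \<phi> T j z (T (fst (\<phi> z))))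
    \<and> (odd j \<longrightarrow> msg \<phi> T j z (T (fst (\<phi> z))) \<longrightarrow> T (fst z) < T (fst (\<phi> z)) \<and> fst z \<in> F)"
  using z
proof (induction j arbitrary: z)
  case (Suc j)
  let ?u = "fst z"
  have u: "?u < n"
    using Suc.prems by (auto simp: half_edges_def)
  note F = mem_final_iff_half_edges[OF \<phi> inj u, folded F_def]
  have IH: "(even j \<longrightarrow> T (fst (\<phi> s)) < T ?u \<and> fst (\<phi> s) \<in> F \<longrightarrow> msg \<phi> T j (\<phi> s) (T ?u))
    \<and> (odd j \<longrightarrow> msg \<phi> T j (\<phi> s) (T ?u) \<longrightarrow> T (fst (\<phi> s)) < T ?u \<and> fst (\<phi> s) \<in> F)"
    if s: "s \<in> siblings z" for s
    using Suc.IH[OF involutionsD(4)[OF \<phi> sibling_in_half_edges[OF s Suc.prems]]]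
    by (simp add: involutionsD(2)[OF \<phi>] fst_siblings[OF s])
  show ?case
  proof (intro conjI impI)
    assume "even (Suc j)" and *: "T ?u < T (fst (\<phi> z)) \<and> ?u \<in> F"
    then have "odd j"
      by simp
    have "\<not> msg \<phi> T j (\<phi> s) (T ?u)" if s: "s \<in> siblings z" for s
    proof
      assume "msg \<phi> T j (\<phi> s) (T ?u)"
      then have "T (fst (\<phi> s)) < T ?u \<and> fst (\<phi> s) \<in> F"
        using IH[OF s] \<open>odd j\<close> by blast
      moreover have "s \<in> {?u} \<times> {..<d ?u}"
        using s by (auto simp: siblings_def)
      ultimately show False
        using * F by blast
    qed
    then show "msg \<phi> T (Suc j) z (T (fst (\<phi> z)))"
      using * \<open>odd j\<close> by simp
  next
    assume "odd (Suc j)" and m: "msg \<phi> T (Suc j) z (T (fst (\<phi> z)))"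
    then have "even j" and lt: "T ?u < T (fst (\<phi> z))"
      and ns: "\<And>s. s \<in> siblings z \<Longrightarrow> \<not> msg \<phi> T j (\<phi> s) (T ?u)"
      by (auto split: if_splits)
    \<comment> \<open>For \<open>s = z\<close> the neighbour is the asking vertex itself, whose
      clock is later and so cannot block; this is why \<open>siblings\<close> may leave out
      \<open>z\<close>.\<close>
    have "\<not> (T (fst (\<phi> s)) < T ?u \<and> fst (\<phi> s) \<in> F)" if s: "s \<in> {?u} \<times> {..<d ?u}" for s
    proof (cases "s = z")
      case True
      then show ?thesis
        using lt by simp
    next
      case False
      then have "s \<in> siblings z"
        using s by (cases s; cases z) (auto simp: siblings_def)
      then show ?thesis
        using IH ns \<open>even j\<close> by blast
    qed
    then have "?u \<in> F"
      using F by blast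
    with lt show "T ?u < T (fst (\<phi> z))" "?u \<in> F"
      by auto
  qed
qed simp

end

context clocked_degrees
begin

lemma active_bound_sandwich:
  assumes \<phi>: "\<phi> \<in> matchings" and inj: "inj_on T {..<n}" and v: "v < n"
  defines "F \<equiv> final_active_set n (involution_graph n d \<phi>) T"
  shows "odd j \<Longrightarrow> v \<in> F \<Longrightarrow> active_bound \<phi> T j v"
    and "even j \<Longrightarrow> active_bound \<phi> T j v \<Longrightarrow> v \<in> F"
proof -
  note F = mem_final_iff_half_edges[OF \<phi> inj v, folded F_def]
  have m: "(even j \<longrightarrow> T (fst (\<phi> s)) < T v \<and> fst (\<phi> s) \<in> F \<longrightarrow> msg \<phi> T j (\<phi> s) (T v))
    \<and> (odd j \<longrightarrow> msg \<phi> T j (\<phi> s) (T v) \<longrightarrow> T (fst (\<phi> s)) < T v \<and> fst (\<phi> s) \<in> F)"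
    if s: "s \<in> {v} \<times> {..<d v}" for s
  proof -
    have sH: "s \<in> H" and fs: "fst s = v"
      using s v by (auto simp: half_edges_def)
    show ?thesis
      using msg_sandwich[OF \<phi> inj involutionsD(4)[OF \<phi> sH], of j, folded F_def]
      by (simp add: involutionsD(2)[OF \<phi>] fs)
  qed
  show "active_bound \<phi> T j v" if "odd j" "v \<in> F"
  proof -
    have "\<forall>s\<in>{v} \<times> {..<d v}. \<not> msg \<phi> T j (\<phi> s) (T v)"
      using m that F by blast
    then show ?thesis
      using that by (simp add: active_bound_def)
  qed
  show "v \<in> F" if "even j" "active_bound \<phi> T j v"
  proof -
    have "\<forall>s\<in>{v} \<times> {..<d v}. \<not> msg \<phi> T j (\<phi> s) (T v)"
      using that unfolding active_bound_def by (meson)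
    then show ?thesis
      using m that(1) F by blast
  qed
qed

lemma sda_proportion_sandwich:
  assumes \<phi>: "\<phi> \<in> matchings" and inj: "inj_on T {..<n}"
  shows "odd j \<Longrightarrow> sda_proportion n (involution_graph n d \<phi>, T) \<le> active_fraction \<phi> T j"
    and "even j \<Longrightarrow> active_fraction \<phi> T j \<le> sda_proportion n (involution_graph n d \<phi>, T)"
proof -
  let ?F = "final_active_set n (involution_graph n d \<phi>) T"
  have a: "active_fraction \<phi> T j = real (card {v \<in> {..<n}. active_bound \<phi> T j v}) / real n"
    by (simp add: active_fraction_def avg_def Int_def)
  have s: "?F \<subseteq> {..<n}"
    by (auto simp: final_active_set_def)
  show "sda_proportion n (involution_graph n d \<phi>, T) \<le> active_fraction \<phi> T j" if "odd j"
    unfolding sda_proportion_def a prod.case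
    using s active_bound_sandwich(1)[OF \<phi> inj _ that]
    by (intro divide_right_mono of_nat_mono card_mono) auto
  show "active_fraction \<phi> T j \<le> sda_proportion n (involution_graph n d \<phi>, T)" if "even j"
    unfolding sda_proportion_def a prod.case
    using s active_bound_sandwich(2)[OF \<phi> inj _ that]
    by (intro divide_right_mono of_nat_mono card_mono) (auto intro: finite_subset)
qed

end

section \<open>Measurability of the exploration\<close>

context clock_model
begin

lemma measurable_clock_any: "(\<lambda>T. T v) \<in> borel_measurable clocks"
proof (cases "v < n")
  case False
  then have "(\<lambda>T. T v) \<in> borel_measurable clocks \<longleftrightarrow> (\<lambda>T. undefined :: real) \<in> borel_measurable clocks"
    by (intro measurable_cong) (auto simp: space_PiM PiE_def extensional_def)
  then show ?thesis
    by simp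
qed (rule measurable_clock)

lemma measurable_insort_key: "(\<lambda>T. insort_key T y zs) \<in> clocks \<rightarrow>\<^sub>M count_space UNIV"
proof (induction zs)
  case (Cons z zs)
  have [measurable]: "(\<lambda>T. T v) \<in> borel_measurable clocks" for v
    by (rule measurable_clock_any)
  have [measurable]: "(\<lambda>T. z # insort_key T y zs) \<in> clocks \<rightarrow>\<^sub>M count_space UNIV"
    by (rule measurable_compose[OF Cons.IH]) simp
  show ?case
    by simp
qed simp

lemma measurable_sort_key: "(\<lambda>T. sort_key T ys) \<in> clocks \<rightarrow>\<^sub>M count_space UNIV"
proof (induction ys)
  case (Cons y ys)
  have "(\<lambda>T. (\<lambda>zs T. insort_key T y zs) (sort_key T ys) T) \<in> clocks \<rightarrow>\<^sub>M count_space UNIV"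
    by (rule measurable_compose_countable[OF measurable_insort_key Cons.IH])
  then show ?case
    by simp
qed simp

text \<open>The sorted list takes values in a countable set, and once it is fixed the proportion is
  a function of the graph, on a discrete space.\<close>

lemma measurable_sda_proportion:
  "sda_proportion n \<in> borel_measurable (measure_pmf p \<Otimes>\<^sub>M clocks)"
proof -
  have f: "(\<lambda>\<omega>. real (card {v \<in> {..<n}. explored (fst \<omega>) xs v = Active}) / real n)
      \<in> borel_measurable (measure_pmf p \<Otimes>\<^sub>M clocks)" for xs
    by (rule measurable_compose[OF measurable_fst]) simp
  have g: "(\<lambda>\<omega>. sort_key (snd \<omega>) [0..<n]) \<in> measure_pmf p \<Otimes>\<^sub>M clocks \<rightarrow>\<^sub>M count_space UNIV"
    by (rule measurable_compose[OF measurable_snd measurable_sort_key])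
  note measurable_compose_countable[OF f g]
  moreover have "sda_proportion n
      = (\<lambda>\<omega>. real (card {v \<in> {..<n}. explored (fst \<omega>) (sort_key (snd \<omega>) [0..<n]) v = Active}) / real n)"
    by (simp add: fun_eq_iff sda_proportion_def final_active_set_eq)
  ultimately show ?thesis
    by simp
qed

end

section \<open>From mean deviations to probabilities\<close>

context clocked_degrees
begin

text \<open>Redraw the clock of \<open>i\<close>: it then hits the value \<open>T j\<close> with
  probability zero.\<close>

lemma AE_inj_clocks:
  assumes no_atoms: "\<And>k x. measure (D k) {x} = 0"
  shows "AE T in clocks. inj_on T {..<n}"
proof -
  have [measurable]: "(\<lambda>T. T v) \<in> borel_measurable clocks" for v
    by (rule measurable_clock_any)
  have "AE T in clocks. T i \<noteq> T j" if ij: "i < n" "j < n" "i \<noteq> j" for i j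
  proof -
    let ?S = "{T \<in> space clocks. T i = T j}"
    have S[measurable]: "?S \<in> sets clocks"
      by measurable
    have "measure clocks ?S = (\<integral>T. indicator ?S T \<partial>clocks)"
      by simp
    also have "\<dots> = (\<integral>T. (\<integral>x. indicator ?S (T(i := x)) \<partial>D (d i)) \<partial>clocks)"
      using ij by (intro integral_PiM_resample[of "\<lambda>v. D (d v)" _ _ _ 1] prob_D) auto
    also have "\<dots> = (\<integral>T. (\<integral>x. indicator {T j} x \<partial>D (d i)) \<partial>clocks)"
    proof (rule Bochner_Integration.integral_cong[OF refl])
      fix T assume "T \<in> space clocks"
      then have "indicat_real ?S (T(i := x)) = indicator {T j} x" for x
        using clock_upd_space[of T i x] ij by (auto simp: indicator_def)
      then show "(\<integral>x. indicat_real ?S (T(i := x)) \<partial>D (d i)) = (\<integral>x. indicator {T j} x \<partial>D (d i))"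
        by simp
    qed
    also have "\<dots> = 0"
      by (simp add: no_atoms space_D)
    finally have "?S \<in> null_sets clocks"
      using S by (simp add: null_sets_def clocks.emeasure_eq_measure)
    then show ?thesis
      by (rule AE_I') auto
  qed
  then have "AE T in clocks. \<forall>i\<in>{..<n}. \<forall>j\<in>{..<n}. i \<noteq> j \<longrightarrow> T i \<noteq> T j"
    by (intro AE_finite_allI finite_lessThan) auto
  then show ?thesis
    by eventually_elim (auto simp: inj_on_def)
qed

lemma measure_pair_configuration_model:
  assumes S: "S \<in> sets (measure_pmf (configuration_model n d) \<Otimes>\<^sub>M clocks)"
  shows "measure (measure_pmf (configuration_model n d) \<Otimes>\<^sub>M clocks) S
    = avg matchings (\<lambda>\<phi>. measure clocks {T. (involution_graph n d \<phi>, T) \<in> S})"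
proof -
  let ?M = "measure_pmf (configuration_model n d)"
  have c: "real (card matchings) > 0"
    using finite_matchings matchings_nonempty by (simp add: card_gt_0_iff)
  have "emeasure (?M \<Otimes>\<^sub>M clocks) S = (\<integral>\<^sup>+E. emeasure clocks (Pair E -` S) \<partial>?M)"
    by (rule clocks.emeasure_pair_measure_alt[OF S])
  also have "\<dots> = (\<integral>\<^sup>+\<phi>. emeasure clocks (Pair (involution_graph n d \<phi>) -` S) \<partial>pmf_of_set matchings)"
    by (simp add: configuration_model_eq matchings_nonempty)
  also have "\<dots> = (\<Sum>\<phi>\<in>matchings. emeasure clocks (Pair (involution_graph n d \<phi>) -` S)) / of_nat (card matchings)"
    by (rule nn_integral_pmf_of_set[OF matchings_nonempty finite_matchings])
  also have "\<dots> = ennreal (avg matchings (\<lambda>\<phi>. measure clocks (Pair (involution_graph n d \<phi>) -` S)))"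
    using c by (simp add: clocks.emeasure_eq_measure avg_def divide_ennreal sum_nonneg
        ennreal_of_nat_eq_real_of_nat)
  finally show ?thesis
    by (simp add: measure_def avg_nonneg vimage_def)
qed

text \<open>Away from ties the proportion lies between the two active fractions, whose centres
  \<alpha> and \<alpha>' are within \<open>\<epsilon> / 2\<close> of \<open>a\<close>. A deviation
  beyond \<epsilon> forces one fraction to be off its centre by \<open>\<epsilon> / 2\<close>, which
  Markov's inequality bounds.\<close>

lemma measure_sda_le:
  assumes no_atoms: "\<And>k x. measure (D k) {x} = 0"
    and j: "odd j" "even j'" and "0 < \<epsilon>" and a: "\<bar>\<alpha> - a\<bar> \<le> \<epsilon> / 2" "\<bar>\<alpha>' - a\<bar> \<le> \<epsilon> / 2"
  shows "measure (measure_pmf (configuration_model n d) \<Otimes>\<^sub>M clocks)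
      {\<omega> \<in> space (measure_pmf (configuration_model n d) \<Otimes>\<^sub>M clocks). \<bar>sda_proportion n \<omega> - a\<bar> > \<epsilon>}
    \<le> (mean (\<lambda>\<phi> T. \<bar>active_fraction \<phi> T j - \<alpha>\<bar>) + mean (\<lambda>\<phi> T. \<bar>active_fraction \<phi> T j' - \<alpha>'\<bar>)) / (\<epsilon> / 2)"
proof -
  let ?P = "measure_pmf (configuration_model n d) \<Otimes>\<^sub>M clocks"
  let ?S = "{\<omega> \<in> space ?P. \<bar>sda_proportion n \<omega> - a\<bar> > \<epsilon>}"
  note [measurable] = measurable_sda_proportion
  have "?S \<in> sets ?P"
    by measurable
  then have "measure ?P ?S = avg matchings (\<lambda>\<phi>. measure clocks {T. (involution_graph n d \<phi>, T) \<in> ?S})"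
    by (rule measure_pair_configuration_model)
  also have "\<dots> \<le> avg matchings (\<lambda>\<phi>. ((\<integral>T. \<bar>active_fraction \<phi> T j - \<alpha>\<bar> \<partial>clocks)
      + (\<integral>T. \<bar>active_fraction \<phi> T j' - \<alpha>'\<bar> \<partial>clocks)) / (\<epsilon> / 2))"
  proof (rule avg_mono)
    fix \<phi> assume \<phi>: "\<phi> \<in> matchings"
    have [measurable]: "(\<lambda>T. active_fraction \<phi> T i) \<in> borel_measurable clocks" for i
      by (rule measurable_active_fraction[OF \<phi>])
    have int: "integrable clocks (\<lambda>T. \<bar>active_fraction \<phi> T i - x\<bar>)" for i x
    proof (rule clocks.integrable_of_bounded[where B = "1 + \<bar>x\<bar>"])
      fix T show "\<bar>\<bar>active_fraction \<phi> T i - x\<bar>\<bar> \<le> 1 + \<bar>x\<bar>"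
        using active_fraction_bounds[of \<phi> T i] by auto
    qed simp
    define B where "B i x = {T \<in> space clocks. \<bar>active_fraction \<phi> T i - x\<bar> \<ge> \<epsilon> / 2}" for i x
    have Bm[measurable]: "B i x \<in> sets clocks" for i x
      unfolding B_def by measurable
    have B: "measure clocks (B i x) \<le> (\<integral>T. \<bar>active_fraction \<phi> T i - x\<bar> \<partial>clocks) / (\<epsilon> / 2)" for i x
      unfolding B_def using integral_Markov_inequality_measure[OF int, where A = "space clocks" and c = "\<epsilon> / 2"] \<open>0 < \<epsilon>\<close> by simp
    have "measure clocks {T. (involution_graph n d \<phi>, T) \<in> ?S} \<le> measure clocks (B j \<alpha> \<union> B j' \<alpha>')"
    proof (rule clocks.finite_measure_mono_AE)
      show "AE T in clocks. T \<in> {T. (involution_graph n d \<phi>, T) \<in> ?S} \<longrightarrow> T \<in> B j \<alpha> \<union> B j' \<alpha>'"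
        using AE_inj_clocks[OF no_atoms] AE_space
      proof eventually_elim
        case (elim T)
        show ?case
          using sda_proportion_sandwich(1)[OF \<phi> elim(1) j(1)] sda_proportion_sandwich(2)[OF \<phi> elim(1) j(2)]
            elim(2) a by (auto simp: B_def abs_if split: if_splits)
      qed
    qed simp
    also have "\<dots> \<le> measure clocks (B j \<alpha>) + measure clocks (B j' \<alpha>')"
      by (rule measure_Un_le) simp_all
    also note add_mono[OF B B]
    finally show "measure clocks {T. (involution_graph n d \<phi>, T) \<in> ?S}
        \<le> ((\<integral>T. \<bar>active_fraction \<phi> T j - \<alpha>\<bar> \<partial>clocks) + (\<integral>T. \<bar>active_fraction \<phi> T j' - \<alpha>'\<bar> \<partial>clocks)) / (\<epsilon> / 2)"
      by (simp only: add_divide_distrib)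
  qed
  finally show ?thesis
    by (simp only: mean_def avg_add avg_divide)
qed

lemma mean_msg_fraction_measurable:
  assumes b[measurable]: "b \<in> borel_measurable borel"
  shows "(\<lambda>s. mean (\<lambda>\<phi> T. \<bar>msg_fraction \<phi> T j s - b s\<bar>)) \<in> borel_measurable borel"
proof -
  have [measurable]: "(\<lambda>s. \<integral>T. \<bar>msg_fraction \<phi> T j s - b s\<bar> \<partial>clocks) \<in> borel_measurable borel"
    if \<phi>: "\<phi> \<in> matchings" for \<phi>
  proof (rule clocks.borel_measurable_lebesgue_integral)
    have [measurable]: "(\<lambda>(T, s). msg_fraction \<phi> T j s) \<in> borel_measurable (clocks \<Otimes>\<^sub>M borel)"
      using measurable_msg_fraction_pair(1)[OF \<phi>, of j undefined] by measurable
    show "(\<lambda>(s, T). \<bar>msg_fraction \<phi> T j s - b s\<bar>) \<in> borel_measurable (borel \<Otimes>\<^sub>M clocks)"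
      by measurable
  qed
  show ?thesis
    unfolding mean_def avg_def by measurable
qed

lemma mean_msg_fraction_in_unit:
  assumes "\<And>s. b s \<in> {0..1}"
  shows "mean (\<lambda>\<phi> T. \<bar>msg_fraction \<phi> T j s - b s\<bar>) \<in> {0..1}"
proof -
  have "(\<integral>T. \<bar>msg_fraction \<phi> T j s - b s\<bar> \<partial>clocks) \<le> 1" if \<phi>: "\<phi> \<in> matchings" for \<phi>
  proof (rule order_trans[OF abs_ge_self clocks.abs_integral_le_const])
    have [measurable]: "(\<lambda>T. msg_fraction \<phi> T j s) \<in> borel_measurable clocks"
      by (rule measurable_msg_fraction[OF \<phi>, where f = "\<lambda>_. s"]) (auto intro: measurable_clock)
    show "(\<lambda>T. \<bar>msg_fraction \<phi> T j s - b s\<bar>) \<in> borel_measurable clocks"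
      by measurable
    show "\<bar>\<bar>msg_fraction \<phi> T j s - b s\<bar>\<bar> \<le> 1" for T
      using msg_fraction_bounds[of \<phi> T j s] assms[of s] by auto
  qed
  then have "mean (\<lambda>\<phi> T. \<bar>msg_fraction \<phi> T j s - b s\<bar>) \<le> 1"
    unfolding mean_def by (intro avg_le_const) auto
  then show ?thesis
    by (simp add: mean_nonneg)
qed

end

section \<open>The large graph limit\<close>

lemma sum_atMost_of_bool_eq:
  fixes g :: "nat \<Rightarrow> real"
  shows "(\<Sum>k\<le>K. of_bool (x = k) * g k) = (if K < x then 0 else g x)"
proof -
  have "(\<Sum>k\<le>K. of_bool (x = k) * g k) = (\<Sum>k\<le>K. if k = x then g k else 0)"
    by (intro sum.cong) auto
  then show ?thesis
    by simp
qed

text \<open>With the value \<open>c\<close> beyond the cutoff as base value, corrected for each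
  degree up to \<open>K\<close>, the average becomes a finite sum, and convergence of single degree
  frequencies suffices for its limit.\<close>

lemma avg_empirical:
  assumes "n > 0"
  shows "avg {..<n} (\<lambda>v. if K < d v then c else g (d v))
    = c + (\<Sum>k\<le>K. empirical_degree_distribution n d k * (g k - c))"
proof -
  have "(if K < d v then c else g (d v)) = c + (\<Sum>k\<le>K. of_bool (d v = k) * (g k - c))" for v
    by (simp add: sum_atMost_of_bool_eq)
  moreover have "avg {..<n} (\<lambda>v. of_bool (d v = k) * x) = empirical_degree_distribution n d k * x" for k x
    by (simp add: avg_def empirical_degree_distribution_def sum_distrib_right[symmetric] Int_def)
  moreover have "avg {..<n} (\<lambda>v. c) = c"
    using assms by (intro avg_const) auto
  ultimately show ?thesis
    by (simp only: avg_add avg_sum)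
qed

lemma card_half_edges: "card (half_edges n d) = (\<Sum>v<n. d v)"
  by (simp add: half_edges_def card_SigmaI)

text \<open>A uniform half-edge selects its owner with probability proportional to the degree; the
  divisor is the number of half-edges per vertex.\<close>

lemma avg_half_edges:
  assumes "n > 0"
  shows "avg (half_edges n d) (\<lambda>z. f (fst z))
    = avg {..<n} (\<lambda>v. real (d v) * f v) / (real (card (half_edges n d)) / real n)"
proof -
  have "(\<Sum>z\<in>half_edges n d. f (fst z)) = (\<Sum>v<n. real (d v) * f v)"
    using sum.Sigma[of "{..<n}" "\<lambda>v. {..<d v}" "\<lambda>v i. f v"]
    by (simp add: half_edges_def case_prod_beta)
  then show ?thesis
    using assms by (simp add: avg_def)
qed

lemma avg_half_edges_empirical:
  assumes "half_edges n d \<noteq> {}"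
  shows "avg (half_edges n d) (\<lambda>z. if K < d (fst z) then c else g (d (fst z)))
    = c + (\<Sum>k\<le>K. real k * empirical_degree_distribution n d k / (real (card (half_edges n d)) / real n) * (g k - c))"
proof -
  let ?M = "real (card (half_edges n d)) / real n"
  have n: "n > 0"
    using assms by (auto simp: half_edges_def)
  have M: "?M > 0"
    using n assms finite_half_edges[of n d] by (simp add: card_gt_0_iff)
  have "avg (half_edges n d) (\<lambda>z. if K < d (fst z) then c else g (d (fst z)))
      = avg (half_edges n d) (\<lambda>z. c + (if K < d (fst z) then 0 else g (d (fst z)) - c))"
    by (intro avg_cong) auto
  also have "\<dots> = c + avg {..<n} (\<lambda>v. real (d v) * (if K < d v then 0 else g (d v) - c)) / ?M"
    using assms avg_half_edges[OF n, of d "\<lambda>v. if K < d v then 0 else g (d v) - c"]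
    by (simp add: avg_add avg_const finite_half_edges)
  also have "avg {..<n} (\<lambda>v. real (d v) * (if K < d v then 0 else g (d v) - c))
      = avg {..<n} (\<lambda>v. if K < d v then 0 else real (d v) * (g (d v) - c))"
    by (intro avg_cong) auto
  also have "\<dots> = (\<Sum>k\<le>K. empirical_degree_distribution n d k * (real k * (g k - c)))"
    using avg_empirical[OF n, of K d 0 "\<lambda>k. real k * (g k - c)"] by simp
  also have "\<dots> / ?M = (\<Sum>k\<le>K. real k * empirical_degree_distribution n d k / ?M * (g k - c))"
    unfolding sum_divide_distrib by (intro sum.cong) (simp_all add: mult_ac)
  finally show ?thesis .
qed

lemma empirical_degree_sums:
  assumes "n > 0"
  shows "(\<lambda>k. f k * empirical_degree_distribution n d k) sums avg {..<n} (\<lambda>v. f (d v))"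
proof -
  have "(\<lambda>k. f k * empirical_degree_distribution n d k) sums
      (\<Sum>k\<in>d ` {..<n}. f k * empirical_degree_distribution n d k)"
    by (rule sums_finite) (auto simp: empirical_degree_distribution_def)
  also have "(\<Sum>k\<in>d ` {..<n}. f k * empirical_degree_distribution n d k)
      = (\<Sum>k\<in>d ` {..<n}. \<Sum>v\<in>{v \<in> {..<n}. d v = k}. f (d v)) / real n"
    by (simp add: empirical_degree_distribution_def sum_divide_distrib mult_ac)
  also have "\<dots> = avg {..<n} (\<lambda>v. f (d v))"
    using sum.image_gen[of "{..<n}" "\<lambda>v. f (d v)" d] by (simp add: avg_def)
  finally show ?thesis .
qed

section \<open>Empirical averages as the graph grows\<close>

locale degree_sequence =
  fixes d :: "nat \<Rightarrow> nat \<Rightarrow> nat" and \<mu> :: "nat pmf" and m :: real and D :: "nat \<Rightarrow> real measure"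
  assumes even_degree_sum: "\<And>n. n \<ge> 1 \<Longrightarrow> even (\<Sum>i<n. d n i)"
    and asymptotic_degrees: "\<And>k. (\<lambda>n. empirical_degree_distribution n (d n) k) \<longlonglongrightarrow> pmf \<mu> k"
    and mean_sums: "(\<lambda>k. real k * pmf \<mu> k) sums m"
    and m_pos: "m > 0"
    and second_moments_bounded: "Bseq (\<lambda>n. \<Sum>k. (real k)\<^sup>2 * empirical_degree_distribution n (d n) k)"
    and prob_D: "\<And>k. prob_space (D k)"
    and sets_D[measurable_cong]: "\<And>k. sets (D k) = sets borel"
begin

abbreviation half_edge_density :: "nat \<Rightarrow> real" where
  "half_edge_density n \<equiv> real (card (half_edges n (d n))) / real n"

lemma half_edge_density_bounds:
  assumes "n > 0"
  shows "(\<Sum>k\<le>N. real k * empirical_degree_distribution n (d n) k) \<le> half_edge_density n"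
    and "N > 0 \<Longrightarrow> half_edge_density n \<le> (\<Sum>k\<le>N. real k * empirical_degree_distribution n (d n) k)
      + (\<Sum>k. (real k)\<^sup>2 * empirical_degree_distribution n (d n) k) / real N"
proof -
  have e: "half_edge_density n = avg {..<n} (\<lambda>v. real (d n v))"
    by (simp add: card_half_edges avg_def)
  have l: "(\<Sum>k\<le>N. real k * empirical_degree_distribution n (d n) k)
      = avg {..<n} (\<lambda>v. if N < d n v then 0 else real (d n v))"
    using avg_empirical[OF assms, of N "d n" 0 real] by (simp add: mult_ac)
  have s: "(\<Sum>k. (real k)\<^sup>2 * empirical_degree_distribution n (d n) k) = avg {..<n} (\<lambda>v. (real (d n v))\<^sup>2)"
    by (rule sums_unique[symmetric, OF empirical_degree_sums[OF assms]])
  show "(\<Sum>k\<le>N. real k * empirical_degree_distribution n (d n) k) \<le> half_edge_density n"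
    unfolding e l by (intro avg_mono) auto
  assume N: "N > 0"
  have "half_edge_density n \<le> avg {..<n} (\<lambda>v. (if N < d n v then 0 else real (d n v)) + (real (d n v))\<^sup>2 / real N)"
    unfolding e
  proof (rule avg_mono)
    fix v
    have "real (d n v) * real N \<le> (real (d n v))\<^sup>2" if "N < d n v"
      using that by (simp add: power2_eq_square)
    then show "real (d n v) \<le> (if N < d n v then 0 else real (d n v)) + (real (d n v))\<^sup>2 / real N"
      using N by (simp add: field_simps)
  qed
  then show "half_edge_density n \<le> (\<Sum>k\<le>N. real k * empirical_degree_distribution n (d n) k)
      + (\<Sum>k. (real k)\<^sup>2 * empirical_degree_distribution n (d n) k) / real N"
    unfolding l s by (simp add: avg_add avg_divide)
qed

text \<open>Degrees above \<open>N\<close> contribute at most the second moment divided by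
  \<open>N\<close>, uniformly in \<open>n\<close>, so no mass of the first moment escapes; the
  frequencies up to \<open>N\<close> converge term by term.\<close>

lemma half_edge_density_tendsto: "half_edge_density \<longlonglongrightarrow> m"
proof (rule LIMSEQ_I)
  fix \<epsilon> :: real assume \<epsilon>: "\<epsilon> > 0"
  obtain C where C: "C > 0" "\<And>n. \<bar>\<Sum>k. (real k)\<^sup>2 * empirical_degree_distribution n (d n) k\<bar> \<le> C"
    using second_moments_bounded by (auto simp: Bseq_def)
  have "(\<lambda>N. \<Sum>k\<le>N. real k * pmf \<mu> k) \<longlonglongrightarrow> m"
    using mean_sums by (simp add: sums_def_le)
  from LIMSEQ_D[OF this, of "\<epsilon> / 4"] \<epsilon> obtain N1 where
    N1: "\<And>N. N \<ge> N1 \<Longrightarrow> \<bar>(\<Sum>k\<le>N. real k * pmf \<mu> k) - m\<bar> < \<epsilon> / 4"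
    by auto
  obtain N2 where N2: "C / real N2 < \<epsilon> / 4" "N2 > 0"
  proof -
    obtain N2 :: nat where "C / (\<epsilon> / 4) < real N2"
      using reals_Archimedean2 by blast
    moreover have "0 < C / (\<epsilon> / 4)"
      using C(1) \<epsilon> by simp
    ultimately have "0 < real N2"
      by linarith
    with \<open>C / (\<epsilon> / 4) < real N2\<close> show ?thesis
      using \<epsilon> by (intro that[of N2]) (simp_all add: field_simps)
  qed
  define N where "N = max N1 N2"
  have N: "N > 0" "C / real N < \<epsilon> / 4"
  proof -
    show "N > 0"
      using N2 by (simp add: N_def)
    have "C / real N \<le> C / real N2"
      using N2 C by (intro divide_left_mono) (auto simp: N_def)
    then show "C / real N < \<epsilon> / 4"
      using N2 by linarith
  qed
  have "(\<lambda>n. \<Sum>k\<le>N. real k * empirical_degree_distribution n (d n) k) \<longlonglongrightarrow> (\<Sum>k\<le>N. real k * pmf \<mu> k)"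
    by (intro tendsto_intros asymptotic_degrees)
  from LIMSEQ_D[OF this, of "\<epsilon> / 4"] \<epsilon> obtain n0 where
    n0: "\<And>n. n \<ge> n0 \<Longrightarrow> \<bar>(\<Sum>k\<le>N. real k * empirical_degree_distribution n (d n) k) - (\<Sum>k\<le>N. real k * pmf \<mu> k)\<bar> < \<epsilon> / 4"
    by auto
  show "\<exists>n0. \<forall>n\<ge>n0. norm (half_edge_density n - m) < \<epsilon>"
  proof (intro exI allI impI)
    fix n assume n: "n \<ge> max n0 1"
    have "(\<Sum>k. (real k)\<^sup>2 * empirical_degree_distribution n (d n) k) / real N \<le> C / real N"
      using C(2)[of n] by (intro divide_right_mono) auto
    moreover have "n > 0" "n \<ge> n0" "N \<ge> N1"
      using n by (auto simp: N_def)
    ultimately show "norm (half_edge_density n - m) < \<epsilon>"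
      using half_edge_density_bounds(1)[of n N] half_edge_density_bounds(2)[of n N] n0[of n] N1[of N] N
      unfolding real_norm_def by linarith
  qed
qed

lemma eventually_clocked_degrees: "\<forall>\<^sub>F n in sequentially. clocked_degrees n (d n) D"
proof -
  have "\<forall>\<^sub>F n in sequentially. half_edge_density n > 0"
    using half_edge_density_tendsto m_pos by (rule order_tendstoD(1))
  then show ?thesis
    using eventually_ge_at_top[of 1]
  proof eventually_elim
    case (elim n)
    then have "half_edges n (d n) \<noteq> {}"
      by auto
    then show ?case
      using even_degree_sum[of n] elim by (simp add: clocked_degrees_def clocked_degrees_axioms_def clock_model_def card_half_edges prob_D sets_D)
  qed
qed

lemma inverse_card_half_edges_tendsto: "(\<lambda>n. 1 / real (card (half_edges n (d n)))) \<longlonglongrightarrow> 0"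
proof -
  have "(\<lambda>n. 1 / half_edge_density n * (1 / real n)) \<longlonglongrightarrow> 1 / m * 0"
    using m_pos by (intro tendsto_intros half_edge_density_tendsto lim_1_over_n) auto
  moreover have "\<forall>\<^sub>F n in sequentially. 1 / half_edge_density n * (1 / real n) = 1 / real (card (half_edges n (d n)))"
    using eventually_gt_at_top[of 0] by eventually_elim simp
  ultimately show ?thesis
    using Lim_transform_eventually by fastforce
qed

lemma deviation_tendsto: "(\<lambda>n. C / real (card (half_edges n (d n))) * sqrt (real (card (half_edges n (d n)) + n))) \<longlonglongrightarrow> 0"
  and deviation_tendsto': "(\<lambda>n. C / real n * sqrt (real (card (half_edges n (d n)) + n))) \<longlonglongrightarrow> 0"
proof -
  let ?h = "\<lambda>n. real (card (half_edges n (d n)))"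
  have 1: "(\<lambda>n. C / half_edge_density n * sqrt ((half_edge_density n + 1) * (1 / real n))) \<longlonglongrightarrow> C / m * sqrt ((m + 1) * 0)"
    using m_pos by (intro tendsto_intros half_edge_density_tendsto lim_1_over_n) auto
  have 2: "(\<lambda>n. C * sqrt ((half_edge_density n + 1) * (1 / real n))) \<longlonglongrightarrow> C * sqrt ((m + 1) * 0)"
    by (intro tendsto_intros half_edge_density_tendsto lim_1_over_n)
  have s: "sqrt ((half_edge_density n + 1) * (1 / real n)) = sqrt (real (card (half_edges n (d n)) + n)) / real n"
    if "n > 0" for n
  proof -
    have "(half_edge_density n + 1) * (1 / real n) = real (card (half_edges n (d n)) + n) / (real n)\<^sup>2"
      using that by (simp add: field_simps power2_eq_square)
    then show ?thesis
      by (simp add: real_sqrt_divide)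
  qed
  have "\<forall>\<^sub>F n in sequentially. C / half_edge_density n * sqrt ((half_edge_density n + 1) * (1 / real n))
      = C / ?h n * sqrt (real (card (half_edges n (d n)) + n))"
    using eventually_gt_at_top[of 0]
  proof eventually_elim
    case (elim n)
    then show ?case
      unfolding s[OF elim] by simp
  qed
  from Lim_transform_eventually[OF 1 this]
  show "(\<lambda>n. C / ?h n * sqrt (real (card (half_edges n (d n)) + n))) \<longlonglongrightarrow> 0"
    by simp
  have "\<forall>\<^sub>F n in sequentially. C * sqrt ((half_edge_density n + 1) * (1 / real n))
      = C / real n * sqrt (real (card (half_edges n (d n)) + n))"
    using eventually_gt_at_top[of 0]
  proof eventually_elim
    case (elim n)
    then show ?case
      unfolding s[OF elim] by simp
  qed
  from Lim_transform_eventually[OF 2 this]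
  show "(\<lambda>n. C / real n * sqrt (real (card (half_edges n (d n)) + n))) \<longlonglongrightarrow> 0"
    by simp
qed

text \<open>The size-biased degree law: the limiting law of the degree at the owner of a uniform
  half-edge.\<close>

definition weight :: "nat \<Rightarrow> real" where
  "weight k = real k * pmf \<mu> k / m"

lemma weight_nonneg: "0 \<le> weight k"
  using m_pos by (simp add: weight_def)

lemma weight_sums: "weight sums 1"
  using sums_divide[OF mean_sums, of m] m_pos by (simp add: weight_def[abs_def])

lemma sum_weight_le: "sum weight {..K} \<le> 1"
  using sum_le_suminf[of weight "{..K}"] weight_sums weight_nonneg by (simp add: sums_iff)

text \<open>The limit of \<open>msg_fraction\<close>. As in \<open>avg_empirical\<close>, the weight
  beyond \<open>K\<close> goes to the trivial answer, which is \<open>1\<close> at depth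
  \<open>0\<close> and \<open>of_bool (odd j)\<close> at depth \<open>Suc j\<close>.\<close>

primrec lim_msg :: "nat \<Rightarrow> nat \<Rightarrow> real \<Rightarrow> real" where
  "lim_msg K 0 t = 1 + (\<Sum>k\<le>K. weight k * ((\<integral>s. indicator {..<t} s \<partial>D k) - 1))"
| "lim_msg K (Suc j) t = of_bool (odd j)
     + (\<Sum>k\<le>K. weight k * ((\<integral>s. indicator {..<t} s * (1 - lim_msg K j s) ^ (k - 1) \<partial>D k) - of_bool (odd j)))"

definition lim_active :: "nat \<Rightarrow> nat \<Rightarrow> real" where
  "lim_active K j = of_bool (odd j)
     + (\<Sum>k\<le>K. pmf \<mu> k * ((\<integral>s. (1 - lim_msg K j s) ^ k \<partial>D k) - of_bool (odd j)))"

lemma measurable_partial_integral: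
  fixes f :: "real \<Rightarrow> real"
  assumes [measurable]: "f \<in> borel_measurable borel"
  shows "(\<lambda>t. \<integral>s. indicator {..<t} s * f s \<partial>D k) \<in> borel_measurable borel"
proof -
  interpret prob_space "D k"
    by (rule prob_D)
  have "(\<lambda>(t, s). indicator {..<t} s * f s) = (\<lambda>(t, s). of_bool (s < t) * f s)"
    by (auto simp: indicator_def)
  also have "\<dots> \<in> borel_measurable (borel \<Otimes>\<^sub>M D k)"
    by measurable
  finally show ?thesis
    by (rule borel_measurable_lebesgue_integral)
qed

lemma integral_in_unit:
  fixes f :: "real \<Rightarrow> real"
  assumes "f \<in> borel_measurable borel" "\<And>s. f s \<in> {0..1}"
  shows "(\<integral>s. f s \<partial>D k) \<in> {0..1}"
proof -
  interpret prob_space "D k"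
    by (rule prob_D)
  have "\<bar>\<integral>s. f s \<partial>D k\<bar> \<le> 1"
    using assms by (intro abs_integral_le_const) auto
  moreover have "0 \<le> (\<integral>s. f s \<partial>D k)"
    using assms by (intro Bochner_Integration.integral_nonneg) auto
  ultimately show ?thesis
    by auto
qed

lemma convex_combination_in_unit:
  assumes "c \<in> {0..1}" "\<And>k. g k \<in> {0..1}" "\<And>k. 0 \<le> w k" "sum w {..K} \<le> (1::real)"
  shows "c + (\<Sum>k\<le>K. w k * (g k - c)) \<in> {0..1}"
proof -
  have e: "c + (\<Sum>k\<le>K. w k * (g k - c)) = (1 - sum w {..K}) * c + (\<Sum>k\<le>K. w k * g k)"
  proof -
    have "(\<Sum>k\<le>K. w k * (g k - c)) = (\<Sum>k\<le>K. w k * g k) - c * sum w {..K}"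
      by (simp add: right_diff_distrib sum_subtractf sum_distrib_left mult.commute)
    then show ?thesis
      by (simp add: algebra_simps)
  qed
  have "(\<Sum>k\<le>K. w k * g k) \<le> sum w {..K}"
    using assms by (intro sum_mono) (auto intro: mult_left_le)
  moreover have "0 \<le> (\<Sum>k\<le>K. w k * g k)"
    using assms by (intro sum_nonneg) auto
  moreover have "(1 - sum w {..K}) * c \<le> 1 - sum w {..K}" "0 \<le> (1 - sum w {..K}) * c"
    using assms by (auto intro: mult_left_le)
  ultimately show ?thesis
    unfolding e by auto
qed

lemma lim_msg_props: "lim_msg K j \<in> borel_measurable borel \<and> (\<forall>t. lim_msg K j t \<in> {0..1})"
proof (induction j)
  case 0
  have [measurable]: "(\<lambda>t. \<integral>s. indicat_real {..<t} s \<partial>D k) \<in> borel_measurable borel" for k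
    by (rule measurable_partial_integral[of "\<lambda>_. 1" k, unfolded mult_1_right, OF borel_measurable_const])
  have "(\<lambda>t. lim_msg K 0 t) \<in> borel_measurable borel"
    unfolding lim_msg.simps by measurable
  moreover have "lim_msg K 0 t \<in> {0..1}" for t
    unfolding lim_msg.simps
    by (intro convex_combination_in_unit integral_in_unit weight_nonneg sum_weight_le) (auto simp: indicator_def)
  ultimately show ?case
    by simp
next
  case (Suc j)
  then have [measurable]: "lim_msg K j \<in> borel_measurable borel" and b: "\<And>t. lim_msg K j t \<in> {0..1}"
    by auto
  have [measurable]: "(\<lambda>t. \<integral>s. indicator {..<t} s * (1 - lim_msg K j s) ^ (k - 1) \<partial>D k) \<in> borel_measurable borel" for k
    by (rule measurable_partial_integral) simp
  have "(\<lambda>t. lim_msg K (Suc j) t) \<in> borel_measurable borel"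
    unfolding lim_msg.simps by measurable
  moreover have "lim_msg K (Suc j) t \<in> {0..1}" for t
    unfolding lim_msg.simps
  proof (intro convex_combination_in_unit integral_in_unit weight_nonneg sum_weight_le)
    fix k s show "indicator {..<t} s * (1 - lim_msg K j s) ^ (k - 1) \<in> {0..1}"
      using b[of s] by (auto simp: indicator_def intro: power_le_one)
  qed auto
  ultimately show ?case
    by simp
qed

abbreviation E :: "nat \<Rightarrow> ((nat \<times> nat \<Rightarrow> nat \<times> nat) \<Rightarrow> (nat \<Rightarrow> real) \<Rightarrow> real) \<Rightarrow> real" where
  "E n \<equiv> clocked_degrees.mean n (d n) D"

lemma empirical_weight_tendsto:
  "(\<lambda>n. c + (\<Sum>k\<le>K. real k * empirical_degree_distribution n (d n) k / half_edge_density n * (g k - c)))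
    \<longlonglongrightarrow> c + (\<Sum>k\<le>K. weight k * (g k - c))"
  unfolding weight_def using m_pos
  by (intro tendsto_intros asymptotic_degrees half_edge_density_tendsto) auto

text \<open>\<open>low_error\<close> integrates the mean error over the deadline, so convergence for
  each fixed \<open>t\<close> suffices by dominated convergence, the errors being at most
  one.\<close>

lemma low_error_tendsto:
  assumes "\<And>t. (\<lambda>n. E n (\<lambda>\<phi> T. \<bar>degree_cutoff.msg_fraction n (d n) K \<phi> T j t - lim_msg K j t\<bar>)) \<longlonglongrightarrow> 0"
  shows "(\<lambda>n. clocked_degrees.low_error n (d n) K D j (lim_msg K j)) \<longlonglongrightarrow> 0"
proof -
  let ?f = "\<lambda>n s. E n (\<lambda>\<phi> T. \<bar>degree_cutoff.msg_fraction n (d n) K \<phi> T j s - lim_msg K j s\<bar>)"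
  obtain n0 where n0: "\<And>n. n \<ge> n0 \<Longrightarrow> clocked_degrees n (d n) D"
    using eventually_clocked_degrees by (auto simp: eventually_sequentially)
  have int: "(\<lambda>n. \<integral>s. ?f n s \<partial>D k) \<longlonglongrightarrow> 0" for k
  \<comment> \<open>The locale facts are available from \<open>n0\<close> on, whereas dominated
    convergence wants measurability for every index; hence the shift.\<close>
  proof (rule LIMSEQ_offset[of _ n0])
    interpret Dk: prob_space "D k"
      by (rule prob_D)
    have "(\<lambda>n. \<integral>s. ?f (n + n0) s \<partial>D k) \<longlonglongrightarrow> (\<integral>s. 0 \<partial>D k)"
    proof (rule integral_dominated_convergence[where w = "\<lambda>_. 1"])
      fix n
      interpret clocked_degrees "n + n0" "d (n + n0)" K D
        by (rule n0) simp
      show "?f (n + n0) \<in> borel_measurable (D k)"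
        using mean_msg_fraction_measurable[of "lim_msg K j" j] lim_msg_props
        by (simp add: measurable_cong_sets[OF sets_D refl])
      show "AE s in D k. norm (?f (n + n0) s) \<le> 1"
        using mean_msg_fraction_in_unit[of "lim_msg K j" j] lim_msg_props by auto
    next
      show "AE s in D k. (\<lambda>n. ?f (n + n0) s) \<longlonglongrightarrow> 0"
        using LIMSEQ_ignore_initial_segment[OF assms] by simp
    qed auto
    then show "(\<lambda>n. \<integral>s. ?f (n + n0) s \<partial>D k) \<longlonglongrightarrow> 0"
      by simp
  qed
  let ?c = "real (K * degree_cutoff.step_error K j K + K * degree_cutoff.reach K (Suc j))"
  have "(\<lambda>n. ?c * (1 / real (card (half_edges n (d n)))) + real K * (\<Sum>k\<le>K. \<integral>s. ?f n s \<partial>D k))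
      \<longlonglongrightarrow> ?c * 0 + real K * (\<Sum>k\<le>K. 0)"
    by (intro tendsto_intros inverse_card_half_edges_tendsto int)
  then have "(\<lambda>n. ?c * (1 / real (card (half_edges n (d n)))) + real K * (\<Sum>k\<le>K. \<integral>s. ?f n s \<partial>D k)) \<longlonglongrightarrow> 0"
    by simp
  moreover have "\<forall>\<^sub>F n in sequentially. ?c * (1 / real (card (half_edges n (d n)))) + real K * (\<Sum>k\<le>K. \<integral>s. ?f n s \<partial>D k)
      = clocked_degrees.low_error n (d n) K D j (lim_msg K j)"
    using eventually_clocked_degrees
  proof eventually_elim
    case (elim n)
    then interpret clocked_degrees n "d n" K D .
    show ?case
      by (simp add: low_error_def)
  qed
  ultimately show ?thesis
    by (rule Lim_transform_eventually)
qed

lemma mean_error_tendsto: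
  assumes "err \<longlonglongrightarrow> 0" "a \<longlonglongrightarrow> \<beta>"
    and le: "\<forall>\<^sub>F n in sequentially. E n (\<lambda>\<phi> T. \<bar>F n \<phi> T - \<beta>\<bar>) \<le> err n + \<bar>a n - \<beta>\<bar>"
  shows "(\<lambda>n. E n (\<lambda>\<phi> T. \<bar>F n \<phi> T - \<beta>\<bar>)) \<longlonglongrightarrow> 0"
proof (rule tendsto_sandwich[OF _ le tendsto_const])
  show "\<forall>\<^sub>F n in sequentially. 0 \<le> E n (\<lambda>\<phi> T. \<bar>F n \<phi> T - \<beta>\<bar>)"
    using eventually_clocked_degrees
    by eventually_elim (auto intro!: clocked_degrees.mean_nonneg)
  have "(\<lambda>n. err n + \<bar>a n - \<beta>\<bar>) \<longlonglongrightarrow> 0 + 0"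
    by (intro tendsto_add assms(1) tendsto_rabs_zero LIM_zero assms(2))
  then show "(\<lambda>n. err n + \<bar>a n - \<beta>\<bar>) \<longlonglongrightarrow> 0"
    by simp
qed

lemma msg_fraction_tendsto:
  "(\<lambda>n. E n (\<lambda>\<phi> T. \<bar>degree_cutoff.msg_fraction n (d n) K \<phi> T j t - lim_msg K j t\<bar>)) \<longlonglongrightarrow> 0"
proof (induction j arbitrary: t)
  case 0
  let ?g = "\<lambda>k. \<integral>s. indicat_real {..<t} s \<partial>D k"
  let ?a = "\<lambda>n. 1 + (\<Sum>k\<le>K. real k * empirical_degree_distribution n (d n) k / half_edge_density n * (?g k - 1))"
  let ?C = "real (4 * degree_cutoff.reach K 0 + degree_cutoff.reach K (Suc 0))"
  show ?case
  proof (rule mean_error_tendsto[OF deviation_tendsto[of ?C]])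
    show "?a \<longlonglongrightarrow> lim_msg K 0 t"
      using empirical_weight_tendsto[where c = 1 and K = K and g = ?g] by simp
    show "\<forall>\<^sub>F n in sequentially. E n (\<lambda>\<phi> T. \<bar>degree_cutoff.msg_fraction n (d n) K \<phi> T 0 t - lim_msg K 0 t\<bar>)
        \<le> ?C / real (card (half_edges n (d n))) * sqrt (real (card (half_edges n (d n)) + n)) + \<bar>?a n - lim_msg K 0 t\<bar>"
      using eventually_clocked_degrees
    proof eventually_elim
      case (elim n)
      then interpret clocked_degrees n "d n" K D .
      let ?y = "avg H (\<lambda>z. if K < d n (fst z) then 1 else ?g (d n (fst z)))"
      have y: "?y = ?a n"
        by (rule avg_half_edges_empirical[OF half_edges_nonempty])
      have "mean (\<lambda>\<phi> T. \<bar>msg_fraction \<phi> T 0 t - lim_msg K 0 t\<bar>)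
          \<le> mean (\<lambda>\<phi> T. \<bar>msg_fraction \<phi> T 0 t - ?y\<bar>) + \<bar>?y - lim_msg K 0 t\<bar>"
        by (intro mean_abs_diff_triangle msg_fraction_bounds
            measurable_msg_fraction[where f = "\<lambda>_. t"]) (auto intro: measurable_clock)
      also have "\<dots> \<le> deviation 0 + \<bar>?y - lim_msg K 0 t\<bar>"
        using msg_fraction_0[of t] by simp
      finally show ?case
        unfolding deviation_def y .
    qed
  qed
next
  case (Suc j)
  let ?\<beta> = "lim_msg K (Suc j) t"
  let ?g = "\<lambda>k. \<integral>s. indicator {..<t} s * (1 - lim_msg K j s) ^ (k - 1) \<partial>D k"
  let ?a = "\<lambda>n. of_bool (odd j) + (\<Sum>k\<le>K. real k * empirical_degree_distribution n (d n) k / half_edge_density n * (?g k - of_bool (odd j)))"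
  let ?C = "real (4 * degree_cutoff.reach K (Suc j) + degree_cutoff.reach K (Suc (Suc j)))"
  show ?case
  proof (rule mean_error_tendsto[OF tendsto_add_zero[OF deviation_tendsto[of ?C] low_error_tendsto[OF Suc.IH]]])
    show "?a \<longlonglongrightarrow> ?\<beta>"
      using empirical_weight_tendsto[where c = "of_bool (odd j)" and K = K and g = ?g] by simp
    show "\<forall>\<^sub>F n in sequentially. E n (\<lambda>\<phi> T. \<bar>degree_cutoff.msg_fraction n (d n) K \<phi> T (Suc j) t - ?\<beta>\<bar>)
        \<le> ?C / real (card (half_edges n (d n))) * sqrt (real (card (half_edges n (d n)) + n))
          + clocked_degrees.low_error n (d n) K D j (lim_msg K j) + \<bar>?a n - ?\<beta>\<bar>"
      using eventually_clocked_degrees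
    proof eventually_elim
      case (elim n)
      then interpret clocked_degrees n "d n" K D .
      let ?y = "avg H (\<lambda>z. if K < d n (fst z) then of_bool (odd j) else ?g (d n (fst z)))"
      have y: "?y = ?a n"
        by (rule avg_half_edges_empirical[OF half_edges_nonempty])
      have "mean (\<lambda>\<phi> T. \<bar>msg_fraction \<phi> T (Suc j) t - ?\<beta>\<bar>)
          \<le> mean (\<lambda>\<phi> T. \<bar>msg_fraction \<phi> T (Suc j) t - ?y\<bar>) + \<bar>?y - ?\<beta>\<bar>"
        by (intro mean_abs_diff_triangle msg_fraction_bounds
            measurable_msg_fraction[where f = "\<lambda>_. t"]) (auto intro: measurable_clock)
      also have "\<dots> \<le> deviation (Suc j) + low_error j (lim_msg K j) + \<bar>?y - ?\<beta>\<bar>"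
        using msg_fraction_Suc[of "lim_msg K j" j t] lim_msg_props[of K j] by simp
      finally show ?case
        unfolding deviation_def y .
    qed
  qed
qed

lemma active_fraction_tendsto:
  "(\<lambda>n. E n (\<lambda>\<phi> T. \<bar>clocked_degrees.active_fraction n (d n) K \<phi> T j - lim_active K j\<bar>)) \<longlonglongrightarrow> 0"
proof -
  let ?g = "\<lambda>k. \<integral>s. (1 - lim_msg K j s) ^ k \<partial>D k"
  let ?a = "\<lambda>n. of_bool (odd j) + (\<Sum>k\<le>K. empirical_degree_distribution n (d n) k * (?g k - of_bool (odd j)))"
  let ?C = "real (5 + 4 * degree_cutoff.reach K j + degree_cutoff.reach K (Suc j))"
  show ?thesis
  proof (rule mean_error_tendsto[OF tendsto_add_zero[OF deviation_tendsto'[of ?C] low_error_tendsto[OF msg_fraction_tendsto]]])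
    show "?a \<longlonglongrightarrow> lim_active K j"
      unfolding lim_active_def by (intro tendsto_intros asymptotic_degrees)
    show "\<forall>\<^sub>F n in sequentially. E n (\<lambda>\<phi> T. \<bar>clocked_degrees.active_fraction n (d n) K \<phi> T j - lim_active K j\<bar>)
        \<le> ?C / real n * sqrt (real (card (half_edges n (d n)) + n))
          + clocked_degrees.low_error n (d n) K D j (lim_msg K j) + \<bar>?a n - lim_active K j\<bar>"
      using eventually_clocked_degrees
    proof eventually_elim
      case (elim n)
      then interpret clocked_degrees n "d n" K D .
      let ?y = "avg {..<n} (\<lambda>v. if K < d n v then of_bool (odd j) else ?g (d n v))"
      have y: "?y = ?a n"
        by (rule avg_empirical[OF n_pos])
      have "mean (\<lambda>\<phi> T. \<bar>active_fraction \<phi> T j - lim_active K j\<bar>)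
          \<le> mean (\<lambda>\<phi> T. \<bar>active_fraction \<phi> T j - ?y\<bar>) + \<bar>?y - lim_active K j\<bar>"
        by (intro mean_abs_diff_triangle active_fraction_bounds measurable_active_fraction)
      also have "\<dots> \<le> ?C / real n * sqrt (real (card H + n)) + low_error j (lim_msg K j) + \<bar>?y - lim_active K j\<bar>"
        using active_fraction_mean[of "lim_msg K j" j] lim_msg_props[of K j] by simp
      finally show ?case
        unfolding y .
    qed
  qed
qed

end

section \<open>The limiting differential equation\<close>

locale sda_limit =
  fixes d :: "nat \<Rightarrow> nat \<Rightarrow> nat" and \<mu> :: "nat pmf" and m :: real
    and rate :: "nat \<Rightarrow> real" and \<tau> :: "real \<Rightarrow> real"
  assumes even_sum: "\<And>n. n \<ge> 1 \<Longrightarrow> even (\<Sum>i<n. d n i)"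
    and degrees_tendsto: "\<And>k. (\<lambda>n. empirical_degree_distribution n (d n) k) \<longlonglongrightarrow> pmf \<mu> k"
    and first_moment: "(\<lambda>k. real k * pmf \<mu> k) sums m"
    and m_gt_0: "m > 0"
    and second_moment: "summable (\<lambda>k. (real k)\<^sup>2 * pmf \<mu> k)"
    and second_moments_Bseq: "Bseq (\<lambda>n. \<Sum>k. (real k)\<^sup>2 * empirical_degree_distribution n (d n) k)"
    and rate_pos: "\<And>k. rate k > 0"
    and rate_summable: "summable (\<lambda>k. real k * rate k * pmf \<mu> k)"
    and \<tau>_0: "\<tau> 0 = 0"
    and \<tau>_ode: "\<And>t. t \<ge> 0 \<Longrightarrow>
      (\<tau> has_real_derivative
         1 / m * (\<Sum>k. real k * rate k * pmf \<mu> k * exp (- rate k * t) * exp (- (real k - 2) * \<tau> t)))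
        (at t within {0..})"

sublocale sda_limit \<subseteq> degree_sequence d \<mu> m "\<lambda>k. density lborel (exponential_density (rate k))"
  by (rule degree_sequence.intro[OF even_sum degrees_tendsto first_moment m_gt_0 second_moments_Bseq])
    (simp_all add: prob_space_exponential_density rate_pos)

context sda_limit
begin

abbreviation D :: "nat \<Rightarrow> real measure" where
  "D k \<equiv> density lborel (exponential_density (rate k))"

text \<open>For \<open>k \<ge> 1\<close> the product of the exponentials is at most
  \<open>exp x\<close>, and the term \<open>k = 0\<close> vanishes. Positivity holds because a
  positive mean needs some degree \<open>k \<ge> 1\<close> of positive mass.\<close>

lemma ode_terms:
  assumes "0 \<le> t" "0 \<le> x"
  shows "summable (\<lambda>k. real k * rate k * pmf \<mu> k * exp (- rate k * t) * exp (- (real k - 2) * x))" (is "summable ?f")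
    and "(\<Sum>k. real k * rate k * pmf \<mu> k * exp (- rate k * t) * exp (- (real k - 2) * x)) > 0"
proof -
  have le: "?f k \<le> real k * rate k * pmf \<mu> k * exp x" for k
  proof (cases "k = 0")
    case False
    then have "- (real k - 2) * x \<le> x"
      using assms mult_right_mono[of "- (real k - 2)" 1 x] by simp
    then have "exp (- rate k * t) * exp (- (real k - 2) * x) \<le> 1 * exp x"
      using assms rate_pos[of k] by (intro mult_mono) auto
    then have "real k * rate k * pmf \<mu> k * (exp (- rate k * t) * exp (- (real k - 2) * x))
        \<le> real k * rate k * pmf \<mu> k * exp x"
      using rate_pos[of k] by (intro mult_left_mono) auto
    then show ?thesis
      by (simp add: mult.assoc)
  qed simp
  have nn: "0 \<le> ?f k" for k
    using rate_pos[of k] by simp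
  show s: "summable ?f"
    by (rule summable_comparison_test'[OF summable_mult2[OF rate_summable, of "exp x"]])
      (use le nn in auto)
  have "\<exists>k. real k * pmf \<mu> k \<noteq> 0"
  proof (rule ccontr)
    assume "\<not> ?thesis"
    then have "(\<lambda>k. real k * pmf \<mu> k) = (\<lambda>_. 0)"
      by auto
    with first_moment m_gt_0 sums_unique2[OF first_moment, of 0] show False
      by simp
  qed
  then obtain k where k: "real k * pmf \<mu> k \<noteq> 0"
    by blast
  have "0 < ?f k"
    using k rate_pos[of k] by (simp add: pmf_pos zero_less_mult_iff)
  then show "0 < suminf ?f"
    using s nn by (intro suminf_pos2)
qed

lemma continuous_\<tau>: "continuous_on {0..} \<tau>"
  using \<tau>_ode by (auto intro!: DERIV_continuous_on)

text \<open>The derivative is known to be positive where \<tau> is nonnegative. At the last such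
  time before \<open>t\<close>, \<tau> would strictly increase to the right, which contradicts its
  being the last.\<close>

lemma \<tau>_nonneg:
  assumes "0 \<le> t"
  shows "0 \<le> \<tau> t"
proof (rule ccontr)
  assume neg: "\<not> 0 \<le> \<tau> t"
  let ?S = "{0..t} \<inter> \<tau> -` {0..}"
  have "continuous_on {0..t} \<tau>"
    using continuous_\<tau> by (rule continuous_on_subset) auto
  then have "closed ?S"
    by (rule continuous_closed_preimage) auto
  then have "compact ?S"
    by (meson bounded_Int bounded_closed_interval compact_eq_bounded_closed)
  moreover have "0 \<in> ?S"
    using assms \<tau>_0 by auto
  ultimately obtain s where s: "s \<in> ?S" and max: "\<And>r. r \<in> ?S \<Longrightarrow> r \<le> s"
    by (metis compact_attains_sup empty_iff)
  have "s \<noteq> t"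
    using s neg by auto
  then have lt: "0 \<le> s" "s < t" "0 \<le> \<tau> s"
    using s by auto
  let ?d = "1 / m * (\<Sum>k. real k * rate k * pmf \<mu> k * exp (- rate k * s) * exp (- (real k - 2) * \<tau> s))"
  have "0 < ?d"
    using ode_terms(2)[OF lt(1,3)] m_gt_0 by simp
  from has_real_derivative_pos_inc_right[OF \<tau>_ode[OF lt(1)] this]
  obtain \<delta> where \<delta>: "\<delta> > 0" "\<And>h. 0 < h \<Longrightarrow> s + h \<in> {0..} \<Longrightarrow> h < \<delta> \<Longrightarrow> \<tau> s < \<tau> (s + h)"
    by blast
  define h where "h = min (\<delta> / 2) (t - s)"
  have h: "0 < h" "h < \<delta>" "s + h \<le> t"
    using \<delta>(1) lt by (auto simp: h_def)
  have "\<tau> s < \<tau> (s + h)"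
    using h lt by (intro \<delta>(2)) auto
  then have "s + h \<in> ?S"
    using h lt by auto
  from max[OF this] h show False
    by simp
qed

text \<open>Constant to the left of zero, so that \<open>q\<close> is continuous and measurable on
  the whole line, while the clocks are nonnegative almost surely.\<close>

definition q :: "real \<Rightarrow> real" where
  "q t = exp (- \<tau> (max 0 t))"

lemma q_bounds: "q t \<in> {0..1}"
  using \<tau>_nonneg[of "max 0 t"] by (simp add: q_def)

lemma continuous_q: "continuous_on UNIV q"
proof -
  have "continuous_on UNIV (\<lambda>t. \<tau> (max 0 t))"
    by (rule continuous_on_compose2[OF continuous_\<tau>]) (auto intro!: continuous_intros)
  then show ?thesis
    unfolding q_def by (intro continuous_intros)
qed

lemma measurable_q[measurable]: "q \<in> borel_measurable borel"
  by (rule borel_measurable_continuous_onI[OF continuous_q])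

text \<open>The density at \<open>t\<close> of the event that the clock of a vertex of degree
  \<open>k\<close> rings while its other \<open>k - 1\<close> edges are silent.\<close>

definition q_term :: "nat \<Rightarrow> real \<Rightarrow> real" where
  "q_term k t = rate k * exp (- rate k * t) * q t ^ (k - 1)"

lemma continuous_q_term: "continuous_on A (q_term k)"
  unfolding q_term_def by (intro continuous_intros continuous_on_subset[OF continuous_q]) auto

lemma q_term_bounds: "0 \<le> t \<Longrightarrow> q_term k t \<in> {0..rate k}"
proof -
  assume t: "0 \<le> t"
  have "exp (- rate k * t) * q t ^ (k - 1) \<le> 1 * 1"
    using q_bounds[of t] rate_pos[of k] t by (intro mult_mono power_le_one) auto
  moreover have "0 \<le> exp (- rate k * t) * q t ^ (k - 1)"
    using q_bounds[of t] by simp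
  ultimately show ?thesis
    using rate_pos[of k] by (simp add: q_term_def mult.assoc)
qed

lemma weight_rate_summable: "summable (\<lambda>k. weight k * rate k)"
  using summable_divide[OF rate_summable, of m] by (simp add: weight_def mult_ac)

text \<open>By the chain rule the derivative of \<open>q\<close> is
  \<open>- exp (- \<tau> t)\<close> times that of \<tau>, and this factor turns
  \<open>exp (- (real k - 2) * \<tau> t)\<close> into \<open>q t ^ (k - 1)\<close>. For
  \<open>k = 0\<close> the weight vanishes, so the truncated subtraction is harmless.\<close>

lemma q_deriv:
  assumes t: "0 \<le> t"
  shows "summable (\<lambda>k. weight k * q_term k t)"
    and "(q has_real_derivative - (\<Sum>k. weight k * q_term k t)) (at t within {0..})"
proof -
  let ?f = "\<lambda>k. real k * rate k * pmf \<mu> k * exp (- rate k * t) * exp (- (real k - 2) * \<tau> t)"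
  have e: "weight k * q_term k t = exp (- \<tau> t) / m * ?f k" for k
  proof (cases k)
    case (Suc i)
    have "q t ^ i = exp (- real i * \<tau> t)"
      using t by (simp add: q_def max_def exp_of_nat_mult[symmetric])
    moreover have "exp (- \<tau> t) * exp (- (real k - 2) * \<tau> t) = exp (- real i * \<tau> t)"
      unfolding exp_add[symmetric] Suc by (simp add: algebra_simps)
    ultimately have "q t ^ i = exp (- \<tau> t) * exp (- (real k - 2) * \<tau> t)"
      by simp
    then have "weight k * q_term k t = weight k * (rate k * exp (- rate k * t) * (exp (- \<tau> t) * exp (- (real k - 2) * \<tau> t)))"
      by (simp add: q_term_def Suc)
    then show ?thesis
      by (simp only: weight_def times_divide_eq_left times_divide_eq_right mult_ac)
  qed (simp add: weight_def)
  have s: "summable ?f"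
    by (rule ode_terms(1)[OF t \<tau>_nonneg[OF t]])
  show "summable (\<lambda>k. weight k * q_term k t)"
    unfolding e by (rule summable_mult[OF s])
  have sum: "(\<Sum>k. weight k * q_term k t) = exp (- \<tau> t) * (1 / m * suminf ?f)"
    unfolding e by (subst suminf_mult[OF s]) simp
  have "((\<lambda>t. exp (- \<tau> t)) has_real_derivative exp (- \<tau> t) * - (1 / m * suminf ?f)) (at t within {0..})"
    by (intro derivative_intros \<tau>_ode t)
  then have "((\<lambda>t. exp (- \<tau> t)) has_real_derivative - (\<Sum>k. weight k * q_term k t)) (at t within {0..})"
    by (simp add: sum)
  then show "(q has_real_derivative - (\<Sum>k. weight k * q_term k t)) (at t within {0..})"
    by (rule has_field_derivative_transform_within[OF _ zero_less_one])
      (use t in \<open>auto simp: q_def max_def\<close>)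
qed

text \<open>The density vanishes at negative times and the end point \<open>t\<close> is a null set.
  This passes from expectations over clocks to gauge integrals, for which the fundamental theorem of
  calculus is used.\<close>

lemma integral_D_eq:
  assumes f[measurable]: "f \<in> borel_measurable borel" and c: "continuous_on {0..t} f" and t: "0 \<le> t"
  shows "(\<integral>s. indicator {..<t} s * f s \<partial>D k) = integral {0..t} (\<lambda>s. rate k * exp (- rate k * s) * f s)"
proof -
  let ?g = "\<lambda>s. rate k * exp (- rate k * s) * f s"
  have nn: "0 \<le> exponential_density (rate k) s" for s
    using rate_pos[of k] by (simp add: exponential_density_def)
  have "(\<integral>s. indicator {..<t} s * f s \<partial>D k) = (\<integral>s. exponential_density (rate k) s * (indicator {..<t} s * f s) \<partial>lborel)"
    using nn by (subst integral_density) auto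
  also have "\<dots> = (\<integral>s. indicator {0..t} s * ?g s \<partial>lborel)"
  proof (rule Bochner_Integration.integral_cong_AE)
    show "AE s in lborel. exponential_density (rate k) s * (indicator {..<t} s * f s) = indicator {0..t} s * ?g s"
      using AE_lborel_singleton[of t]
      by eventually_elim (auto simp: indicator_def exponential_density_def mult_ac)
  qed measurable
  also have "\<dots> = (LBINT s:{0..t}. ?g s)"
    by (simp add: set_lebesgue_integral_def)
  also have "\<dots> = integral {0..t} ?g"
    by (intro set_borel_integral_eq_integral borel_integrable_atLeastAtMost' continuous_intros c)
  finally show ?thesis .
qed

lemma integral_q_term:
  assumes "0 \<le> t"
  shows "integral {0..t} (q_term k) = (\<integral>s. indicator {..<t} s * q s ^ (k - 1) \<partial>D k)"
    and "integral {0..t} (q_term k) \<in> {0..1}"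
proof -
  show e: "integral {0..t} (q_term k) = (\<integral>s. indicator {..<t} s * q s ^ (k - 1) \<partial>D k)"
    unfolding q_term_def using assms continuous_q
    by (intro integral_D_eq[symmetric]) (auto intro!: continuous_intros intro: continuous_on_subset)
  show "integral {0..t} (q_term k) \<in> {0..1}"
    unfolding e
    by (intro integral_in_unit) (use q_bounds in \<open>auto simp: indicator_def intro: power_le_one\<close>)
qed

definition weight_tail :: "nat \<Rightarrow> real" where
  "weight_tail K = 1 - sum weight {..K}"

lemma weight_tail_nonneg: "0 \<le> weight_tail K"
  using sum_weight_le by (simp add: weight_tail_def)

lemma weight_tail_tendsto: "weight_tail \<longlonglongrightarrow> 0"
  using tendsto_diff[OF tendsto_const weight_sums[unfolded sums_def_le], of 1]
  by (simp add: weight_tail_def[abs_def])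

text \<open>The partial sums up to \<open>K'\<close> solve the equation up to an error that is uniformly small in \<open>K'\<close>, and
  the terms between \<open>K\<close> and \<open>K'\<close> contribute at most the weight beyond \<open>K\<close>.\<close>

lemma q_partial_equation:
  assumes t: "0 \<le> t"
  shows "\<bar>q t - (1 - (\<Sum>k\<le>K. weight k * integral {0..t} (q_term k)))\<bar> \<le> weight_tail K"
proof -
  let ?G = "\<lambda>K t. 1 - (\<Sum>k\<le>K. weight k * integral {0..t} (q_term k))"
  let ?R = "\<lambda>k. weight k * rate k"
  let ?r = "\<lambda>K. suminf ?R - sum ?R {..K}"
  have 1: "\<bar>?G K' t - q t\<bar> \<le> ?r K' * t" for K'
  proof -
    \<comment> \<open>The derivative of the difference is the tail beyond \<open>K'\<close> of
      \<open>weight k * q_term k s\<close>, which the tail of \<open>weight k * rate k\<close>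
      bounds for all \<open>s\<close> at once.\<close>
    have "norm ((?G K' t - q t) - (?G K' 0 - q 0)) \<le> ?r K' * norm (t - 0)"
    proof (rule field_differentiable_bound[where S = "{0..t}" and f' = "\<lambda>s. (\<Sum>k. weight k * q_term k s) - (\<Sum>k\<le>K'. weight k * q_term k s)"])
      fix s assume s: "s \<in> {0..t}"
      have "((\<lambda>t. ?G K' t - q t) has_real_derivative
          (0 - (\<Sum>k\<le>K'. weight k * q_term k s)) - - (\<Sum>k. weight k * q_term k s)) (at s within {0..t})"
        using s
        by (intro derivative_intros DERIV_cmult integral_has_real_derivative continuous_q_term
            has_field_derivative_subset[OF q_deriv(2)]) auto
      then show "((\<lambda>t. ?G K' t - q t) has_real_derivative
          (\<Sum>k. weight k * q_term k s) - (\<Sum>k\<le>K'. weight k * q_term k s)) (at s within {0..t})"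
        by (simp add: algebra_simps)
      have s0: "0 \<le> s"
        using s by simp
      have le: "weight k * q_term k s \<le> ?R k" "0 \<le> weight k * q_term k s" for k
        using q_term_bounds[OF s0, of k] weight_nonneg[of k] by (auto intro: mult_left_mono)
      have split: "suminf f - sum f {..K'} = (\<Sum>k. f (k + Suc K'))" if "summable f" for f :: "nat \<Rightarrow> real"
        using suminf_split_initial_segment[OF that, of "Suc K'"] by (simp add: lessThan_Suc_atMost)
      have sh: "summable (\<lambda>k. f (k + Suc K'))" if "summable f" for f :: "nat \<Rightarrow> real"
        using that by (rule summable_ignore_initial_segment)
      have "(\<Sum>k. weight (k + Suc K') * q_term (k + Suc K') s) \<le> (\<Sum>k. ?R (k + Suc K'))"
        using sh[OF q_deriv(1)[OF s0]] sh[OF weight_rate_summable] le(1) by (intro suminf_le) auto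
      moreover have "0 \<le> (\<Sum>k. weight (k + Suc K') * q_term (k + Suc K') s)"
        using sh[OF q_deriv(1)[OF s0]] le(2) by (intro suminf_nonneg) auto
      ultimately show "norm ((\<Sum>k. weight k * q_term k s) - (\<Sum>k\<le>K'. weight k * q_term k s)) \<le> ?r K'"
        using split[OF q_deriv(1)[OF s0]] split[OF weight_rate_summable] by simp
    qed (use t in auto)
    then show ?thesis
      using t by (simp add: q_def \<tau>_0)
  qed
  have 2: "\<bar>?G K t - ?G K' t\<bar> \<le> weight_tail K" if "K \<le> K'" for K'
  proof -
    have "{..K'} = {..K} \<union> {K<..K'}" "{..K} \<inter> {K<..K'} = {}"
      using that by auto
    then have split: "sum f {..K'} = sum f {..K} + sum f {K<..K'}" for f :: "nat \<Rightarrow> real"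
      by (simp add: sum.union_disjoint)
    have "?G K t - ?G K' t = (\<Sum>k\<in>{K<..K'}. weight k * integral {0..t} (q_term k))"
      by (simp add: split)
    moreover have "(\<Sum>k\<in>{K<..K'}. weight k * integral {0..t} (q_term k)) \<le> sum weight {K<..K'}"
      using integral_q_term(2)[OF t] weight_nonneg by (intro sum_mono) (auto intro: mult_left_le)
    moreover have "0 \<le> (\<Sum>k\<in>{K<..K'}. weight k * integral {0..t} (q_term k))"
      using integral_q_term(2)[OF t] weight_nonneg by (intro sum_nonneg) auto
    moreover have "sum weight {K<..K'} \<le> weight_tail K"
      using sum_weight_le[of K'] by (simp add: split weight_tail_def)
    ultimately show ?thesis
      by linarith
  qed
  have lim: "(\<lambda>K'. weight_tail K + ?r K' * t) \<longlonglongrightarrow> weight_tail K + (suminf ?R - suminf ?R) * t"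
    using summable_LIMSEQ'[OF weight_rate_summable] by (intro tendsto_intros)
  have "\<forall>\<^sub>F K' in sequentially. \<bar>q t - ?G K t\<bar> \<le> weight_tail K + ?r K' * t"
    using eventually_ge_at_top[of K]
  proof eventually_elim
    case (elim K')
    then show ?case
      using 1[of K'] 2[OF elim] by linarith
  qed
  from tendsto_lowerbound[OF lim this] show ?thesis
    by simp
qed

text \<open>The time scale of the iteration: its derivative is the Lipschitz rate of the integral
  operator. As each exponential law has mass one, it stays below the second moment over
  \<open>m\<close>, for any rates and over the infinite horizon.\<close>

definition growth :: "nat \<Rightarrow> real \<Rightarrow> real" where
  "growth K t = (\<Sum>k\<le>K. weight k * real (k - 1) * (1 - exp (- rate k * max 0 t)))"

definition growth_bound :: real where
  "growth_bound = (\<Sum>k. (real k)\<^sup>2 * pmf \<mu> k) / m"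

lemma growth_bounds: "growth K t \<in> {0..growth_bound}"
proof -
  have 1: "weight k * real (k - 1) * (1 - exp (- rate k * max 0 t)) \<le> (real k)\<^sup>2 * pmf \<mu> k / m" for k
  proof -
    have "weight k * real (k - 1) * (1 - exp (- rate k * max 0 t)) \<le> weight k * real k * 1"
      using weight_nonneg[of k] rate_pos[of k] by (intro mult_mono) auto
    then show ?thesis
      by (simp add: weight_def power2_eq_square mult_ac)
  qed
  have "growth K t \<le> (\<Sum>k\<le>K. (real k)\<^sup>2 * pmf \<mu> k / m)"
    unfolding growth_def by (intro sum_mono 1)
  also have "\<dots> = (\<Sum>k\<le>K. (real k)\<^sup>2 * pmf \<mu> k) / m"
    by (simp add: sum_divide_distrib)
  also have "\<dots> \<le> growth_bound"
    unfolding growth_bound_def using m_gt_0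
    by (intro divide_right_mono sum_le_suminf second_moment) auto
  finally have "growth K t \<le> growth_bound" .
  moreover have "0 \<le> growth K t"
    unfolding growth_def
  proof (intro sum_nonneg mult_nonneg_nonneg weight_nonneg)
    show "0 \<le> 1 - exp (- rate k * max 0 t)" for k
      using mult_nonneg_nonneg[of "rate k" "max 0 t"] rate_pos[of k] by simp
  qed simp
  ultimately show ?thesis
    by simp
qed

lemma growth_deriv:
  assumes "s \<in> {0..t}"
  shows "(growth K has_real_derivative (\<Sum>k\<le>K. weight k * real (k - 1) * (rate k * exp (- rate k * s)))) (at s within {0..t})"
proof -
  have "((\<lambda>s. \<Sum>k\<le>K. weight k * real (k - 1) * (1 - exp (- rate k * s))) has_real_derivative
      (\<Sum>k\<le>K. weight k * real (k - 1) * (0 - exp (- rate k * s) * (- rate k * 1)))) (at s within {0..t})"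
    by (intro derivative_intros DERIV_cmult)
  then have "((\<lambda>s. \<Sum>k\<le>K. weight k * real (k - 1) * (1 - exp (- rate k * s))) has_real_derivative
      (\<Sum>k\<le>K. weight k * real (k - 1) * (rate k * exp (- rate k * s)))) (at s within {0..t})"
    by (simp add: mult_ac)
  then show ?thesis
    by (rule has_field_derivative_transform_within[OF _ zero_less_one])
      (use assms in \<open>auto simp: growth_def max_def\<close>)
qed

lemma continuous_growth: "continuous_on A (growth K)"
  unfolding growth_def by (intro continuous_intros)

lemma measurable_growth[measurable]: "growth K \<in> borel_measurable borel"
  by (rule borel_measurable_continuous_onI[OF continuous_growth])

text \<open>The exact solution of the linear iteration in \<open>picard_step\<close>: the
  exponential absorbs the constant source, as in Gronwall's inequality, and the initial error
  \<open>1\<close> becomes \<open>growth K t ^ j / fact j\<close>. Of the two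
  \<open>weight_tail K\<close>, one is the truncation of the equation for \<open>q\<close>, the
  other the trivial answers beyond the cutoff.\<close>

definition picard_bound :: "nat \<Rightarrow> nat \<Rightarrow> real \<Rightarrow> real" where
  "picard_bound K j t = 2 * weight_tail K * exp (growth K t) + growth K t ^ j / fact j"

lemma picard_bound_nonneg: "0 \<le> picard_bound K j t"
  using growth_bounds[of K t] weight_tail_nonneg[of K] by (simp add: picard_bound_def)

lemma picard_bound_le: "picard_bound K j t \<le> 2 * weight_tail K * exp growth_bound + growth_bound ^ j / fact j"
  unfolding picard_bound_def using growth_bounds[of K t] weight_tail_nonneg[of K]
  by (intro add_mono mult_left_mono divide_right_mono power_mono) auto

lemma measurable_picard_bound[measurable]: "picard_bound K j \<in> borel_measurable borel"
  unfolding picard_bound_def by measurable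

lemma picard_step:
  assumes t: "0 \<le> t"
  shows "2 * weight_tail K + (\<Sum>k\<le>K. weight k * (real (k - 1) * (\<integral>s. indicator {..<t} s * picard_bound K j s \<partial>D k)))
    = picard_bound K (Suc j) t"
proof -
  let ?a = "\<lambda>s. \<Sum>k\<le>K. weight k * real (k - 1) * (rate k * exp (- rate k * s))"
  have c: "continuous_on {0..t} (picard_bound K j)"
    unfolding picard_bound_def by (intro continuous_intros continuous_growth) auto
  have "(\<Sum>k\<le>K. weight k * (real (k - 1) * (\<integral>s. indicator {..<t} s * picard_bound K j s \<partial>D k)))
      = (\<Sum>k\<le>K. integral {0..t} (\<lambda>s. weight k * real (k - 1) * (rate k * exp (- rate k * s)) * picard_bound K j s))"
  proof (rule sum.cong[OF refl])
    fix k
    have "integral {0..t} (\<lambda>s. weight k * real (k - 1) * (rate k * exp (- rate k * s)) * picard_bound K j s)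
        = integral {0..t} (\<lambda>s. (weight k * real (k - 1)) *\<^sub>R (rate k * exp (- rate k * s) * picard_bound K j s))"
      by (simp add: mult.assoc)
    also have "\<dots> = weight k * real (k - 1) * integral {0..t} (\<lambda>s. rate k * exp (- rate k * s) * picard_bound K j s)"
      by (subst integral_cmul) simp
    finally show "weight k * (real (k - 1) * (\<integral>s. indicator {..<t} s * picard_bound K j s \<partial>D k))
        = integral {0..t} (\<lambda>s. weight k * real (k - 1) * (rate k * exp (- rate k * s)) * picard_bound K j s)"
      by (simp add: integral_D_eq[OF measurable_picard_bound c t])
  qed
  also have "\<dots> = integral {0..t} (\<lambda>s. ?a s * picard_bound K j s)"
    unfolding sum_distrib_right
    by (intro Henstock_Kurzweil_Integration.integral_sum[symmetric] integrable_continuous_interval continuous_intros c) auto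
  also have "\<dots> = picard_bound K (Suc j) t - picard_bound K (Suc j) 0"
  proof (rule integral_unique, rule fundamental_theorem_of_calculus[OF t])
    fix s assume s: "s \<in> {0..t}"
    have "((\<lambda>s. 2 * weight_tail K * exp (growth K s) + growth K s ^ Suc j / fact (Suc j)) has_real_derivative
        2 * weight_tail K * (exp (growth K s) * ?a s)
          + real (Suc j) * (?a s * growth K s ^ (Suc j - Suc 0)) / fact (Suc j)) (at s within {0..t})"
    proof (intro DERIV_add DERIV_cmult DERIV_cdivide)
      show "((\<lambda>s. exp (growth K s)) has_real_derivative exp (growth K s) * ?a s) (at s within {0..t})"
        by (intro derivative_intros growth_deriv[OF s])
      show "((\<lambda>s. growth K s ^ Suc j) has_real_derivative real (Suc j) * (?a s * growth K s ^ (Suc j - Suc 0))) (at s within {0..t})"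
        by (rule DERIV_power[OF growth_deriv[OF s]])
    qed
    moreover have "2 * weight_tail K * (exp (growth K s) * x) + real (Suc j) * (x * growth K s ^ (Suc j - Suc 0)) / fact (Suc j)
        = x * picard_bound K j s" for x
    proof -
      have "real (Suc j) * (x * growth K s ^ (Suc j - Suc 0)) / fact (Suc j) = x * (growth K s ^ j / fact j)"
        by (simp add: field_simps del: of_nat_Suc)
      then show ?thesis
        by (simp add: picard_bound_def algebra_simps)
    qed
    ultimately have "(picard_bound K (Suc j) has_real_derivative ?a s * picard_bound K j s) (at s within {0..t})"
      by (simp add: picard_bound_def[abs_def])
    then show "(picard_bound K (Suc j) has_vector_derivative ?a s * picard_bound K j s) (at s within {0..t})"
      by (simp add: has_real_derivative_iff_has_vector_derivative)
  qed
  \<comment> \<open>\<open>growth K 0 = 0\<close>, and the exponent \<open>Suc j\<close> is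
    positive.\<close>
  also have "picard_bound K (Suc j) 0 = 2 * weight_tail K"
    by (simp add: picard_bound_def growth_def)
  finally show ?thesis
    by simp
qed

end

section \<open>Comparison of the recursion with the equation\<close>

context sda_limit
begin

lemma lim_msg_bounds: "lim_msg K j t \<in> {0..1}"
  and measurable_lim_msg[measurable]: "lim_msg K j \<in> borel_measurable borel"
  using lim_msg_props by blast+

lemma AE_D_nonneg: "AE s in D k. 0 \<le> s"
  by (simp add: AE_density exponential_density_def)

lemma D_no_atoms: "measure (D k) {x} = 0"
proof -
  have "AE s in D k. s \<noteq> x"
    using AE_lborel_singleton[of x] by (simp add: AE_density) (auto elim: eventually_mono)
  then have "AE s in D k. s \<notin> {x}"
    by simp
  then have "{x} \<in> null_sets (D k)"
    by (subst AE_iff_null_sets) auto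
  then show ?thesis
    by (simp add: null_sets_def measure_def)
qed

text \<open>Powers with exponent \<open>i\<close> are \<open>i\<close>-Lipschitz on the unit
  interval. The estimate by \<open>b\<close> is asked for at nonnegative times, which carry all the
  mass of \<open>D k\<close>.\<close>

lemma abs_integral_power_diff_le:
  assumes [measurable]: "f \<in> borel_measurable borel" "g \<in> borel_measurable borel" "b \<in> borel_measurable borel"
    and f: "\<And>s. f s \<in> {0..1::real}" and g: "\<And>s. g s \<in> {0..1}"
    and A[measurable]: "A \<in> sets borel"
    and b: "\<And>s. 0 \<le> s \<Longrightarrow> s \<in> A \<Longrightarrow> \<bar>f s - g s\<bar> \<le> b s" "\<And>s. b s \<in> {0..B}"
  shows "\<bar>(\<integral>s. indicator A s * f s ^ i \<partial>D k) - (\<integral>s. indicator A s * g s ^ i \<partial>D k)\<bar>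
    \<le> real i * (\<integral>s. indicator A s * b s \<partial>D k)"
proof -
  interpret prob_space "D k"
    by (rule prob_D)
  have int: "integrable (D k) (\<lambda>s. indicator A s * h s ^ i)" if "h \<in> borel_measurable borel" "\<And>s. h s \<in> {0..1}" for h :: "real \<Rightarrow> real"
  proof (rule integrable_of_bounded[where B = 1])
    have "\<bar>h s ^ i\<bar> \<le> 1" for s
      using that(2)[of s] by (simp add: power_abs[symmetric] power_le_one)
    then show "\<bar>indicator A s * h s ^ i\<bar> \<le> 1" for s
      by (simp add: indicator_def)
  qed (use that(1) in measurable)
  have intb: "integrable (D k) (\<lambda>s. indicator A s * b s)"
  proof (rule integrable_of_bounded[where B = B])
    show "\<bar>indicator A s * b s\<bar> \<le> B" for s
      using b(2)[of s] by (auto simp: indicator_def)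
  qed measurable
  have "\<bar>(\<integral>s. indicator A s * f s ^ i \<partial>D k) - (\<integral>s. indicator A s * g s ^ i \<partial>D k)\<bar>
      = \<bar>\<integral>s. indicator A s * f s ^ i - indicator A s * g s ^ i \<partial>D k\<bar>"
    using int f g by simp
  also have "\<dots> \<le> (\<integral>s. \<bar>indicator A s * f s ^ i - indicator A s * g s ^ i\<bar> \<partial>D k)"
    by (rule integral_abs_bound)
  also have "\<dots> \<le> (\<integral>s. real i * (indicator A s * b s) \<partial>D k)"
  proof (rule integral_mono_AE)
    show "integrable (D k) (\<lambda>s. \<bar>indicator A s * f s ^ i - indicator A s * g s ^ i\<bar>)"
      using int f g by simp
    show "integrable (D k) (\<lambda>s. real i * (indicator A s * b s))"
      using intb by simp
    show "AE s in D k. \<bar>indicator A s * f s ^ i - indicator A s * g s ^ i\<bar> \<le> real i * (indicator A s * b s)"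
      using AE_D_nonneg
    proof eventually_elim
      case (elim s)
      have "\<bar>f s ^ i - g s ^ i\<bar> \<le> real i * \<bar>f s - g s\<bar>"
        using norm_power_diff[of "f s" "g s" i] f[of s] g[of s] by simp
      also have "\<dots> \<le> real i * b s" if "s \<in> A"
        using b(1)[OF elim that] by (intro mult_left_mono) auto
      finally show ?case
        by (auto simp: indicator_def)
    qed
  qed
  finally show ?thesis
    by simp
qed

text \<open>\<open>1 - lim_msg K j\<close> is the \<open>j\<close>-th iterate. At the start both
  functions lie in the unit interval and \<open>growth K t ^ 0 / fact 0\<close> is one; afterwards
  the powers \<open>k - 1\<close> produce the Lipschitz constants that are built into
  \<open>growth\<close>.\<close>

lemma picard:
  assumes "0 \<le> t"
  shows "\<bar>(1 - lim_msg K j t) - q t\<bar> \<le> picard_bound K j t"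
  using assms
proof (induction j arbitrary: t)
  case 0
  have "\<bar>(1 - lim_msg K 0 t) - q t\<bar> \<le> 1"
    using lim_msg_bounds[of K 0 t] q_bounds[of t] unfolding atLeastAtMost_iff by linarith
  moreover have "1 \<le> picard_bound K 0 t"
    using weight_tail_nonneg[of K] by (simp add: picard_bound_def)
  ultimately show ?case
    by linarith
next
  case (Suc j)
  let ?c = "of_bool (odd j) :: real"
  define I where "I k = (\<integral>s. indicator {..<t} s * (1 - lim_msg K j s) ^ (k - 1) \<partial>D k)" for k
  define J where "J k = integral {0..t} (q_term k)" for k
  define B where "B k = (\<integral>s. indicator {..<t} s * picard_bound K j s \<partial>D k)" for k
  have "lim_msg K (Suc j) t = ?c + ((\<Sum>k\<le>K. weight k * I k) - ?c * sum weight {..K})"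
    by (simp add: I_def right_diff_distrib sum_subtractf sum_distrib_left mult.commute)
  \<comment> \<open>The trivial answers contribute \<open>?c * weight_tail K\<close>, which is
    present at every second depth.\<close>
  then have e: "1 - lim_msg K (Suc j) t = 1 - (\<Sum>k\<le>K. weight k * I k) - ?c * weight_tail K"
    by (simp add: weight_tail_def algebra_simps)
  have IJ: "\<bar>I k - J k\<bar> \<le> real (k - 1) * B k" for k
    unfolding I_def J_def B_def integral_q_term(1)[OF Suc.prems]
  proof (rule abs_integral_power_diff_le)
    show "1 - lim_msg K j s \<in> {0..1}" for s
      using lim_msg_bounds[of K j s] by simp
    show "\<bar>1 - lim_msg K j s - q s\<bar> \<le> picard_bound K j s" if "0 \<le> s" for s
      using Suc.IH[OF that] .
    show "picard_bound K j s \<in> {0..2 * weight_tail K * exp growth_bound + growth_bound ^ j / fact j}" for s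
      using picard_bound_nonneg picard_bound_le by simp
    show "(\<lambda>s. 1 - lim_msg K j s) \<in> borel_measurable borel"
      by measurable
  qed (use q_bounds in auto)
  have "\<bar>(\<Sum>k\<le>K. weight k * I k) - (\<Sum>k\<le>K. weight k * J k)\<bar> \<le> (\<Sum>k\<le>K. weight k * (real (k - 1) * B k))"
    unfolding sum_subtractf[symmetric] right_diff_distrib[symmetric]
    by (rule order_trans[OF sum_abs]) (intro sum_mono, simp only: abs_mult abs_of_nonneg[OF weight_nonneg],
        intro mult_left_mono IJ weight_nonneg)
  moreover have "\<bar>q t - (1 - (\<Sum>k\<le>K. weight k * J k))\<bar> \<le> weight_tail K"
    unfolding J_def by (rule q_partial_equation[OF Suc.prems])
  moreover have "0 \<le> ?c * weight_tail K" "?c * weight_tail K \<le> weight_tail K"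
    using weight_tail_nonneg[of K] by auto
  moreover have "2 * weight_tail K + (\<Sum>k\<le>K. weight k * (real (k - 1) * B k)) = picard_bound K (Suc j) t"
    unfolding B_def by (rule picard_step[OF Suc.prems])
  ultimately show ?case
    unfolding e by linarith
qed

section \<open>The limiting proportion of active vertices\<close>

definition pmf_tail :: "nat \<Rightarrow> real" where
  "pmf_tail K = 1 - sum (pmf \<mu>) {..K}"

lemma sum_pmf_eq: "sum (pmf \<mu>) {..K} = measure \<mu> {..K}"
  by (simp add: measure_measure_pmf_finite)

lemma pmf_sums: "pmf \<mu> sums 1"
proof -
  have "(\<lambda>K. measure \<mu> {..K}) \<longlonglongrightarrow> measure \<mu> (\<Union>K. {..K})"
    by (rule measure_pmf.finite_Lim_measure_incseq) (auto simp: incseq_def)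
  moreover have "(\<Union>K. {..K}) = (UNIV :: nat set)"
    by auto
  ultimately show ?thesis
    by (simp add: sums_def_le sum_pmf_eq)
qed

lemma pmf_tail_nonneg: "0 \<le> pmf_tail K"
  by (simp add: pmf_tail_def sum_pmf_eq)

lemma pmf_tail_tendsto: "pmf_tail \<longlonglongrightarrow> 0"
  using tendsto_diff[OF tendsto_const pmf_sums[unfolded sums_def_le], of 1]
  by (simp add: pmf_tail_def[abs_def])

text \<open>A vertex of degree \<open>k\<close> with clock \<open>s\<close> is active in the limit
  with probability \<open>q s ^ k\<close>, all its edges being silent at that time.\<close>

definition limit_proportion :: real where
  "limit_proportion = (\<Sum>k. pmf \<mu> k * (\<integral>s. q s ^ k \<partial>D k))"

lemma integral_q_power_bounds: "(\<integral>s. q s ^ k \<partial>D k) \<in> {0..1}"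
  by (intro integral_in_unit) (use q_bounds in \<open>auto intro: power_le_one\<close>)

lemma limit_proportion_summable: "summable (\<lambda>k. pmf \<mu> k * (\<integral>s. q s ^ k \<partial>D k))"
proof (rule summable_comparison_test')
  show "summable (pmf \<mu>)"
    using pmf_sums by (rule sums_summable)
  show "norm (pmf \<mu> k * (\<integral>s. q s ^ k \<partial>D k)) \<le> pmf \<mu> k" if "k \<ge> 0" for k
    using integral_q_power_bounds[of k] by (auto simp: abs_mult intro: mult_left_le)
qed

lemma limit_proportion_partial:
  "\<bar>limit_proportion - (\<Sum>k\<le>K. pmf \<mu> k * (\<integral>s. q s ^ k \<partial>D k))\<bar> \<le> pmf_tail K"
proof -
  let ?f = "\<lambda>k. pmf \<mu> k * (\<integral>s. q s ^ k \<partial>D k)"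
  have split: "suminf f - sum f {..K} = (\<Sum>k. f (k + Suc K))" if "summable f" for f :: "nat \<Rightarrow> real"
    using suminf_split_initial_segment[OF that, of "Suc K"] by (simp add: lessThan_Suc_atMost)
  have sf: "summable (\<lambda>k. ?f (k + Suc K))"
    using limit_proportion_summable by (rule summable_ignore_initial_segment)
  have sp: "summable (\<lambda>k. pmf \<mu> (k + Suc K))"
    using sums_summable[OF pmf_sums] by (rule summable_ignore_initial_segment)
  have le: "?f k \<le> pmf \<mu> k" "0 \<le> ?f k" for k
    using integral_q_power_bounds[of k] by (auto intro: mult_left_le)
  have "(\<Sum>k. ?f (k + Suc K)) \<le> (\<Sum>k. pmf \<mu> (k + Suc K))"
    by (rule suminf_le[OF le(1) sf sp])
  moreover have "0 \<le> (\<Sum>k. ?f (k + Suc K))"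
    by (rule suminf_nonneg[OF sf le(2)])
  ultimately show ?thesis
    using split[OF limit_proportion_summable] split[OF sums_summable[OF pmf_sums]] sums_unique[OF pmf_sums]
    by (simp add: limit_proportion_def pmf_tail_def)
qed

text \<open>For vertices the degree law is \<mu> without size bias, and the Lipschitz constants
  \<open>k\<close> average to \<open>m\<close>. One \<open>pmf_tail\<close> comes from the truncated
  series, the other from the trivial answers.\<close>

lemma lim_active_approx:
  "\<bar>lim_active K j - limit_proportion\<bar>
    \<le> 2 * pmf_tail K + m * (2 * weight_tail K * exp growth_bound + growth_bound ^ j / fact j)"
proof -
  let ?c = "of_bool (odd j) :: real"
  let ?B = "2 * weight_tail K * exp growth_bound + growth_bound ^ j / fact j"
  define I where "I k = (\<integral>s. (1 - lim_msg K j s) ^ k \<partial>D k)" for k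
  define J where "J k = (\<integral>s. q s ^ k \<partial>D k)" for k
  have B: "0 \<le> ?B"
    using picard_bound_nonneg[of K j 0] picard_bound_le[of K j 0] by linarith
  have "lim_active K j = ?c + ((\<Sum>k\<le>K. pmf \<mu> k * I k) - ?c * sum (pmf \<mu>) {..K})"
    by (simp add: lim_active_def I_def right_diff_distrib sum_subtractf sum_distrib_left mult.commute)
  then have e: "lim_active K j = (\<Sum>k\<le>K. pmf \<mu> k * I k) + ?c * pmf_tail K"
    by (simp add: pmf_tail_def algebra_simps)
  have IJ: "\<bar>I k - J k\<bar> \<le> real k * ?B" for k
  proof -
    interpret prob_space "D k"
      by (rule prob_D)
    have "\<bar>(\<integral>s. indicator UNIV s * (1 - lim_msg K j s) ^ k \<partial>D k) - (\<integral>s. indicator UNIV s * q s ^ k \<partial>D k)\<bar>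
        \<le> real k * (\<integral>s. indicator UNIV s * ?B \<partial>D k)"
    proof (rule abs_integral_power_diff_le)
      show "1 - lim_msg K j s \<in> {0..1}" for s
        using lim_msg_bounds[of K j s] by simp
      show "\<bar>1 - lim_msg K j s - q s\<bar> \<le> ?B" if "0 \<le> s" for s
        using picard[OF that, of K j] picard_bound_le[of K j s] by linarith
      show "?B \<in> {0..?B}"
        using B by simp
      show "(\<lambda>s. 1 - lim_msg K j s) \<in> borel_measurable borel"
        by measurable
    qed (use q_bounds in auto)
    moreover have "prob UNIV = 1"
      using prob_space by simp
    ultimately show ?thesis
      unfolding I_def J_def by simp
  qed
  have "\<bar>(\<Sum>k\<le>K. pmf \<mu> k * I k) - (\<Sum>k\<le>K. pmf \<mu> k * J k)\<bar> \<le> (\<Sum>k\<le>K. pmf \<mu> k * (real k * ?B))"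
    unfolding sum_subtractf[symmetric] right_diff_distrib[symmetric]
    by (rule order_trans[OF sum_abs]) (intro sum_mono, simp only: abs_mult abs_of_nonneg[OF pmf_nonneg],
        intro mult_left_mono IJ pmf_nonneg)
  also have "\<dots> = (\<Sum>k\<le>K. real k * pmf \<mu> k) * ?B"
    unfolding sum_distrib_right by (intro sum.cong) (simp_all add: mult_ac)
  also have "\<dots> \<le> m * ?B"
  proof (intro mult_right_mono B)
    show "(\<Sum>k\<le>K. real k * pmf \<mu> k) \<le> m"
      unfolding sums_unique[OF first_moment]
      by (rule sum_le_suminf) (auto intro: sums_summable[OF first_moment])
  qed
  finally have "\<bar>(\<Sum>k\<le>K. pmf \<mu> k * I k) - (\<Sum>k\<le>K. pmf \<mu> k * J k)\<bar> \<le> m * ?B" .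
  moreover have "\<bar>limit_proportion - (\<Sum>k\<le>K. pmf \<mu> k * J k)\<bar> \<le> pmf_tail K"
    unfolding J_def by (rule limit_proportion_partial)
  moreover have "0 \<le> ?c * pmf_tail K" "?c * pmf_tail K \<le> pmf_tail K"
    using pmf_tail_nonneg[of K] by auto
  ultimately show ?thesis
    unfolding e by linarith
qed

text \<open>Sum and integral may be exchanged because the terms are nonnegative and their integrals
  summable.\<close>

lemma limit_proportion_eq:
  "(LBINT t:{0..}. \<Sum>k. rate k * pmf \<mu> k * exp (- rate k * t) * exp (- real k * \<tau> t)) = limit_proportion"
proof -
  define f where "f k t = pmf \<mu> k * (exponential_density (rate k) t * q t ^ k)" for k t
  have nn: "0 \<le> exponential_density (rate k) s" for k s
    using rate_pos[of k] by (simp add: exponential_density_def)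
  have f_nn: "0 \<le> f k t" for k t
    unfolding f_def using nn q_bounds[of t] by simp
  have f_eq: "f k t = indicator {0..} t * (rate k * pmf \<mu> k * exp (- rate k * t) * exp (- real k * \<tau> t))" for k t
    by (simp add: f_def exponential_density_def q_def indicator_def exp_of_nat_mult[symmetric] mult_ac)
  have int: "integrable lborel (\<lambda>t. exponential_density (rate k) t * q t ^ k)" for k
  proof -
    interpret prob_space "D k"
      by (rule prob_D)
    have "integrable (D k) (\<lambda>s. q s ^ k)"
    proof (rule integrable_of_bounded[where B = 1])
      show "\<bar>q s ^ k\<bar> \<le> 1" for s
        using q_bounds[of s] by (simp add: power_abs[symmetric] power_le_one)
    qed simp
    then show ?thesis
      using nn by (subst (asm) integrable_density) auto
  qed
  have f_int: "integrable lborel (f k)" for k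
    unfolding f_def using int by simp
  have f_val: "(\<integral>t. f k t \<partial>lborel) = pmf \<mu> k * (\<integral>s. q s ^ k \<partial>D k)" for k
    unfolding f_def using nn by (subst integral_density) auto
  \<comment> \<open>The majorant contains the factor \<open>k\<close>, so it dominates from
    \<open>k = 1\<close> on.\<close>
  have summ: "summable (\<lambda>k. f k t)" for t
  proof (rule summable_comparison_test'[OF rate_summable, of 1])
    fix k :: nat assume k: "k \<ge> 1"
    have "exponential_density (rate k) t \<le> rate k"
      using rate_pos[of k] by (simp add: exponential_density_def)
    then have "exponential_density (rate k) t * q t ^ k \<le> rate k * 1"
      using q_bounds[of t] nn rate_pos[of k] by (intro mult_mono power_le_one) auto
    then have "f k t \<le> pmf \<mu> k * (rate k * 1)"
      unfolding f_def by (intro mult_left_mono) auto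
    also have "\<dots> \<le> real k * rate k * pmf \<mu> k"
      using k rate_pos[of k] mult_right_mono[of 1 "real k" "rate k * pmf \<mu> k"] by (simp add: mult_ac)
    finally show "norm (f k t) \<le> real k * rate k * pmf \<mu> k"
      using f_nn[of k t] by simp
  qed
  have "(LBINT t:{0..}. \<Sum>k. rate k * pmf \<mu> k * exp (- rate k * t) * exp (- real k * \<tau> t)) = (\<integral>t. (\<Sum>k. f k t) \<partial>lborel)"
    unfolding set_lebesgue_integral_def
  proof (rule Bochner_Integration.integral_cong[OF refl])
    fix t :: real
    show "indicator {0..} t *\<^sub>R (\<Sum>k. rate k * pmf \<mu> k * exp (- rate k * t) * exp (- real k * \<tau> t)) = (\<Sum>k. f k t)"
      unfolding f_eq by (cases "0 \<le> t") (simp_all add: indicator_def)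
  qed
  also have "\<dots> = (\<Sum>k. \<integral>t. f k t \<partial>lborel)"
  proof (rule integral_suminf[OF f_int])
    show "AE t in lborel. summable (\<lambda>k. norm (f k t))"
      using summ f_nn by simp
    show "summable (\<lambda>k. \<integral>t. norm (f k t) \<partial>lborel)"
      using limit_proportion_summable f_nn by (simp add: f_val)
  qed
  finally show ?thesis
    by (simp add: f_val limit_proportion_def)
qed

text \<open>The tolerance fixes \<open>K\<close> and the depth before \<open>n\<close> tends to
  infinity; \<open>growth_bound\<close> depends on neither, so the two errors are made small
  separately.\<close>

lemma sda_measure_tendsto:
  assumes \<epsilon>: "\<epsilon> > 0"
  shows "(\<lambda>n. measure (sda_measure n (d n) rate)
    {\<omega> \<in> space (sda_measure n (d n) rate). \<bar>sda_proportion n \<omega> - limit_proportion\<bar> > \<epsilon>}) \<longlonglongrightarrow> 0"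
proof -
  have "(\<lambda>K. 2 * pmf_tail K + m * (2 * weight_tail K * exp growth_bound)) \<longlonglongrightarrow> 2 * 0 + m * (2 * 0 * exp growth_bound)"
    by (intro tendsto_intros pmf_tail_tendsto weight_tail_tendsto)
  then have "\<forall>\<^sub>F K in sequentially. 2 * pmf_tail K + m * (2 * weight_tail K * exp growth_bound) < \<epsilon> / 4"
    using \<epsilon> by (intro order_tendstoD(2)[of _ 0]) auto
  then obtain K where K: "2 * pmf_tail K + m * (2 * weight_tail K * exp growth_bound) < \<epsilon> / 4"
    by (auto simp: eventually_sequentially)
  have "(\<lambda>j. growth_bound ^ j / fact j) \<longlonglongrightarrow> 0"
    using summable_LIMSEQ_zero[OF summable_exp[of growth_bound]] by (simp add: divide_inverse mult.commute)
  then have "(\<lambda>j. m * (growth_bound ^ j / fact j)) \<longlonglongrightarrow> m * 0"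
    by (intro tendsto_intros)
  then have "\<forall>\<^sub>F j in sequentially. m * (growth_bound ^ j / fact j) < \<epsilon> / 4"
    using \<epsilon> by (intro order_tendstoD(2)[of _ 0]) auto
  then obtain J where J: "\<And>j. j \<ge> J \<Longrightarrow> m * (growth_bound ^ j / fact j) < \<epsilon> / 4"
    by (auto simp: eventually_sequentially)
  have near: "\<bar>lim_active K j - limit_proportion\<bar> \<le> \<epsilon> / 2" if "j \<ge> J" for j
    using lim_active_approx[of K j] K J[OF that] by (simp only: distrib_left)
  \<comment> \<open>Two neighbouring depths, one of each parity: the odd one gives the upper bound,
    the even one the lower bound.\<close>
  let ?j = "2 * J + 1" and ?j' = "2 * J"
  let ?e = "\<lambda>n j. E n (\<lambda>\<phi> T. \<bar>clocked_degrees.active_fraction n (d n) K \<phi> T j - lim_active K j\<bar>)"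
  have "(\<lambda>n. (?e n ?j + ?e n ?j') / (\<epsilon> / 2)) \<longlonglongrightarrow> (0 + 0) / (\<epsilon> / 2)"
    using \<epsilon> by (intro tendsto_intros active_fraction_tendsto) auto
  then have lim: "(\<lambda>n. (?e n ?j + ?e n ?j') / (\<epsilon> / 2)) \<longlonglongrightarrow> 0"
    by simp
  show ?thesis
  proof (rule tendsto_sandwich[OF _ _ tendsto_const lim])
    show "\<forall>\<^sub>F n in sequentially. measure (sda_measure n (d n) rate)
        {\<omega> \<in> space (sda_measure n (d n) rate). \<bar>sda_proportion n \<omega> - limit_proportion\<bar> > \<epsilon>}
      \<le> (?e n ?j + ?e n ?j') / (\<epsilon> / 2)"
      using eventually_clocked_degrees
    proof eventually_elim
      case (elim n)
      then interpret clocked_degrees n "d n" K D .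
      show ?case
        unfolding sda_measure_def
        by (rule measure_sda_le) (use D_no_atoms \<epsilon> near in auto)
    qed
  qed simp
qed

end

lemma sda_measure_prob_space_measurable:
  assumes "\<And>k. rate k > 0"
  shows "prob_space (sda_measure n d rate)" "sda_proportion n \<in> borel_measurable (sda_measure n d rate)"
proof -
  \<comment> \<open>The cutoff \<open>0\<close> is a dummy that neither claim mentions. This locale
    makes no assumption on the half-edges, so every \<open>n\<close> is covered.\<close>
  interpret clock_model n d 0 "\<lambda>k. density lborel (exponential_density (rate k))"
    by (rule clock_model.intro) (simp_all add: prob_space_exponential_density assms)
  interpret pair_prob_space "measure_pmf (configuration_model n d)" clocks ..
  show "prob_space (sda_measure n d rate)"
    unfolding sda_measure_def by (rule prob_space_axioms)
  show "sda_proportion n \<in> borel_measurable (sda_measure n d rate)"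
    unfolding sda_measure_def by (rule measurable_sda_proportion)
qed

theorem proposition3p2:
  fixes d :: "nat \<Rightarrow> nat \<Rightarrow> nat"
    and \<mu> :: "nat pmf"
    and \<mu>n :: "nat \<Rightarrow> nat \<Rightarrow> real"
    and m :: real
    and rate :: "nat \<Rightarrow> real"
    and \<tau> :: "real \<Rightarrow> real"
  assumes even_degree_sum: "\<And>n. n \<ge> 1 \<Longrightarrow> even (\<Sum>i<n. d n i)"
    and \<mu>n_eq: "\<And>n. \<mu>n n = empirical_degree_distribution n (d n)"
    and asymptotic_degrees: "\<And>k. (\<lambda>n. \<mu>n n k) \<longlonglongrightarrow> pmf \<mu> k"
    and m_eq: "m = (\<Sum>k. real k * pmf \<mu> k)"
    and m_pos: "m > 0"
    and second_moment_finite: "summable (\<lambda>k. (real k)\<^sup>2 * pmf \<mu> k)"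
    and second_moments: "(\<lambda>n. \<Sum>k. (real k)\<^sup>2 * \<mu>n n k) \<longlonglongrightarrow> (\<Sum>k. (real k)\<^sup>2 * pmf \<mu> k)"
    and rate_pos: "\<And>k. rate k > 0"
    and uniformly_summable:
      "\<exists>\<epsilon> :: nat \<Rightarrow> real. \<epsilon> \<longlonglongrightarrow> 0 \<and>
         (\<forall>n\<ge>1. \<forall>N\<ge>1. (\<Sum>k. real (k + N) * rate (k + N) * \<mu>n n (k + N)) \<le> \<epsilon> N)"
    and \<tau>_0: "\<tau> 0 = 0"
    and \<tau>_ode: "\<And>t. t \<ge> 0 \<Longrightarrow>
      (\<tau> has_real_derivative
         1 / m * (\<Sum>k. real k * rate k * pmf \<mu> k * exp (- rate k * t) * exp (- (real k - 2) * \<tau> t)))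
        (at t within {0..})"
  shows "converges_in_probability
           (\<lambda>n. sda_measure n (d n) rate)
           (\<lambda>n. sda_proportion n)
           (LBINT t:{0..}. \<Sum>k. rate k * pmf \<mu> k * exp (- rate k * t) * exp (- real k * \<tau> t))"
proof -
  have "summable (\<lambda>k. real k * pmf \<mu> k)"
  proof (rule summable_comparison_test'[OF second_moment_finite])
    fix k :: nat
    have "real k \<le> (real k)\<^sup>2"
      by (cases k) (simp_all add: power2_eq_square)
    then show "norm (real k * pmf \<mu> k) \<le> (real k)\<^sup>2 * pmf \<mu> k"
      by (simp add: mult_right_mono)
  qed
  then have first_moment: "(\<lambda>k. real k * pmf \<mu> k) sums m"
    unfolding m_eq by (rule summable_sums)
  \<comment> \<open>With \<open>N = 1\<close> the sum omits just the vanishing term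
    \<open>k = 0\<close>. The bound \<open>\<epsilon> 1\<close> is uniform in \<open>n\<close> and
    passes to the limit on partial sums, as in Fatou's lemma.\<close>
  obtain \<epsilon> where \<epsilon>: "\<And>n. n \<ge> 1 \<Longrightarrow> (\<Sum>k. real (k + 1) * rate (k + 1) * \<mu>n n (k + 1)) \<le> \<epsilon> (1::nat)"
    using uniformly_summable by blast
  have "summable (\<lambda>k. real (k + 1) * rate (k + 1) * pmf \<mu> (k + 1))"
  proof (rule summableI_nonneg_bounded)
    fix M
    show "0 \<le> real (M + 1) * rate (M + 1) * pmf \<mu> (M + 1)"
      using rate_pos[of "M + 1"] by simp
    have lim: "(\<lambda>n. \<Sum>k<M. real (k + 1) * rate (k + 1) * \<mu>n n (k + 1)) \<longlonglongrightarrow> (\<Sum>k<M. real (k + 1) * rate (k + 1) * pmf \<mu> (k + 1))"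
      by (intro tendsto_intros asymptotic_degrees)
    have "(\<Sum>k<M. real (k + 1) * rate (k + 1) * \<mu>n n (k + 1)) \<le> \<epsilon> 1" if n: "n \<ge> 1" for n
    proof -
      have "summable (\<lambda>k. real k * rate k * \<mu>n n k)"
        unfolding \<mu>n_eq using n by (intro sums_summable[OF empirical_degree_sums]) simp
      then have "summable (\<lambda>k. real (k + 1) * rate (k + 1) * \<mu>n n (k + 1))"
        by (rule summable_ignore_initial_segment)
      then have "(\<Sum>k<M. real (k + 1) * rate (k + 1) * \<mu>n n (k + 1)) \<le> (\<Sum>k. real (k + 1) * rate (k + 1) * \<mu>n n (k + 1))"
      proof (rule sum_le_suminf)
        show "0 \<le> real (k + 1) * rate (k + 1) * \<mu>n n (k + 1)" for k
          using rate_pos[of "k + 1"] by (simp add: \<mu>n_eq empirical_degree_distribution_def)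
      qed simp
      then show ?thesis
        using \<epsilon>[OF n] by linarith
    qed
    then show "(\<Sum>k<M. real (k + 1) * rate (k + 1) * pmf \<mu> (k + 1)) \<le> \<epsilon> 1"
      by (intro LIMSEQ_le_const2[OF lim]) blast
  qed
  then have rate_summable: "summable (\<lambda>k. real k * rate k * pmf \<mu> k)"
    by (subst (asm) summable_iff_shift)
  interpret sda_limit d \<mu> m rate \<tau>
  proof (rule sda_limit.intro[OF even_degree_sum _ first_moment m_pos second_moment_finite _ rate_pos rate_summable \<tau>_0 \<tau>_ode])
    show "(\<lambda>n. empirical_degree_distribution n (d n) k) \<longlonglongrightarrow> pmf \<mu> k" for k
      using asymptotic_degrees[of k] by (simp add: \<mu>n_eq)
    show "Bseq (\<lambda>n. \<Sum>k. (real k)\<^sup>2 * empirical_degree_distribution n (d n) k)"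
      using second_moments unfolding \<mu>n_eq by (intro convergent_imp_Bseq convergentI)
  qed
  show ?thesis
    unfolding converges_in_probability_def limit_proportion_eq
    using sda_measure_prob_space_measurable[where rate = rate, OF rate_pos] sda_measure_tendsto by blast
qed

end
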